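(* Let $A$ be an artin algebra. Let $I$ be an indecomposable injective module in $\mathrm{mod}\,A$ with a proper quotient $I/N$ such that $\mathrm{soc}^s(I/N)$ is uniserial and $(\mathrm{soc}^{s+1}I+N)/N\not\subseteq \mathrm{soc}^{s-1}(I/N)$, for some $s\ge 1$. Write $\mathrm{soc}^{s-1}(I/N)=L/N$ and $\mathrm{soc}^s(I/N)=M/N$ with $N\subseteq L\subseteq M\subseteq I$. If $\mathrm{top}^{s+1}(P_{\mathrm{top}(\mathrm{soc}^s(I/N))})$ is uniserial, then there exists an almost split sequence $$0\longrightarrow L\xrightarrow{(q_1,\,p_1)^T} M\oplus \mathrm{soc}^{s-1}(I/N)\xrightarrow{(p_2,\,-q_2)} \mathrm{soc}^s(I/N)\longrightarrow 0$$ in $\mathrm{mod}\,A$, where $q_1,q_2$ are inclusion maps and $p_1,p_2$ are canonical projections.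
   Context: $A$ is an artin algebra with Jacobson radical $J$; $\mathrm{mod}\,A$ is the category of finitely generated left $A$-modules. For a module $X$ and $i\ge 0$: $\mathrm{top}\,X=X/JX$; $\mathrm{top}^iX=X/J^iX$; $\mathrm{soc}^iX$ is the $i$-th term of the socle series, i.e. $\mathrm{soc}^0X=0$ and $\mathrm{soc}^iX/\mathrm{soc}^{i-1}X=\mathrm{soc}(X/\mathrm{soc}^{i-1}X)$, equivalently $\mathrm{soc}^iX=\{x\in X: J^ix=0\}$. $P_X$ denotes a projective cover of $X$. A quotient $I/N$ is proper if $N\ne 0$. A module is uniserial if any two of its submodules are comparable under inclusion. *)

theory Defs
  imports "HOL-Algebra.Module" "HOL-Algebra.Ideal"
begin

text \<open>
  The locale \<^locale>\<open>module\<close> requires a commutative ring of scalars; the following is its version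
  for left modules over an arbitrary ring.  The records are those of the library, whose fields for
  multiplication and unit are not used for modules, and \<^locale>\<open>submodule\<close> is used as it stands.
\<close>

locale left_module = R?: ring R + M?: abelian_group M
  for R :: "('a, 'c) ring_scheme" and M :: "('a, 'm, 'd) module_scheme" +
  assumes smult_closed:
      "\<lbrakk>a \<in> carrier R; x \<in> carrier M\<rbrakk> \<Longrightarrow> a \<odot>\<^bsub>M\<^esub> x \<in> carrier M"
    and smult_l_distr:
      "\<lbrakk>a \<in> carrier R; b \<in> carrier R; x \<in> carrier M\<rbrakk>
        \<Longrightarrow> (a \<oplus>\<^bsub>R\<^esub> b) \<odot>\<^bsub>M\<^esub> x = a \<odot>\<^bsub>M\<^esub> x \<oplus>\<^bsub>M\<^esub> b \<odot>\<^bsub>M\<^esub> x"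
    and smult_r_distr:
      "\<lbrakk>a \<in> carrier R; x \<in> carrier M; y \<in> carrier M\<rbrakk>
        \<Longrightarrow> a \<odot>\<^bsub>M\<^esub> (x \<oplus>\<^bsub>M\<^esub> y) = a \<odot>\<^bsub>M\<^esub> x \<oplus>\<^bsub>M\<^esub> a \<odot>\<^bsub>M\<^esub> y"
    and smult_assoc1:
      "\<lbrakk>a \<in> carrier R; b \<in> carrier R; x \<in> carrier M\<rbrakk>
        \<Longrightarrow> (a \<otimes>\<^bsub>R\<^esub> b) \<odot>\<^bsub>M\<^esub> x = a \<odot>\<^bsub>M\<^esub> (b \<odot>\<^bsub>M\<^esub> x)"
    and smult_one: "x \<in> carrier M \<Longrightarrow> \<one>\<^bsub>R\<^esub> \<odot>\<^bsub>M\<^esub> x = x"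

definition submodule_gen ::
    "('a, 'c) ring_scheme \<Rightarrow> ('a, 'm, 'd) module_scheme \<Rightarrow> 'm set \<Rightarrow> 'm set" where
  "submodule_gen A X S = \<Inter>{H. submodule H A X \<and> S \<subseteq> H}"

definition fin_gen :: "('a, 'c) ring_scheme \<Rightarrow> ('a, 'm, 'd) module_scheme \<Rightarrow> bool" where
  "fin_gen A X \<longleftrightarrow> (\<exists>S. finite S \<and> S \<subseteq> carrier X \<and> submodule_gen A X S = carrier X)"

definition fg_module :: "('a, 'c) ring_scheme \<Rightarrow> ('a, 'm, 'd) module_scheme \<Rightarrow> bool" where
  "fg_module A X \<longleftrightarrow> left_module A X \<and> fin_gen A X"


subsection \<open>Artin algebras\<close>

definition artinian_cring :: "('r, 'c) ring_scheme \<Rightarrow> bool" where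
  "artinian_cring R \<longleftrightarrow> cring R \<and>
     (\<forall>C :: nat \<Rightarrow> 'r set. (\<forall>n. ideal (C n) R \<and> C (Suc n) \<subseteq> C n) \<longrightarrow> (\<exists>n. \<forall>m\<ge>n. C m = C n))"

text \<open>The locale \<^locale>\<open>algebra\<close> of the library covers commutative algebras only.\<close>

locale artin_algebra = R?: module R A + A?: ring A
  for R :: "('r, 'c) ring_scheme" and A :: "('r, 'a) module" +
  assumes artinian: "artinian_cring R"
    and smult_mult_left:
      "\<lbrakk>r \<in> carrier R; x \<in> carrier A; y \<in> carrier A\<rbrakk>
        \<Longrightarrow> (r \<odot>\<^bsub>A\<^esub> x) \<otimes>\<^bsub>A\<^esub> y = r \<odot>\<^bsub>A\<^esub> (x \<otimes>\<^bsub>A\<^esub> y)"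
    and smult_mult_right:
      "\<lbrakk>r \<in> carrier R; x \<in> carrier A; y \<in> carrier A\<rbrakk>
        \<Longrightarrow> x \<otimes>\<^bsub>A\<^esub> (r \<odot>\<^bsub>A\<^esub> y) = r \<odot>\<^bsub>A\<^esub> (x \<otimes>\<^bsub>A\<^esub> y)"
    and fin_gen: "fin_gen R A"


subsection \<open>Homomorphisms, quotients and direct sums\<close>

text \<open>
  As with \<^const>\<open>hom\<close>, only the values of a homomorphism on the carrier matter, and a submodule
  \<open>H\<close> of \<open>X\<close> becomes a module as \<open>X\<lparr>carrier := H\<rparr>\<close>.
\<close>

definition mod_hom ::
    "('a, 'c) ring_scheme \<Rightarrow> ('a, 'm, 'd) module_scheme \<Rightarrow> ('a, 'n, 'e) module_scheme \<Rightarrow> ('m \<Rightarrow> 'n) set" where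
  "mod_hom A X Y = {f \<in> carrier X \<rightarrow> carrier Y.
     (\<forall>x\<in>carrier X. \<forall>y\<in>carrier X. f (x \<oplus>\<^bsub>X\<^esub> y) = f x \<oplus>\<^bsub>Y\<^esub> f y) \<and>
     (\<forall>a\<in>carrier A. \<forall>x\<in>carrier X. f (a \<odot>\<^bsub>X\<^esub> x) = a \<odot>\<^bsub>Y\<^esub> f x)}"

definition quot_mod :: "('a, 'm, 'd) module_scheme \<Rightarrow> 'm set \<Rightarrow> ('a, 'm set) module" where
  "quot_mod X N = \<lparr>carrier = a_rcosets\<^bsub>X\<^esub> N, mult = (\<lambda>_ _. N), one = N,
     zero = N, add = (\<lambda>C D. C <+>\<^bsub>X\<^esub> D), smult = (\<lambda>a C. \<Union>x\<in>C. N +>\<^bsub>X\<^esub> (a \<odot>\<^bsub>X\<^esub> x))\<rparr>"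

definition dsum ::
    "('a, 'm, 'd) module_scheme \<Rightarrow> ('a, 'n, 'e) module_scheme \<Rightarrow> ('a, 'm \<times> 'n) module" where
  "dsum X Y = \<lparr>carrier = carrier X \<times> carrier Y,
     mult = (\<lambda>_ _. (\<zero>\<^bsub>X\<^esub>, \<zero>\<^bsub>Y\<^esub>)), one = (\<zero>\<^bsub>X\<^esub>, \<zero>\<^bsub>Y\<^esub>),
     zero = (\<zero>\<^bsub>X\<^esub>, \<zero>\<^bsub>Y\<^esub>),
     add = (\<lambda>(x, y) (x', y'). (x \<oplus>\<^bsub>X\<^esub> x', y \<oplus>\<^bsub>Y\<^esub> y')),
     smult = (\<lambda>a (x, y). (a \<odot>\<^bsub>X\<^esub> x, a \<odot>\<^bsub>Y\<^esub> y))\<rparr>"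


subsection \<open>Radical, top and socle\<close>

definition regular_module :: "('a, 'c) ring_scheme \<Rightarrow> ('a, 'a) module" where
  "regular_module A = \<lparr>carrier = carrier A, mult = mult A, one = one A, zero = zero A, add = add A,
     smult = mult A\<rparr>"

definition maximal_left_ideal :: "('a, 'c) ring_scheme \<Rightarrow> 'a set \<Rightarrow> bool" where
  "maximal_left_ideal A H \<longleftrightarrow> submodule H A (regular_module A) \<and> H \<noteq> carrier A \<and>
     (\<forall>K. submodule K A (regular_module A) \<and> H \<subseteq> K \<longrightarrow> K = H \<or> K = carrier A)"

definition jacobson_radical :: "('a, 'c) ring_scheme \<Rightarrow> 'a set" where
  "jacobson_radical A = carrier A \<inter> \<Inter> {H. maximal_left_ideal A H}"

primrec rad_pow ::
    "('a, 'c) ring_scheme \<Rightarrow> ('a, 'm, 'd) module_scheme \<Rightarrow> nat \<Rightarrow> 'm set" where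
  "rad_pow A X 0 = carrier X"
| "rad_pow A X (Suc i) =
     submodule_gen A X {a \<odot>\<^bsub>X\<^esub> x | a x. a \<in> jacobson_radical A \<and> x \<in> rad_pow A X i}"

definition top_pow ::
    "('a, 'c) ring_scheme \<Rightarrow> nat \<Rightarrow> ('a, 'm, 'd) module_scheme \<Rightarrow> ('a, 'm set) module" where
  "top_pow A i X = quot_mod X (rad_pow A X i)"

definition mod_top ::
    "('a, 'c) ring_scheme \<Rightarrow> ('a, 'm, 'd) module_scheme \<Rightarrow> ('a, 'm set) module" where
  "mod_top A X = top_pow A 1 X"

definition simple_submodule ::
    "('a, 'c) ring_scheme \<Rightarrow> ('a, 'm, 'd) module_scheme \<Rightarrow> 'm set \<Rightarrow> bool" where
  "simple_submodule A X S \<longleftrightarrow> submodule S A X \<and> S \<noteq> {\<zero>\<^bsub>X\<^esub>} \<and>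
     (\<forall>H. submodule H A X \<and> H \<subseteq> S \<longrightarrow> H = {\<zero>\<^bsub>X\<^esub>} \<or> H = S)"

definition socle :: "('a, 'c) ring_scheme \<Rightarrow> ('a, 'm, 'd) module_scheme \<Rightarrow> 'm set" where
  "socle A X = submodule_gen A X (\<Union> {S. simple_submodule A X S})"

primrec soc_pow ::
    "('a, 'c) ring_scheme \<Rightarrow> ('a, 'm, 'd) module_scheme \<Rightarrow> nat \<Rightarrow> 'm set" where
  "soc_pow A X 0 = {\<zero>\<^bsub>X\<^esub>}"
| "soc_pow A X (Suc i) =
     {x \<in> carrier X. soc_pow A X i +>\<^bsub>X\<^esub> x \<in> socle A (quot_mod X (soc_pow A X i))}"

definition soc_pow_mod ::
    "('a, 'c) ring_scheme \<Rightarrow> nat \<Rightarrow> ('a, 'm) module \<Rightarrow> ('a, 'm) module" where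
  "soc_pow_mod A i X = X\<lparr>carrier := soc_pow A X i\<rparr>"

definition uniserial :: "('a, 'c) ring_scheme \<Rightarrow> ('a, 'm, 'd) module_scheme \<Rightarrow> bool" where
  "uniserial A X \<longleftrightarrow> left_module A X \<and>
     (\<forall>H K. submodule H A X \<and> submodule K A X \<longrightarrow> H \<subseteq> K \<or> K \<subseteq> H)"

definition indecomposable :: "('a, 'c) ring_scheme \<Rightarrow> ('a, 'm, 'd) module_scheme \<Rightarrow> bool" where
  "indecomposable A X \<longleftrightarrow> left_module A X \<and> carrier X \<noteq> {\<zero>\<^bsub>X\<^esub>} \<and>
     (\<forall>H K. submodule H A X \<and> submodule K A X \<and> H \<inter> K = {\<zero>\<^bsub>X\<^esub>} \<and> H <+>\<^bsub>X\<^esub> K = carrier X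
        \<longrightarrow> H = {\<zero>\<^bsub>X\<^esub>} \<or> K = {\<zero>\<^bsub>X\<^esub>})"


subsection \<open>Notions that quantify over the category of finitely generated modules\<close>

text \<open>
  A formula cannot quantify over the types that carry modules.  In this subsection the bound
  modules therefore have the fixed carrier type \<open>(nat \<Rightarrow> 'a) set\<close>, where \<open>'a\<close> is the type of the
  ring elements.  This is no restriction: a finitely generated module is a quotient of some
  \<open>A^n\<close>, so it is isomorphic to a module on that type, whatever its own carrier type is (see the
  lemma \<open>fg_module_iso_universe\<close> below).
\<close>

type_synonym 'a fgmod = "('a, (nat \<Rightarrow> 'a) set) module"

definition injective_fg :: "('a, 'c) ring_scheme \<Rightarrow> ('a, 'm, 'd) module_scheme \<Rightarrow> bool" where
  "injective_fg A I \<longleftrightarrow> fg_module A I \<and>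
     (\<forall>(X :: 'a fgmod) (Y :: 'a fgmod). \<forall>f \<in> mod_hom A X Y. \<forall>g \<in> mod_hom A X I.
        fg_module A X \<and> fg_module A Y \<and> inj_on f (carrier X)
        \<longrightarrow> (\<exists>h \<in> mod_hom A Y I. \<forall>x\<in>carrier X. h (f x) = g x))"

definition projective_fg :: "('a, 'c) ring_scheme \<Rightarrow> ('a, 'm, 'd) module_scheme \<Rightarrow> bool" where
  "projective_fg A P \<longleftrightarrow> fg_module A P \<and>
     (\<forall>(X :: 'a fgmod) (Y :: 'a fgmod). \<forall>f \<in> mod_hom A X Y. \<forall>g \<in> mod_hom A P Y.
        fg_module A X \<and> fg_module A Y \<and> f ` carrier X = carrier Y
        \<longrightarrow> (\<exists>h \<in> mod_hom A P X. \<forall>x\<in>carrier P. f (h x) = g x))"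

definition projective_cover ::
    "('a, 'c) ring_scheme \<Rightarrow> ('a, 'm, 'd) module_scheme \<Rightarrow> ('m \<Rightarrow> 'n)
      \<Rightarrow> ('a, 'n, 'e) module_scheme \<Rightarrow> bool" where
  "projective_cover A P f X \<longleftrightarrow> projective_fg A P \<and> fg_module A X \<and>
     f \<in> mod_hom A P X \<and> f ` carrier P = carrier X \<and>
     (\<forall>H. submodule H A P \<and> H <+>\<^bsub>P\<^esub> a_kernel P X f = carrier P \<longrightarrow> H = carrier P)"

definition split_mono ::
    "('a, 'c) ring_scheme \<Rightarrow> ('a, 'm, 'd) module_scheme \<Rightarrow> ('a, 'n, 'e) module_scheme
      \<Rightarrow> ('m \<Rightarrow> 'n) \<Rightarrow> bool" where
  "split_mono A X Y f \<longleftrightarrow> (\<exists>h \<in> mod_hom A Y X. \<forall>x\<in>carrier X. h (f x) = x)"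

definition split_epi ::
    "('a, 'c) ring_scheme \<Rightarrow> ('a, 'm, 'd) module_scheme \<Rightarrow> ('a, 'n, 'e) module_scheme
      \<Rightarrow> ('m \<Rightarrow> 'n) \<Rightarrow> bool" where
  "split_epi A X Y f \<longleftrightarrow> (\<exists>h \<in> mod_hom A Y X. \<forall>y\<in>carrier Y. f (h y) = y)"

definition left_almost_split ::
    "('a, 'c) ring_scheme \<Rightarrow> ('a, 'm, 'd) module_scheme \<Rightarrow> ('a, 'n, 'e) module_scheme
      \<Rightarrow> ('m \<Rightarrow> 'n) \<Rightarrow> bool" where
  "left_almost_split A X Y f \<longleftrightarrow> f \<in> mod_hom A X Y \<and> \<not> split_mono A X Y f \<and>
     (\<forall>Z :: 'a fgmod. \<forall>u \<in> mod_hom A X Z. fg_module A Z \<and> \<not> split_mono A X Z u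
        \<longrightarrow> (\<exists>v \<in> mod_hom A Y Z. \<forall>x\<in>carrier X. v (f x) = u x))"

definition right_almost_split ::
    "('a, 'c) ring_scheme \<Rightarrow> ('a, 'm, 'd) module_scheme \<Rightarrow> ('a, 'n, 'e) module_scheme
      \<Rightarrow> ('m \<Rightarrow> 'n) \<Rightarrow> bool" where
  "right_almost_split A Y X g \<longleftrightarrow> g \<in> mod_hom A Y X \<and> \<not> split_epi A Y X g \<and>
     (\<forall>Z :: 'a fgmod. \<forall>u \<in> mod_hom A Z X. fg_module A Z \<and> \<not> split_epi A Z X u
        \<longrightarrow> (\<exists>v \<in> mod_hom A Z Y. \<forall>z\<in>carrier Z. g (v z) = u z))"

definition short_exact ::
    "('a, 'c) ring_scheme \<Rightarrow> ('a, 'l, 'd) module_scheme \<Rightarrow> ('l \<Rightarrow> 'm) \<Rightarrow> ('a, 'm, 'e) module_scheme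
      \<Rightarrow> ('m \<Rightarrow> 'n) \<Rightarrow> ('a, 'n, 'f) module_scheme \<Rightarrow> bool" where
  "short_exact A X f Y g Z \<longleftrightarrow> fg_module A X \<and> fg_module A Y \<and> fg_module A Z \<and>
     f \<in> mod_hom A X Y \<and> g \<in> mod_hom A Y Z \<and> inj_on f (carrier X) \<and>
     f ` carrier X = a_kernel Y Z g \<and> g ` carrier Y = carrier Z"

definition almost_split_sequence ::
    "('a, 'c) ring_scheme \<Rightarrow> ('a, 'l, 'd) module_scheme \<Rightarrow> ('l \<Rightarrow> 'm) \<Rightarrow> ('a, 'm, 'e) module_scheme
      \<Rightarrow> ('m \<Rightarrow> 'n) \<Rightarrow> ('a, 'n, 'f) module_scheme \<Rightarrow> bool" where
  "almost_split_sequence A X f Y g Z \<longleftrightarrow> short_exact A X f Y g Z \<and>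
     left_almost_split A X Y f \<and> right_almost_split A Y Z g"

lemma (in left_module) smult_zero_right:
  assumes "a \<in> carrier R" shows "a \<odot>\<^bsub>M\<^esub> \<zero>\<^bsub>M\<^esub> = \<zero>\<^bsub>M\<^esub>"
proof -
  have "a \<odot>\<^bsub>M\<^esub> \<zero>\<^bsub>M\<^esub> \<oplus>\<^bsub>M\<^esub> a \<odot>\<^bsub>M\<^esub> \<zero>\<^bsub>M\<^esub> = a \<odot>\<^bsub>M\<^esub> \<zero>\<^bsub>M\<^esub>"
    using smult_r_distr[OF assms M.zero_closed M.zero_closed] by simp
  then show ?thesis
    using smult_closed[OF assms M.zero_closed] M.add.r_cancel_one by blast
qed

lemma (in left_module) smult_zero_left:
  assumes "x \<in> carrier M" shows "\<zero>\<^bsub>R\<^esub> \<odot>\<^bsub>M\<^esub> x = \<zero>\<^bsub>M\<^esub>"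
proof -
  have "\<zero>\<^bsub>R\<^esub> \<odot>\<^bsub>M\<^esub> x \<oplus>\<^bsub>M\<^esub> \<zero>\<^bsub>R\<^esub> \<odot>\<^bsub>M\<^esub> x = \<zero>\<^bsub>R\<^esub> \<odot>\<^bsub>M\<^esub> x"
    using smult_l_distr[OF R.zero_closed R.zero_closed assms] by simp
  then show ?thesis
    using smult_closed[OF R.zero_closed assms] M.add.r_cancel_one by blast
qed

lemma (in left_module) smult_uminus_left:
  assumes "a \<in> carrier R" "x \<in> carrier M"
  shows "(\<ominus>\<^bsub>R\<^esub> a) \<odot>\<^bsub>M\<^esub> x = \<ominus>\<^bsub>M\<^esub> (a \<odot>\<^bsub>M\<^esub> x)"
proof -
  have "(\<ominus>\<^bsub>R\<^esub> a) \<odot>\<^bsub>M\<^esub> x \<oplus>\<^bsub>M\<^esub> a \<odot>\<^bsub>M\<^esub> x = \<zero>\<^bsub>M\<^esub>"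
    using smult_l_distr[of "\<ominus>\<^bsub>R\<^esub> a" a x] assms by (simp add: R.l_neg smult_zero_left)
  then show ?thesis
    using assms by (intro M.minus_equality[symmetric]) (auto intro: smult_closed)
qed

lemma (in left_module) submoduleI:
  assumes "H \<subseteq> carrier M" "\<zero>\<^bsub>M\<^esub> \<in> H"
    and "\<And>x y. x \<in> H \<Longrightarrow> y \<in> H \<Longrightarrow> x \<oplus>\<^bsub>M\<^esub> y \<in> H"
    and "\<And>a x. a \<in> carrier R \<Longrightarrow> x \<in> H \<Longrightarrow> a \<odot>\<^bsub>M\<^esub> x \<in> H"
  shows "submodule H R M"
proof -
  have "\<ominus>\<^bsub>M\<^esub> x \<in> H" if "x \<in> H" for x
  proof -
    have "x \<in> carrier M" using that assms(1) by auto
    then have "(\<ominus>\<^bsub>R\<^esub> \<one>\<^bsub>R\<^esub>) \<odot>\<^bsub>M\<^esub> x = \<ominus>\<^bsub>M\<^esub> x"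
      by (simp add: smult_uminus_left smult_one)
    then show ?thesis using assms(4)[of "\<ominus>\<^bsub>R\<^esub> \<one>\<^bsub>R\<^esub>" x] that by simp
  qed
  then show ?thesis
    using assms by (intro submodule.intro subgroup.intro submodule_axioms.intro) (auto simp: a_inv_def)
qed

lemma (in left_module) quot_mod_smult:
  assumes "submodule N R M" "a \<in> carrier R" "x \<in> carrier M"
  shows "a \<odot>\<^bsub>quot_mod M N\<^esub> (N +>\<^bsub>M\<^esub> x) = N +>\<^bsub>M\<^esub> (a \<odot>\<^bsub>M\<^esub> x)"
proof -
  interpret N: submodule N R M by fact
  have sg: "additive_subgroup N M" by (simp add: additive_subgroup.intro N.subgroup_axioms)
  interpret N: abelian_subgroup N M
    using sg M.abelian_group_axioms by (rule abelian_subgroupI3)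
  have "N +>\<^bsub>M\<^esub> (a \<odot>\<^bsub>M\<^esub> y) = N +>\<^bsub>M\<^esub> (a \<odot>\<^bsub>M\<^esub> x)" if y: "y \<in> N +>\<^bsub>M\<^esub> x" for y
  proof -
    obtain n where n: "n \<in> N" "y = n \<oplus>\<^bsub>M\<^esub> x"
      using y by (auto simp: a_r_coset_def')
    have nc: "n \<in> carrier M" using n(1) N.a_subset by auto
    have "a \<odot>\<^bsub>M\<^esub> y = a \<odot>\<^bsub>M\<^esub> n \<oplus>\<^bsub>M\<^esub> a \<odot>\<^bsub>M\<^esub> x"
      using n(2) smult_r_distr[OF assms(2) nc assms(3)] by simp
    moreover have "a \<odot>\<^bsub>M\<^esub> n \<in> N" using N.smult_closed assms(2) n(1) by blast
    ultimately have "a \<odot>\<^bsub>M\<^esub> y \<in> N +>\<^bsub>M\<^esub> (a \<odot>\<^bsub>M\<^esub> x)"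
      by (auto simp: a_r_coset_def')
    then show ?thesis
      using M.a_repr_independence[OF _ smult_closed[OF assms(2,3)] N.subgroup_axioms] by metis
  qed
  moreover have "x \<in> N +>\<^bsub>M\<^esub> x" using N.a_rcos_self assms(3) by blast
  ultimately have "(\<Union>y\<in>N +>\<^bsub>M\<^esub> x. N +>\<^bsub>M\<^esub> (a \<odot>\<^bsub>M\<^esub> y)) = N +>\<^bsub>M\<^esub> (a \<odot>\<^bsub>M\<^esub> x)"
    by blast
  then show ?thesis by (simp add: quot_mod_def)
qed

lemma (in left_module) left_module_quot_mod:
  assumes "submodule N R M"
  shows "left_module R (quot_mod M N)"
proof -
  interpret N: submodule N R M by fact
  have sg: "additive_subgroup N M" by (simp add: additive_subgroup.intro N.subgroup_axioms)
  interpret N: abelian_subgroup N M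
    using sg M.abelian_group_axioms by (rule abelian_subgroupI3)
  let ?Q = "quot_mod M N"
  have car: "carrier ?Q = (\<lambda>x. N +>\<^bsub>M\<^esub> x) ` carrier M"
    by (auto simp: quot_mod_def A_RCOSETS_def')
  have zero: "\<zero>\<^bsub>?Q\<^esub> = N +>\<^bsub>M\<^esub> \<zero>\<^bsub>M\<^esub>"
    using N.a_subset by (simp add: quot_mod_def)
  have add: "(N +>\<^bsub>M\<^esub> x) \<oplus>\<^bsub>?Q\<^esub> (N +>\<^bsub>M\<^esub> y) = N +>\<^bsub>M\<^esub> (x \<oplus>\<^bsub>M\<^esub> y)"
    if "x \<in> carrier M" "y \<in> carrier M" for x y
    using that N.a_rcos_sum by (simp add: quot_mod_def)
  note sm = quot_mod_smult[OF assms]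
  have ag: "abelian_group ?Q"
  proof (rule abelian_groupI)
    fix X assume "X \<in> carrier ?Q"
    then obtain x where x: "x \<in> carrier M" "X = N +>\<^bsub>M\<^esub> x" using car by auto
    then have "(N +>\<^bsub>M\<^esub> (\<ominus>\<^bsub>M\<^esub> x)) \<oplus>\<^bsub>?Q\<^esub> X = \<zero>\<^bsub>?Q\<^esub>"
      by (simp add: add zero M.l_neg)
    then show "\<exists>Y\<in>carrier ?Q. Y \<oplus>\<^bsub>?Q\<^esub> X = \<zero>\<^bsub>?Q\<^esub>" using x car by blast
  qed (auto simp: car zero add M.a_ac)
  show ?thesis
    by (intro left_module.intro left_module_axioms.intro ag R.ring_axioms)
      (auto simp: car sm add smult_closed smult_l_distr smult_r_distr smult_assoc1 smult_one)
qed

lemma (in left_module) transport_fg: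
  fixes \<phi> :: "'m \<Rightarrow> 'u"
  assumes inj: "inj_on \<phi> (carrier M)" and fg: "fin_gen R M"
  shows "\<exists>Y :: ('a, 'u) module. fg_module R Y \<and>
    (\<exists>f \<in> mod_hom R M Y. bij_betw f (carrier M) (carrier Y))"
proof -
  define \<psi> where "\<psi> = the_inv_into (carrier M) \<phi>"
  have \<psi>: "\<psi> (\<phi> x) = x" if "x \<in> carrier M" for x
    using that inj by (simp add: \<psi>_def the_inv_into_f_f)
  define Y :: "('a, 'u) module" where "Y = \<lparr>carrier = \<phi> ` carrier M,
     mult = (\<lambda>_ _. \<phi> \<zero>\<^bsub>M\<^esub>), one = \<phi> \<zero>\<^bsub>M\<^esub>, zero = \<phi> \<zero>\<^bsub>M\<^esub>,
     add = (\<lambda>u v. \<phi> (\<psi> u \<oplus>\<^bsub>M\<^esub> \<psi> v)), smult = (\<lambda>a u. \<phi> (a \<odot>\<^bsub>M\<^esub> \<psi> u))\<rparr>"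
  have car: "carrier Y = \<phi> ` carrier M" and zero: "\<zero>\<^bsub>Y\<^esub> = \<phi> \<zero>\<^bsub>M\<^esub>"
    by (simp_all add: Y_def)
  have add: "\<phi> x \<oplus>\<^bsub>Y\<^esub> \<phi> y = \<phi> (x \<oplus>\<^bsub>M\<^esub> y)" if "x \<in> carrier M" "y \<in> carrier M" for x y
    using that by (simp add: Y_def \<psi>)
  have sm: "a \<odot>\<^bsub>Y\<^esub> \<phi> x = \<phi> (a \<odot>\<^bsub>M\<^esub> x)" if "x \<in> carrier M" for a x
    using that by (simp add: Y_def \<psi>)
  have ag: "abelian_group Y"
  proof (rule abelian_groupI)
    fix X assume "X \<in> carrier Y"
    then obtain x where x: "x \<in> carrier M" "X = \<phi> x" using car by auto
    then have "\<phi> (\<ominus>\<^bsub>M\<^esub> x) \<oplus>\<^bsub>Y\<^esub> X = \<zero>\<^bsub>Y\<^esub>" by (simp add: add zero M.l_neg)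
    then show "\<exists>Z\<in>carrier Y. Z \<oplus>\<^bsub>Y\<^esub> X = \<zero>\<^bsub>Y\<^esub>" using x car by blast
  qed (auto simp: car zero add M.a_ac)
  have lm: "left_module R Y"
    by (intro left_module.intro left_module_axioms.intro ag R.ring_axioms)
      (auto simp: car sm add smult_closed smult_l_distr smult_r_distr smult_assoc1 smult_one)
  have hom: "\<phi> \<in> mod_hom R M Y" by (auto simp: mod_hom_def car add sm)
  obtain S where S: "finite S" "S \<subseteq> carrier M" "submodule_gen R M S = carrier M"
    using fg by (auto simp: fin_gen_def)
  have gen: "carrier Y \<subseteq> H" if H: "submodule H R Y" "\<phi> ` S \<subseteq> H" for H
  proof -
    interpret H: submodule H R Y by fact
    let ?K = "{x \<in> carrier M. \<phi> x \<in> H}"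
    have "submodule ?K R M"
    proof (rule submoduleI)
      show "\<zero>\<^bsub>M\<^esub> \<in> ?K" using H.one_closed by (simp add: zero)
      show "x \<oplus>\<^bsub>M\<^esub> y \<in> ?K" if "x \<in> ?K" "y \<in> ?K" for x y
        using that H.m_closed[of "\<phi> x" "\<phi> y"] by (simp add: add)
      show "a \<odot>\<^bsub>M\<^esub> x \<in> ?K" if "a \<in> carrier R" "x \<in> ?K" for a x
        using that H.smult_closed[of a "\<phi> x"] by (simp add: sm smult_closed)
    qed auto
    moreover have "S \<subseteq> ?K" using S(2) H(2) by auto
    ultimately have "carrier M \<subseteq> ?K"
      unfolding S(3)[symmetric] submodule_gen_def by blast
    then show ?thesis by (auto simp: car)
  qed
  have "submodule (carrier Y) R Y"
    by (rule left_module.submoduleI[OF lm])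
      (auto simp: abelian_groupE[OF ag] left_module.smult_closed[OF lm])
  moreover have "\<phi> ` S \<subseteq> carrier Y" using S(2) by (auto simp: car)
  ultimately have "submodule_gen R Y (\<phi> ` S) = carrier Y"
    using gen unfolding submodule_gen_def by blast
  then have "fin_gen R Y"
    unfolding fin_gen_def using S by (intro exI[of _ "\<phi> ` S"]) (auto simp: car)
  then show ?thesis
    using lm hom inj by (intro exI[of _ Y] conjI bexI[of _ \<phi>]) (auto simp: fg_module_def bij_betw_def car)
qed

primrec lincomb :: "('a, 'm, 'd) module_scheme \<Rightarrow> (nat \<Rightarrow> 'm) \<Rightarrow> (nat \<Rightarrow> 'a) \<Rightarrow> nat \<Rightarrow> 'm" where
  "lincomb X g v 0 = \<zero>\<^bsub>X\<^esub>"
| "lincomb X g v (Suc n) = lincomb X g v n \<oplus>\<^bsub>X\<^esub> v n \<odot>\<^bsub>X\<^esub> g n"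

lemma (in left_module) fin_gen_lincomb:
  assumes "fin_gen R M"
  obtains g n where "\<And>x. x \<in> carrier M \<Longrightarrow> \<exists>v. lincomb M g v n = x"
proof -
  obtain S where S: "finite S" "S \<subseteq> carrier M" "submodule_gen R M S = carrier M"
    using assms by (auto simp: fin_gen_def)
  obtain n :: nat and g where g: "S = g ` {i. i < n}"
    using finite_imp_nat_seg_image_inj_on[OF S(1)] by blast
  have gc: "g i \<in> carrier M" if "i < n" for i using that g S(2) by auto
  have lc: "lincomb M g v k \<in> carrier M" if "range v \<subseteq> carrier R" "k \<le> n" for v k
    using that(2) by (induction k) (use that(1) gc in \<open>auto intro!: smult_closed M.a_closed\<close>)
  let ?T = "{lincomb M g v n | v. range v \<subseteq> carrier R}"
  have "submodule ?T R M"
  proof (rule submoduleI)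
    show "?T \<subseteq> carrier M" using lc by auto
    have "lincomb M g (\<lambda>_. \<zero>\<^bsub>R\<^esub>) k = \<zero>\<^bsub>M\<^esub>" if "k \<le> n" for k
      using that by (induction k) (auto simp: smult_zero_left gc)
    then have "lincomb M g (\<lambda>_. \<zero>\<^bsub>R\<^esub>) n = \<zero>\<^bsub>M\<^esub>" by simp
    then show "\<zero>\<^bsub>M\<^esub> \<in> ?T" by (intro CollectI exI[of _ "\<lambda>_. \<zero>\<^bsub>R\<^esub>"]) auto
  next
    fix x y assume "x \<in> ?T" "y \<in> ?T"
    then obtain v w where vw: "range v \<subseteq> carrier R" "range w \<subseteq> carrier R"
      "x = lincomb M g v n" "y = lincomb M g w n" by blast
    have c: "v i \<in> carrier R" "w i \<in> carrier R" for i using vw(1,2) by auto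
    have "lincomb M g (\<lambda>i. v i \<oplus>\<^bsub>R\<^esub> w i) k = lincomb M g v k \<oplus>\<^bsub>M\<^esub> lincomb M g w k"
      if "k \<le> n" for k
      using that
    proof (induction k)
      case (Suc k)
      then show ?case
        using lc[OF vw(1), of k] lc[OF vw(2), of k] c gc[of k]
        by (simp add: smult_l_distr smult_closed M.a_ac)
    qed simp
    then have "lincomb M g (\<lambda>i. v i \<oplus>\<^bsub>R\<^esub> w i) n = x \<oplus>\<^bsub>M\<^esub> y" using vw by simp
    then show "x \<oplus>\<^bsub>M\<^esub> y \<in> ?T"
      using c by (intro CollectI exI[of _ "\<lambda>i. v i \<oplus>\<^bsub>R\<^esub> w i"]) auto
  next
    fix a x assume a: "a \<in> carrier R" and "x \<in> ?T"
    then obtain v where v: "range v \<subseteq> carrier R" "x = lincomb M g v n" by blast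
    have c: "v i \<in> carrier R" for i using v(1) by auto
    have "lincomb M g (\<lambda>i. a \<otimes>\<^bsub>R\<^esub> v i) k = a \<odot>\<^bsub>M\<^esub> lincomb M g v k" if "k \<le> n" for k
      using that
    proof (induction k)
      case 0
      then show ?case by (simp add: smult_zero_right a)
    next
      case (Suc k)
      then show ?case
        using lc[OF v(1), of k] c gc[of k] a
        by (simp add: smult_r_distr smult_closed smult_assoc1)
    qed
    then have "lincomb M g (\<lambda>i. a \<otimes>\<^bsub>R\<^esub> v i) n = a \<odot>\<^bsub>M\<^esub> x" using v by simp
    then show "a \<odot>\<^bsub>M\<^esub> x \<in> ?T"
      using c a by (intro CollectI exI[of _ "\<lambda>i. a \<otimes>\<^bsub>R\<^esub> v i"]) auto
  qed
  moreover have "S \<subseteq> ?T"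
  proof
    fix x assume "x \<in> S"
    then obtain i where i: "i < n" "x = g i" using g by auto
    let ?v = "\<lambda>j. if j = i then \<one>\<^bsub>R\<^esub> else \<zero>\<^bsub>R\<^esub>"
    have "lincomb M g ?v k = (if i < k then g i else \<zero>\<^bsub>M\<^esub>)" if "k \<le> n" for k
      using that
      by (induction k) (auto simp: smult_one smult_zero_left gc less_Suc_eq)
    then have "lincomb M g ?v n = x" using i by simp
    then show "x \<in> ?T" by (intro CollectI exI[of _ ?v]) auto
  qed
  ultimately have "carrier M \<subseteq> ?T" unfolding S(3)[symmetric] submodule_gen_def by blast
  then have "\<exists>v. lincomb M g v n = x" if "x \<in> carrier M" for x using that by blast
  then show thesis by (rule that)
qed

lemma fg_module_iso_universe:
  fixes A :: "('a, 'c) ring_scheme" and X :: "('a, 'm, 'd) module_scheme"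
  assumes "fg_module A X"
  shows "\<exists>Y :: 'a fgmod. fg_module A Y \<and>
    (\<exists>f \<in> mod_hom A X Y. bij_betw f (carrier X) (carrier Y))"
proof -
  interpret left_module A X using assms by (simp add: fg_module_def)
  have fg: "fin_gen A X" using assms by (simp add: fg_module_def)
  obtain g n where gn: "\<And>x. x \<in> carrier X \<Longrightarrow> \<exists>v. lincomb X g v n = x"
    using fin_gen_lincomb[OF fg] by blast
  have "inj_on (\<lambda>x. {v. lincomb X g v n = x}) (carrier X)"
    by (rule inj_onI) (use gn in blast)
  then show ?thesis using fg by (rule transport_fg)
qed

end

theory Submission
  imports Defs
begin

text \<open>
  The module \<open>I\<close> has a simple socle \<open>T = A t\<close>. Lifting the projective cover of the top of \<open>M/N\<close> gives
  \<open>\<phi> : P \<rightarrow> soc\<^sup>s\<^sup>+\<^sup>1 I\<close> with \<open>\<phi>(P) + N = M\<close>; its image is isomorphic to \<open>P/J\<^sup>s\<^sup>+\<^sup>1P\<close>, meets \<open>N\<close> in \<open>T\<close>, and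
  \<open>J\<^sup>sP = A b\<close> with \<open>\<phi> b = t\<close>. Given \<open>u : L \<rightarrow> Z\<close>, a map \<open>\<zeta> : P \<rightarrow> Z\<close> with \<open>\<zeta> b = u t\<close> glues with the restriction
  of \<open>u\<close> to \<open>N\<close> to a map \<open>M \<rightarrow> Z\<close>, and the difference on \<open>L\<close> factors through \<open>L/N\<close>; so \<open>u\<close> extends along
  \<open>L \<rightarrow> M \<oplus> L/N\<close>. If there is no such \<open>\<zeta>\<close>, an \<open>R\<close>-linear duality argument yields \<open>w : Z \<rightarrow> L\<close> with \<open>w (u t) \<noteq> 0\<close>,
  and then \<open>w u\<close> is invertible, that is, \<open>u\<close> splits. This makes the first map left almost split; since every
  endomorphism of the uniserial module \<open>M/N\<close> is invertible or nilpotent, the second map is right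
  almost split.
\<close>

section \<open>Submodules, homomorphisms and quotients\<close>

text \<open>The values \<open>\<zeta> b\<close> form an \<open>R\<close>-submodule of
  \<open>Z\<close> but in general no \<open>A\<close>-submodule. The decisive separation is
  therefore \<open>R\<close>-linear, although its outcome is an \<open>A\<close>-homomorphism; this
  is why scalars are restricted and finite length is first established over \<open>R\<close>.
  Homomorphisms \<open>Z \<rightarrow> I\<close> do not separate all points of \<open>Z\<close>,
  only those of \<open>f Z\<close> for a primitive idempotent \<open>f\<close> with
  \<open>f t = t\<close>; in classical terms \<open>I\<close> is the dual of \<open>f A\<close>. So
  \<open>b\<close> is chosen with \<open>f b = b\<close>, which places every
  \<open>\<zeta> b\<close>, and \<open>u t\<close> as well, in \<open>f Z\<close>. The exponent
  \<open>s + 1\<close> comes from \<open>N \<noteq> 0\<close>: then \<open>N\<close> contains the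
  socle of \<open>I\<close>, so \<open>soc\<^sup>s\<^sup>+\<^sup>1 I\<close> maps into
  \<open>soc\<^sup>s(I/N)\<close>, and the non-inclusion hypothesis makes this map onto. Socle
  layers of \<open>I\<close> and radical powers of \<open>P\<close> are exchanged by one principle:
  a homomorphism kills \<open>J^i P\<close> exactly if its image lies in the \<open>i\<close>-th
  socle layer.\<close>

lemma submoduleD:
  assumes "submodule H A X"
  shows submodule_subset: "H \<subseteq> carrier X"
    and submodule_zero_mem: "\<zero>\<^bsub>X\<^esub> \<in> H"
    and submodule_add_mem: "x \<in> H \<Longrightarrow> y \<in> H \<Longrightarrow> x \<oplus>\<^bsub>X\<^esub> y \<in> H"
    and submodule_smult_mem: "a \<in> carrier A \<Longrightarrow> x \<in> H \<Longrightarrow> a \<odot>\<^bsub>X\<^esub> x \<in> H"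
    and submodule_uminus_mem: "x \<in> H \<Longrightarrow> \<ominus>\<^bsub>X\<^esub> x \<in> H"
    and submodule_minus_mem: "x \<in> H \<Longrightarrow> y \<in> H \<Longrightarrow> x \<ominus>\<^bsub>X\<^esub> y \<in> H"
proof -
  interpret H: submodule H A X by fact
  show "H \<subseteq> carrier X" "\<zero>\<^bsub>X\<^esub> \<in> H" using H.subset H.one_closed by auto
  show "x \<oplus>\<^bsub>X\<^esub> y \<in> H" if "x \<in> H" "y \<in> H" for x y using H.m_closed that by auto
  show "a \<odot>\<^bsub>X\<^esub> x \<in> H" if "a \<in> carrier A" "x \<in> H" for a x using H.smult_closed that by auto
  show inv: "\<ominus>\<^bsub>X\<^esub> x \<in> H" if "x \<in> H" for x using H.m_inv_closed[OF that] by (simp add: a_inv_def)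
  show "x \<ominus>\<^bsub>X\<^esub> y \<in> H" if "x \<in> H" "y \<in> H" for x y
    using H.m_closed[of x "\<ominus>\<^bsub>X\<^esub> y"] inv that by (simp add: a_minus_def)
qed

lemma set_add_iff: "x \<in> H <+>\<^bsub>X\<^esub> K \<longleftrightarrow> (\<exists>h\<in>H. \<exists>k\<in>K. x = h \<oplus>\<^bsub>X\<^esub> k)"
  by (auto simp: set_add_def')

context left_module
begin

lemma submodule_carrier: "submodule (carrier M) R M"
  by (rule submoduleI) (auto intro: smult_closed)

lemma submodule_zero: "submodule {\<zero>\<^bsub>M\<^esub>} R M"
  by (rule submoduleI) (auto simp: smult_zero_right)

lemma submodule_Int:
  assumes "submodule H R M" "submodule K R M"
  shows "submodule (H \<inter> K) R M"
  using submoduleD[OF assms(1)] submoduleD[OF assms(2)] by (intro submoduleI) auto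

lemma submodule_set_add:
  assumes H: "submodule H R M" and K: "submodule K R M"
  shows "submodule (H <+>\<^bsub>M\<^esub> K) R M"
proof (rule submoduleI)
  note sub = submodule_subset[OF H, THEN subsetD] submodule_subset[OF K, THEN subsetD]
  show "H <+>\<^bsub>M\<^esub> K \<subseteq> carrier M" using sub by (auto simp: set_add_iff)
  show "\<zero>\<^bsub>M\<^esub> \<in> H <+>\<^bsub>M\<^esub> K"
    unfolding set_add_iff using submodule_zero_mem[OF H] submodule_zero_mem[OF K] M.l_zero M.zero_closed by metis
  show "x \<oplus>\<^bsub>M\<^esub> y \<in> H <+>\<^bsub>M\<^esub> K" if xy: "x \<in> H <+>\<^bsub>M\<^esub> K" "y \<in> H <+>\<^bsub>M\<^esub> K" for x y
  proof -
    obtain h k h' k' where hk: "h \<in> H" "k \<in> K" "h' \<in> H" "k' \<in> K" "x = h \<oplus>\<^bsub>M\<^esub> k" "y = h' \<oplus>\<^bsub>M\<^esub> k'"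
      using xy by (auto simp: set_add_iff)
    then have "x \<oplus>\<^bsub>M\<^esub> y = (h \<oplus>\<^bsub>M\<^esub> h') \<oplus>\<^bsub>M\<^esub> (k \<oplus>\<^bsub>M\<^esub> k')" using sub by (simp add: M.a_ac)
    then show ?thesis
      unfolding set_add_iff using hk submodule_add_mem[OF H] submodule_add_mem[OF K] by blast
  qed
  show "a \<odot>\<^bsub>M\<^esub> x \<in> H <+>\<^bsub>M\<^esub> K" if a: "a \<in> carrier R" and x: "x \<in> H <+>\<^bsub>M\<^esub> K" for a x
  proof -
    obtain h k where hk: "h \<in> H" "k \<in> K" "x = h \<oplus>\<^bsub>M\<^esub> k" using x by (auto simp: set_add_iff)
    then have "a \<odot>\<^bsub>M\<^esub> x = a \<odot>\<^bsub>M\<^esub> h \<oplus>\<^bsub>M\<^esub> a \<odot>\<^bsub>M\<^esub> k" using sub a smult_r_distr by simp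
    then show ?thesis
      unfolding set_add_iff using hk submodule_smult_mem[OF H a] submodule_smult_mem[OF K a] by blast
  qed
qed

lemma minus_zero: "x \<in> carrier M \<Longrightarrow> x \<ominus>\<^bsub>M\<^esub> \<zero>\<^bsub>M\<^esub> = x"
  using M.add.inv_one by (simp add: a_minus_def)

lemma minus_add_cancel: "x \<in> carrier M \<Longrightarrow> y \<in> carrier M \<Longrightarrow> (x \<ominus>\<^bsub>M\<^esub> y) \<oplus>\<^bsub>M\<^esub> y = x"
  by (simp add: a_minus_def M.a_assoc M.l_neg)

lemma minus_eq_zero_iff: "x \<in> carrier M \<Longrightarrow> y \<in> carrier M \<Longrightarrow> x \<ominus>\<^bsub>M\<^esub> y = \<zero>\<^bsub>M\<^esub> \<longleftrightarrow> x = y"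
  using minus_add_cancel[of x y] by (auto simp: a_minus_def M.r_neg)

lemma add_minus_cancel:
  assumes "x \<in> carrier M" "y \<in> carrier M"
  shows "(x \<oplus>\<^bsub>M\<^esub> y) \<ominus>\<^bsub>M\<^esub> x = y" "(x \<oplus>\<^bsub>M\<^esub> y) \<ominus>\<^bsub>M\<^esub> y = x"
proof -
  have *: "(x \<oplus>\<^bsub>M\<^esub> y) \<ominus>\<^bsub>M\<^esub> y = x" if "x \<in> carrier M" "y \<in> carrier M" for x y
    using that by (simp add: a_minus_def M.a_assoc M.r_neg)
  show "(x \<oplus>\<^bsub>M\<^esub> y) \<ominus>\<^bsub>M\<^esub> x = y" using *[of y x] assms by (simp add: M.a_comm)
  show "(x \<oplus>\<^bsub>M\<^esub> y) \<ominus>\<^bsub>M\<^esub> y = x" by (rule *[OF assms])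
qed

lemma set_add_upper1:
  assumes H: "submodule H R M" and K: "submodule K R M"
  shows "H \<subseteq> H <+>\<^bsub>M\<^esub> K"
  unfolding set_add_iff subset_iff
  using submodule_zero_mem[OF K] submodule_subset[OF H, THEN subsetD] M.r_zero by metis

lemma set_add_upper2:
  assumes H: "submodule H R M" and K: "submodule K R M"
  shows "K \<subseteq> H <+>\<^bsub>M\<^esub> K"
  unfolding set_add_iff subset_iff
  using submodule_zero_mem[OF H] submodule_subset[OF K, THEN subsetD] M.l_zero by metis

lemma set_add_least:
  assumes "submodule G R M" "H \<subseteq> G" "K \<subseteq> G"
  shows "H <+>\<^bsub>M\<^esub> K \<subseteq> G"
  unfolding set_add_iff subset_iff using assms(2,3) submodule_add_mem[OF assms(1)] by blast

lemma submodule_cyclic: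
  assumes x: "x \<in> carrier M"
  shows "submodule ((\<lambda>a. a \<odot>\<^bsub>M\<^esub> x) ` carrier R) R M"
proof (rule submoduleI)
  show "\<zero>\<^bsub>M\<^esub> \<in> (\<lambda>a. a \<odot>\<^bsub>M\<^esub> x) ` carrier R" using smult_zero_left[OF x] R.zero_closed by (metis image_eqI)
  show "y \<oplus>\<^bsub>M\<^esub> z \<in> (\<lambda>a. a \<odot>\<^bsub>M\<^esub> x) ` carrier R"
    if yz: "y \<in> (\<lambda>a. a \<odot>\<^bsub>M\<^esub> x) ` carrier R" "z \<in> (\<lambda>a. a \<odot>\<^bsub>M\<^esub> x) ` carrier R" for y z
  proof -
    obtain a b where "a \<in> carrier R" "b \<in> carrier R" "y = a \<odot>\<^bsub>M\<^esub> x" "z = b \<odot>\<^bsub>M\<^esub> x" using yz by blast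
    then show ?thesis using x by (intro image_eqI[of _ _ "a \<oplus>\<^bsub>R\<^esub> b"]) (auto simp: smult_l_distr)
  qed
  show "b \<odot>\<^bsub>M\<^esub> y \<in> (\<lambda>a. a \<odot>\<^bsub>M\<^esub> x) ` carrier R"
    if b: "b \<in> carrier R" and y: "y \<in> (\<lambda>a. a \<odot>\<^bsub>M\<^esub> x) ` carrier R" for b y
  proof -
    obtain a where "a \<in> carrier R" "y = a \<odot>\<^bsub>M\<^esub> x" using y by blast
    then show ?thesis using x b by (intro image_eqI[of _ _ "b \<otimes>\<^bsub>R\<^esub> a"]) (auto simp: smult_assoc1)
  qed
qed (auto intro: smult_closed x)

lemma cyclic_self: "x \<in> carrier M \<Longrightarrow> x \<in> (\<lambda>a. a \<odot>\<^bsub>M\<^esub> x) ` carrier R"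
  using smult_one[of x] R.one_closed by (metis image_eqI)

lemma cyclic_least:
  assumes "submodule H R M" "x \<in> H"
  shows "(\<lambda>a. a \<odot>\<^bsub>M\<^esub> x) ` carrier R \<subseteq> H"
  using submodule_smult_mem[OF assms(1) _ assms(2)] by auto

lemma submodule_Inter:
  assumes "\<And>H. H \<in> C \<Longrightarrow> submodule H R M" "C \<noteq> {}"
  shows "submodule (\<Inter>C) R M"
proof -
  note D = submoduleD[OF assms(1)]
  obtain H where H: "H \<in> C" using assms(2) by blast
  show ?thesis
  proof (rule submoduleI)
    show "\<Inter>C \<subseteq> carrier M" using submodule_subset[OF assms(1)[OF H]] H by blast
  qed (auto simp: D)
qed

lemma submodule_gen_submodule:
  assumes "S \<subseteq> carrier M"
  shows "submodule (submodule_gen R M S) R M"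
  unfolding submodule_gen_def using assms submodule_carrier by (intro submodule_Inter) auto

lemma submodule_gen_upper: "S \<subseteq> submodule_gen R M S"
  by (auto simp: submodule_gen_def)

lemma submodule_gen_least: "submodule H R M \<Longrightarrow> S \<subseteq> H \<Longrightarrow> submodule_gen R M S \<subseteq> H"
  by (auto simp: submodule_gen_def)

lemma left_module_sub:
  assumes H: "submodule H R M"
  shows "left_module R (M\<lparr>carrier := H\<rparr>)"
proof -
  note sub = submodule_subset[OF H, THEN subsetD]
  have "abelian_group (M\<lparr>carrier := H\<rparr>)"
  proof (rule abelian_groupI)
    show "\<exists>y\<in>carrier (M\<lparr>carrier := H\<rparr>). y \<oplus>\<^bsub>M\<lparr>carrier := H\<rparr>\<^esub> x = \<zero>\<^bsub>M\<lparr>carrier := H\<rparr>\<^esub>"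
      if "x \<in> carrier (M\<lparr>carrier := H\<rparr>)" for x
      using that submodule_uminus_mem[OF H, of x] sub[of x] M.l_neg[of x] by auto
  qed (auto simp: submoduleD[OF H] sub M.a_ac)
  then show ?thesis
    by (intro left_module.intro left_module_axioms.intro R.ring_axioms)
      (auto simp: sub submoduleD[OF H] smult_l_distr smult_r_distr smult_assoc1 smult_one)
qed

text \<open>The additive inverse is a description that ranges over the carrier, so shrinking the
  carrier changes the term; uniqueness of inverses shows that the value stays.\<close>

lemma a_inv_sub:
  assumes H: "submodule H R M" and x: "x \<in> H"
  shows "\<ominus>\<^bsub>M\<lparr>carrier := H\<rparr>\<^esub> x = \<ominus>\<^bsub>M\<^esub> x"
proof -
  interpret H: left_module R "M\<lparr>carrier := H\<rparr>" by (rule left_module_sub[OF H])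
  show ?thesis
    by (rule H.M.minus_equality) (use x submoduleD[OF H] submodule_subset[OF H] M.l_neg in auto)
qed

lemma submodule_sub_iff:
  assumes H: "submodule H R M"
  shows "submodule K R (M\<lparr>carrier := H\<rparr>) \<longleftrightarrow> submodule K R M \<and> K \<subseteq> H"
proof
  interpret H: left_module R "M\<lparr>carrier := H\<rparr>" by (rule left_module_sub[OF H])
  show "submodule K R M \<and> K \<subseteq> H" if K: "submodule K R (M\<lparr>carrier := H\<rparr>)"
    using submoduleD[OF K] submodule_subset[OF H] by (auto intro!: submoduleI)
  show "submodule K R (M\<lparr>carrier := H\<rparr>)" if K: "submodule K R M \<and> K \<subseteq> H"
    using submoduleD[OF conjunct1[OF K]] K by (auto intro!: H.submoduleI)
qed

end

lemma mod_homD: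
  assumes "f \<in> mod_hom A X Y"
  shows mod_hom_closed: "x \<in> carrier X \<Longrightarrow> f x \<in> carrier Y"
    and mod_hom_add: "x \<in> carrier X \<Longrightarrow> y \<in> carrier X \<Longrightarrow> f (x \<oplus>\<^bsub>X\<^esub> y) = f x \<oplus>\<^bsub>Y\<^esub> f y"
    and mod_hom_smult: "a \<in> carrier A \<Longrightarrow> x \<in> carrier X \<Longrightarrow> f (a \<odot>\<^bsub>X\<^esub> x) = a \<odot>\<^bsub>Y\<^esub> f x"
  using assms by (auto simp: mod_hom_def)

lemma mod_homI:
  assumes "\<And>x. x \<in> carrier X \<Longrightarrow> f x \<in> carrier Y"
    and "\<And>x y. x \<in> carrier X \<Longrightarrow> y \<in> carrier X \<Longrightarrow> f (x \<oplus>\<^bsub>X\<^esub> y) = f x \<oplus>\<^bsub>Y\<^esub> f y"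
    and "\<And>a x. a \<in> carrier A \<Longrightarrow> x \<in> carrier X \<Longrightarrow> f (a \<odot>\<^bsub>X\<^esub> x) = a \<odot>\<^bsub>Y\<^esub> f x"
  shows "f \<in> mod_hom A X Y"
  using assms by (auto simp: mod_hom_def)

lemma mod_hom_comp:
  assumes "f \<in> mod_hom A X Y" "g \<in> mod_hom A Y Z"
  shows "(\<lambda>x. g (f x)) \<in> mod_hom A X Z"
  using assms by (auto simp: mod_hom_def Pi_iff)

lemma mod_hom_sub_codomain:
  assumes "f \<in> mod_hom A X Y" "f ` carrier X \<subseteq> H"
  shows "f \<in> mod_hom A X (Y\<lparr>carrier := H\<rparr>)"
  using assms by (auto simp: mod_hom_def)

lemma mod_hom_of_sub_codomain:
  assumes "f \<in> mod_hom A X (Y\<lparr>carrier := H\<rparr>)" "H \<subseteq> carrier Y"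
  shows "f \<in> mod_hom A X Y"
  using assms by (auto simp: mod_hom_def)

lemma mod_hom_sub_domain:
  assumes "f \<in> mod_hom A X Y" "H \<subseteq> carrier X"
  shows "f \<in> mod_hom A (X\<lparr>carrier := H\<rparr>) Y"
  using mod_homD[OF assms(1)] assms(2) by (intro mod_homI) (auto simp: subset_iff)

lemma mod_hom_incl: "H \<subseteq> carrier X \<Longrightarrow> (\<lambda>x. x) \<in> mod_hom A (X\<lparr>carrier := H\<rparr>) X"
  by (auto simp: mod_hom_def)

section \<open>Kernels, images and factorisation of homomorphisms\<close>

locale module_hom = X?: left_module A X + Y?: left_module A Y
  for A :: "('a, 'c) ring_scheme" and X :: "('a, 'm, 'd) module_scheme"
    and Y :: "('a, 'n, 'e) module_scheme" +
  fixes f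
  assumes hom: "f \<in> mod_hom A X Y"
begin

lemmas closed = mod_hom_closed[OF hom]
lemmas add = mod_hom_add[OF hom]
lemmas smult = mod_hom_smult[OF hom]

lemma zero: "f \<zero>\<^bsub>X\<^esub> = \<zero>\<^bsub>Y\<^esub>"
  using smult[of "\<zero>\<^bsub>A\<^esub>" "\<zero>\<^bsub>X\<^esub>"] closed[of "\<zero>\<^bsub>X\<^esub>"]
  by (simp add: X.smult_zero_left Y.smult_zero_left)

lemma uminus: "x \<in> carrier X \<Longrightarrow> f (\<ominus>\<^bsub>X\<^esub> x) = \<ominus>\<^bsub>Y\<^esub> (f x)"
  using add[of "\<ominus>\<^bsub>X\<^esub> x" x] by (simp add: zero closed X.M.l_neg Y.M.minus_equality)

lemma minus: "x \<in> carrier X \<Longrightarrow> y \<in> carrier X \<Longrightarrow> f (x \<ominus>\<^bsub>X\<^esub> y) = f x \<ominus>\<^bsub>Y\<^esub> f y"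
  by (simp add: a_minus_def add uminus)

lemma image_submodule:
  assumes H: "submodule H A X"
  shows "submodule (f ` H) A Y"
proof (rule Y.submoduleI)
  note sub = submodule_subset[OF H, THEN subsetD]
  show "f ` H \<subseteq> carrier Y" using sub closed by auto
  show "\<zero>\<^bsub>Y\<^esub> \<in> f ` H" using submodule_zero_mem[OF H] zero by (metis image_eqI)
  show "x \<oplus>\<^bsub>Y\<^esub> y \<in> f ` H" if "x \<in> f ` H" "y \<in> f ` H" for x y
    using that submodule_add_mem[OF H] sub by (auto simp: add[symmetric])
  show "a \<odot>\<^bsub>Y\<^esub> x \<in> f ` H" if "a \<in> carrier A" "x \<in> f ` H" for a x
    using that submodule_smult_mem[OF H] sub by (auto simp: smult[symmetric])
qed

lemma vimage_submodule:
  assumes K: "submodule K A Y"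
  shows "submodule {x \<in> carrier X. f x \<in> K} A X"
  by (rule X.submoduleI) (auto simp: zero add smult submoduleD[OF K] intro: X.smult_closed)

lemma kernel_submodule: "submodule {x \<in> carrier X. f x = \<zero>\<^bsub>Y\<^esub>} A X"
  using vimage_submodule[OF Y.submodule_zero] by simp

lemma eq_iff_minus_kernel:
  assumes "x \<in> carrier X" "y \<in> carrier X"
  shows "f x = f y \<longleftrightarrow> f (x \<ominus>\<^bsub>X\<^esub> y) = \<zero>\<^bsub>Y\<^esub>"
  using assms closed by (simp add: minus Y.minus_eq_zero_iff)

lemma inj_on_iff: "inj_on f (carrier X) \<longleftrightarrow> (\<forall>x\<in>carrier X. f x = \<zero>\<^bsub>Y\<^esub> \<longrightarrow> x = \<zero>\<^bsub>X\<^esub>)"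
proof
  show "\<forall>x\<in>carrier X. f x = \<zero>\<^bsub>Y\<^esub> \<longrightarrow> x = \<zero>\<^bsub>X\<^esub>" if "inj_on f (carrier X)"
    using that zero by (metis X.M.zero_closed inj_onD)
  show "inj_on f (carrier X)" if "\<forall>x\<in>carrier X. f x = \<zero>\<^bsub>Y\<^esub> \<longrightarrow> x = \<zero>\<^bsub>X\<^esub>"
    using that eq_iff_minus_kernel by (auto intro!: inj_onI simp: X.minus_eq_zero_iff[symmetric] simp del: X.minus_eq_zero_iff)
qed

text \<open>Vanishing on the kernel makes \<open>h\<close> constant on the fibres of
  \<open>f\<close>, so any choice of preimages gives the same map. Homomorphisms out of cyclic
  modules, quotients and sums of submodules are built this way below.\<close>

lemma factor:
  assumes Z: "left_module A Z" and surj: "f ` carrier X = carrier Y" and h: "h \<in> mod_hom A X Z"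
    and ker: "\<And>x. x \<in> carrier X \<Longrightarrow> f x = \<zero>\<^bsub>Y\<^esub> \<Longrightarrow> h x = \<zero>\<^bsub>Z\<^esub>"
  obtains k where "k \<in> mod_hom A Y Z" "\<And>x. x \<in> carrier X \<Longrightarrow> k (f x) = h x"
proof -
  interpret h: module_hom A X Z h
    using X.left_module_axioms Z h by (simp add: module_hom_def module_hom_axioms_def)
  define g where "g = inv_into (carrier X) f"
  have g: "g y \<in> carrier X" "f (g y) = y" if "y \<in> carrier Y" for y
    using that surj by (auto simp: g_def inv_into_into f_inv_into_f)
  have eq: "h x = h x'" if "x \<in> carrier X" "x' \<in> carrier X" "f x = f x'" for x x'
    using that ker eq_iff_minus_kernel[of x x'] h.eq_iff_minus_kernel[of x x'] by simp
  have kf: "h (g (f x)) = h x" if "x \<in> carrier X" for x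
    using that closed g by (intro eq) auto
  have "(\<lambda>y. h (g y)) \<in> mod_hom A Y Z"
  proof (rule mod_homI)
    show "h (g (y \<oplus>\<^bsub>Y\<^esub> y')) = h (g y) \<oplus>\<^bsub>Z\<^esub> h (g y')" if "y \<in> carrier Y" "y' \<in> carrier Y" for y y'
      using that g by (subst h.add[symmetric]) (auto intro!: eq simp: add)
    show "h (g (a \<odot>\<^bsub>Y\<^esub> y)) = a \<odot>\<^bsub>Z\<^esub> h (g y)" if "a \<in> carrier A" "y \<in> carrier Y" for a y
      using that g by (subst h.smult[symmetric]) (auto intro!: eq simp: smult X.smult_closed Y.smult_closed)
  qed (use g h.closed in auto)
  then show thesis using kf by (rule that)
qed

end

lemma module_homI: "left_module A X \<Longrightarrow> left_module A Y \<Longrightarrow> f \<in> mod_hom A X Y \<Longrightarrow> module_hom A X Y f"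
  by (simp add: module_hom_def module_hom_axioms_def)

lemma inv_mod_hom:
  assumes "left_module A X" "left_module A Y" "f \<in> mod_hom A X Y" "bij_betw f (carrier X) (carrier Y)"
  obtains g where "g \<in> mod_hom A Y X" "\<And>x. x \<in> carrier X \<Longrightarrow> g (f x) = x"
    "\<And>y. y \<in> carrier Y \<Longrightarrow> f (g y) = y"
proof -
  interpret module_hom A X Y f using assms(1-3) by (rule module_homI)
  have surj: "f ` carrier X = carrier Y" and inj: "inj_on f (carrier X)"
    using assms(4) by (auto simp: bij_betw_def)
  obtain g where g: "g \<in> mod_hom A Y X" "\<And>x. x \<in> carrier X \<Longrightarrow> g (f x) = x"
    using factor[OF assms(1) surj, of "\<lambda>x. x"] inj inj_on_iff by (auto simp: mod_hom_def)
  moreover have "f (g y) = y" if "y \<in> carrier Y" for y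
    using surj g(2) that by (metis imageE)
  ultimately show thesis by (rule that)
qed

section \<open>Cosets and the canonical projection\<close>

context left_module
begin

lemma quot_carrier: "carrier (quot_mod M N) = (\<lambda>x. N +>\<^bsub>M\<^esub> x) ` carrier M"
  by (auto simp: quot_mod_def A_RCOSETS_def')

lemma quot_zero: "\<zero>\<^bsub>quot_mod M N\<^esub> = N"
  by (simp add: quot_mod_def)

lemma coset_eq_iff:
  assumes N: "submodule N R M" and "x \<in> carrier M" "y \<in> carrier M"
  shows "N +>\<^bsub>M\<^esub> x = N +>\<^bsub>M\<^esub> y \<longleftrightarrow> x \<ominus>\<^bsub>M\<^esub> y \<in> N"
proof -
  have sg: "subgroup N (add_monoid M)" using N by (simp add: submodule_def)
  have memb: "z \<in> N +>\<^bsub>M\<^esub> w \<longleftrightarrow> z \<ominus>\<^bsub>M\<^esub> w \<in> N" if "z \<in> carrier M" "w \<in> carrier M" for z w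
  proof
    assume "z \<in> N +>\<^bsub>M\<^esub> w"
    then obtain n where "n \<in> N" "z = n \<oplus>\<^bsub>M\<^esub> w" by (auto simp: a_r_coset_def')
    then show "z \<ominus>\<^bsub>M\<^esub> w \<in> N" using that submodule_subset[OF N] by (auto simp: a_minus_def M.a_assoc M.r_neg)
  next
    assume "z \<ominus>\<^bsub>M\<^esub> w \<in> N"
    moreover have "z = (z \<ominus>\<^bsub>M\<^esub> w) \<oplus>\<^bsub>M\<^esub> w" using that by (simp add: a_minus_def M.a_assoc M.l_neg)
    ultimately show "z \<in> N +>\<^bsub>M\<^esub> w" by (auto simp: a_r_coset_def')
  qed
  show ?thesis
  proof
    assume "N +>\<^bsub>M\<^esub> x = N +>\<^bsub>M\<^esub> y"
    moreover have "x \<in> N +>\<^bsub>M\<^esub> x"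
      using memb[of x x] assms submodule_zero_mem[OF N] by (simp add: a_minus_def M.r_neg)
    ultimately show "x \<ominus>\<^bsub>M\<^esub> y \<in> N" using memb assms by auto
  next
    assume "x \<ominus>\<^bsub>M\<^esub> y \<in> N"
    then show "N +>\<^bsub>M\<^esub> x = N +>\<^bsub>M\<^esub> y" using memb[of x y] M.a_repr_independence[OF _ assms(3) sg, of x] assms by auto
  qed
qed

lemma coset_eq_self_iff:
  assumes N: "submodule N R M" and x: "x \<in> carrier M"
  shows "N +>\<^bsub>M\<^esub> x = N \<longleftrightarrow> x \<in> N"
  using coset_eq_iff[OF N x M.zero_closed] submodule_subset[OF N] x by (simp add: minus_zero)

lemma quot_proj_hom:
  assumes N: "submodule N R M"
  shows "(\<lambda>x. N +>\<^bsub>M\<^esub> x) \<in> mod_hom R M (quot_mod M N)"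
proof (rule mod_homI)
  interpret N: abelian_subgroup N M
    using N M.abelian_group_axioms by (intro abelian_subgroupI3) (auto simp: additive_subgroup_def submodule_def)
  show "N +>\<^bsub>M\<^esub> (x \<oplus>\<^bsub>M\<^esub> y) = (N +>\<^bsub>M\<^esub> x) \<oplus>\<^bsub>quot_mod M N\<^esub> (N +>\<^bsub>M\<^esub> y)"
    if "x \<in> carrier M" "y \<in> carrier M" for x y
    using that N.a_rcos_sum by (simp add: quot_mod_def)
qed (auto simp: quot_carrier quot_mod_smult[OF N])

lemma quot_proj_module_hom:
  assumes N: "submodule N R M"
  shows "module_hom R M (quot_mod M N) (\<lambda>x. N +>\<^bsub>M\<^esub> x)"
  by (intro module_homI left_module_axioms left_module_quot_mod quot_proj_hom N)

end

section \<open>Direct sums and homomorphisms into and out of them\<close>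

lemma dsum_simps [simp]:
  "carrier (dsum X Y) = carrier X \<times> carrier Y"
  "\<zero>\<^bsub>dsum X Y\<^esub> = (\<zero>\<^bsub>X\<^esub>, \<zero>\<^bsub>Y\<^esub>)"
  "(x, y) \<oplus>\<^bsub>dsum X Y\<^esub> (x', y') = (x \<oplus>\<^bsub>X\<^esub> x', y \<oplus>\<^bsub>Y\<^esub> y')"
  "a \<odot>\<^bsub>dsum X Y\<^esub> (x, y) = (a \<odot>\<^bsub>X\<^esub> x, a \<odot>\<^bsub>Y\<^esub> y)"
  by (simp_all add: dsum_def)

lemma left_module_dsum:
  assumes X: "left_module A X" and Y: "left_module A Y"
  shows "left_module A (dsum X Y)"
proof -
  interpret X: left_module A X by fact
  interpret Y: left_module A Y by fact
  have "abelian_group (dsum X Y)"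
  proof (rule abelian_groupI)
    show "\<exists>y\<in>carrier (dsum X Y). y \<oplus>\<^bsub>dsum X Y\<^esub> x = \<zero>\<^bsub>dsum X Y\<^esub>" if "x \<in> carrier (dsum X Y)" for x
      using that by (intro bexI[of _ "(\<ominus>\<^bsub>X\<^esub> fst x, \<ominus>\<^bsub>Y\<^esub> snd x)"]) (auto simp: X.M.l_neg Y.M.l_neg)
  qed (auto simp: X.M.a_ac Y.M.a_ac)
  then show ?thesis
    by (intro left_module.intro left_module_axioms.intro X.R.ring_axioms)
      (auto simp: X.smult_closed Y.smult_closed X.smult_l_distr Y.smult_l_distr
        X.smult_r_distr Y.smult_r_distr X.smult_assoc1 Y.smult_assoc1 X.smult_one Y.smult_one)
qed

lemma dsum_fst_hom: "fst \<in> mod_hom A (dsum X Y) X"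
  and dsum_snd_hom: "snd \<in> mod_hom A (dsum X Y) Y"
  by (auto simp: mod_hom_def)

lemma mod_hom_pair:
  assumes "f \<in> mod_hom A Z X" "g \<in> mod_hom A Z Y"
  shows "(\<lambda>z. (f z, g z)) \<in> mod_hom A Z (dsum X Y)"
  using assms by (auto simp: mod_hom_def Pi_iff)

lemma mod_hom_copair:
  assumes "left_module A Z" "f \<in> mod_hom A X Z" "g \<in> mod_hom A Y Z"
  shows "(\<lambda>(x, y). f x \<oplus>\<^bsub>Z\<^esub> g y) \<in> mod_hom A (dsum X Y) Z"
proof -
  interpret Z: left_module A Z by fact
  show ?thesis
    using mod_homD[OF assms(2)] mod_homD[OF assms(3)]
    by (intro mod_homI) (auto simp: Z.M.a_ac Z.smult_r_distr)
qed

lemma mod_hom_minus: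
  assumes "left_module A Y" "f \<in> mod_hom A X Y" "g \<in> mod_hom A X Y"
  shows "(\<lambda>x. f x \<ominus>\<^bsub>Y\<^esub> g x) \<in> mod_hom A X Y"
proof -
  interpret Y: left_module A Y by fact
  have sm: "a \<odot>\<^bsub>Y\<^esub> (\<ominus>\<^bsub>Y\<^esub> y) = \<ominus>\<^bsub>Y\<^esub> (a \<odot>\<^bsub>Y\<^esub> y)" if "a \<in> carrier A" "y \<in> carrier Y" for a y
    using that Y.smult_r_distr[of a "\<ominus>\<^bsub>Y\<^esub> y" y]
    by (intro Y.M.minus_equality[symmetric]) (auto simp: Y.M.l_neg Y.smult_zero_right Y.smult_closed)
  show ?thesis
    using mod_homD[OF assms(2)] mod_homD[OF assms(3)]
    by (intro mod_homI) (auto simp: a_minus_def Y.M.minus_add Y.M.a_ac Y.smult_r_distr sm Y.smult_closed)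
qed

lemma mod_hom_zero:
  assumes "left_module A Y"
  shows "(\<lambda>_. \<zero>\<^bsub>Y\<^esub>) \<in> mod_hom A X Y"
proof -
  interpret Y: left_module A Y by fact
  show ?thesis by (rule mod_homI) (auto simp: Y.smult_zero_right)
qed

section \<open>Finite length\<close>

text \<open>A module has finite length iff its submodules admit a strictly monotone rank in \<open>\<nat>\<close>; this form
  passes to submodules and quotients without any chain manipulation.\<close>

definition fin_length_between ::
    "('a, 'c) ring_scheme \<Rightarrow> ('a, 'm, 'd) module_scheme \<Rightarrow> 'm set \<Rightarrow> 'm set \<Rightarrow> bool" where
  "fin_length_between A X H K \<longleftrightarrow> (\<exists>l :: 'm set \<Rightarrow> nat. \<forall>Q Q'. submodule Q A X \<and> submodule Q' A X \<and>
     H \<subseteq> Q \<and> Q \<subset> Q' \<and> Q' \<subseteq> K \<longrightarrow> l Q < l Q')"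

definition fin_length :: "('a, 'c) ring_scheme \<Rightarrow> ('a, 'm, 'd) module_scheme \<Rightarrow> bool" where
  "fin_length A X \<longleftrightarrow> (\<exists>l :: 'm set \<Rightarrow> nat. \<forall>H K. submodule H A X \<and> submodule K A X \<and> H \<subset> K \<longrightarrow> l H < l K)"

lemma regular_module_simps [simp]:
  "carrier (regular_module A) = carrier A" "\<zero>\<^bsub>regular_module A\<^esub> = \<zero>\<^bsub>A\<^esub>"
  "add (regular_module A) = add A" "smult (regular_module A) = mult A"
  by (simp_all add: regular_module_def)

lemma (in ring) left_module_regular: "left_module R (regular_module R)"
proof -
  have "abelian_group (regular_module R)"
  proof (rule abelian_groupI)
    show "\<exists>y\<in>carrier (regular_module R). y \<oplus>\<^bsub>regular_module R\<^esub> x = \<zero>\<^bsub>regular_module R\<^esub>"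
      if "x \<in> carrier (regular_module R)" for x
      using that by (intro bexI[of _ "\<ominus> x"]) (auto simp: l_neg)
  qed (auto simp: a_ac)
  then show ?thesis
    by (intro left_module.intro left_module_axioms.intro ring_axioms) (auto simp: l_distr r_distr m_assoc)
qed

text \<open>The artinian condition is phrased with ideals, rank functions with submodules of the
  regular module; commutativity supplies multiplication on the other side.\<close>

lemma (in cring) submodule_regular_ideal:
  assumes "submodule H R (regular_module R)"
  shows "ideal H R"
proof (rule idealI)
  show "subgroup H (add_monoid R)"
  proof (rule subgroup.intro)
    show "inv\<^bsub>add_monoid R\<^esub> x \<in> H" if "x \<in> H" for x
      using submodule_uminus_mem[OF assms that] by (simp add: a_inv_def m_inv_def)
  qed (use submoduleD[OF assms] in auto)
  show "x \<otimes> a \<in> H" if "a \<in> H" "x \<in> carrier R" for a x using submodule_smult_mem[OF assms that(2,1)] by simp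
  then show "a \<otimes> x \<in> H" if "a \<in> H" "x \<in> carrier R" for a x
    using that submodule_subset[OF assms] m_comm[of a x] by auto
qed (rule ring_axioms)

section \<open>Extremal submodules and the construction of rank functions\<close>

context left_module
begin

text \<open>Ranks are bounded by the rank of the whole module, so among the submodules with property
  \<open>Q\<close> one has greatest rank, and strict monotonicity makes it maximal for inclusion.
  Such choices stand in for ascending chains.\<close>

lemma fin_length_maximal:
  assumes "fin_length R M" "submodule H0 R M" "Q H0"
  shows "\<exists>H. submodule H R M \<and> Q H \<and> (\<forall>K. submodule K R M \<and> Q K \<and> H \<subseteq> K \<longrightarrow> K = H)"
proof -
  obtain l :: "_ \<Rightarrow> nat" where l: "\<And>H K. submodule H R M \<Longrightarrow> submodule K R M \<Longrightarrow> H \<subset> K \<Longrightarrow> l H < l K"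
    using assms(1) unfolding fin_length_def by metis
  have "l H \<le> l (carrier M)" if "submodule H R M" for H
    using l[OF that submodule_carrier] submodule_subset[OF that] by (metis less_imp_le order_refl psubsetI)
  \<comment> \<open>The principle of the greatest value asks for a strict bound, hence the
    \<open>Suc\<close>.\<close>
  then have "\<exists>H. (submodule H R M \<and> Q H) \<and> (\<forall>K. submodule K R M \<and> Q K \<longrightarrow> l K \<le> l H)"
    using assms(2,3) by (intro ex_has_greatest_nat[where b = "Suc (l (carrier M))"]) (auto simp: less_Suc_eq_le)
  then obtain H where H: "submodule H R M \<and> Q H" "\<And>K. submodule K R M \<and> Q K \<longrightarrow> l K \<le> l H" by metis
  have "K = H" if "submodule K R M" "Q K" "H \<subseteq> K" for K
    proof (rule ccontr)
      assume "K \<noteq> H"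
      then have "l H < l K" using that H(1) by (intro l) auto
      then show False using H(2)[of K] that by simp
    qed
  then show ?thesis using H(1) by blast
qed

lemma fin_length_minimal:
  assumes "fin_length R M" "submodule H0 R M" "Q H0"
  shows "\<exists>H. submodule H R M \<and> Q H \<and> (\<forall>K. submodule K R M \<and> Q K \<and> K \<subseteq> H \<longrightarrow> K = H)"
proof -
  obtain l :: "_ \<Rightarrow> nat" where l: "\<And>H K. submodule H R M \<Longrightarrow> submodule K R M \<Longrightarrow> H \<subset> K \<Longrightarrow> l H < l K"
    using assms(1) unfolding fin_length_def by metis
  have "\<exists>H. (submodule H R M \<and> Q H) \<and> (\<forall>K. submodule K R M \<and> Q K \<longrightarrow> l H \<le> l K)"
    using assms(2,3) by (intro ex_has_least_nat) auto
  then obtain H where H: "submodule H R M \<and> Q H" "\<And>K. submodule K R M \<and> Q K \<longrightarrow> l H \<le> l K" by metis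
  have "K = H" if "submodule K R M" "Q K" "K \<subseteq> H" for K
    proof (rule ccontr)
      assume "K \<noteq> H"
      then have "l K < l H" using that H(1) by (intro l) auto
      then show False using H(2)[of K] that by simp
    qed
  then show ?thesis using H(1) by blast
qed

text \<open>Zorn's lemma rather than a rank, because the finite length of an artinian ring is itself
  derived from this. In the quotient by such an \<open>H\<close> every nonzero submodule contains
  the class of \<open>v\<close>, so that class spans an essential simple socle.\<close>

lemma exists_maximal_avoiding:
  assumes H0: "submodule H0 R M" and v: "v \<notin> H0"
  shows "\<exists>H. submodule H R M \<and> H0 \<subseteq> H \<and> v \<notin> H \<and> (\<forall>K. submodule K R M \<and> H \<subset> K \<longrightarrow> v \<in> K)"
proof -
  let ?C = "{H. submodule H R M \<and> H0 \<subseteq> H \<and> v \<notin> H}"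
  have "\<exists>H\<in>?C. \<forall>K\<in>?C. H \<subseteq> K \<longrightarrow> K = H"
  proof (rule subset_Zorn_nonempty)
    fix C assume C: "C \<noteq> {}" "subset.chain ?C C"
    have sm: "submodule H R M" if "H \<in> C" for H using C(2) that by (auto simp: subset_chain_def)
    have "submodule (\<Union>C) R M"
    proof (rule submoduleI)
      show "\<Union>C \<subseteq> carrier M" using submodule_subset[OF sm] by blast
      show "\<zero>\<^bsub>M\<^esub> \<in> \<Union>C" using C(1) submodule_zero_mem[OF sm] by blast
      show "a \<odot>\<^bsub>M\<^esub> x \<in> \<Union>C" if "a \<in> carrier R" "x \<in> \<Union>C" for a x
        using that submodule_smult_mem[OF sm] by blast
      show "x \<oplus>\<^bsub>M\<^esub> y \<in> \<Union>C" if xy: "x \<in> \<Union>C" "y \<in> \<Union>C" for x y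
      proof -
        obtain H K where HK: "H \<in> C" "K \<in> C" "x \<in> H" "y \<in> K" using xy by blast
        then have "H \<subseteq> K \<or> K \<subseteq> H" using C(2) by (auto simp: subset_chain_def)
        then show ?thesis using HK submodule_add_mem[OF sm] by blast
      qed
    qed
    then show "\<Union>C \<in> ?C" using C by (auto simp: subset_chain_def)
  qed (use assms in auto)
  then obtain H where H: "H \<in> ?C" "\<forall>K\<in>?C. H \<subseteq> K \<longrightarrow> K = H" by (elim bexE)
  have "v \<in> K" if "submodule K R M" "H \<subset> K" for K
    using H that by (metis (mono_tags, lifting) mem_Collect_eq order_trans psubset_eq)
  then show ?thesis using H(1) by (intro exI[of _ H]) auto
qed

text \<open>The rank of \<open>Q\<close> is the rank of \<open>Q \<inter> K\<close> plus that of
  \<open>Q + K\<close>. By the modular law both terms can stay the same only if \<open>Q\<close>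
  does.\<close>

lemma fin_length_between_trans:
  assumes K: "submodule K R M" and HK: "H \<subseteq> K" and KG: "K \<subseteq> G" "submodule G R M"
    and "fin_length_between R M H K" "fin_length_between R M K G"
  shows "fin_length_between R M H G"
proof -
  obtain l1 l2 :: "_ \<Rightarrow> nat" where
    l1: "\<And>Q Q'. submodule Q R M \<Longrightarrow> submodule Q' R M \<Longrightarrow> H \<subseteq> Q \<Longrightarrow> Q \<subset> Q' \<Longrightarrow> Q' \<subseteq> K \<Longrightarrow> l1 Q < l1 Q'" and
    l2: "\<And>Q Q'. submodule Q R M \<Longrightarrow> submodule Q' R M \<Longrightarrow> K \<subseteq> Q \<Longrightarrow> Q \<subset> Q' \<Longrightarrow> Q' \<subseteq> G \<Longrightarrow> l2 Q < l2 Q'"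
    using assms(5,6) unfolding fin_length_between_def by metis
  have "l1 (Q \<inter> K) + l2 (Q <+>\<^bsub>M\<^esub> K) < l1 (Q' \<inter> K) + l2 (Q' <+>\<^bsub>M\<^esub> K)"
    if Q: "submodule Q R M" "submodule Q' R M" "H \<subseteq> Q" "Q \<subset> Q'" "Q' \<subseteq> G" for Q Q'
  proof -
    note sm = submodule_Int[OF Q(1) K] submodule_Int[OF Q(2) K]
      submodule_set_add[OF Q(1) K] submodule_set_add[OF Q(2) K]
    have sub: "Q \<inter> K \<subseteq> Q' \<inter> K" "Q <+>\<^bsub>M\<^esub> K \<subseteq> Q' <+>\<^bsub>M\<^esub> K"
      using Q(4) unfolding set_add_iff subset_iff psubset_eq by blast+
    have le1: "Q \<inter> K \<noteq> Q' \<inter> K \<Longrightarrow> l1 (Q \<inter> K) < l1 (Q' \<inter> K)"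
      using sm Q(3) HK sub by (intro l1) auto
    have le2: "Q <+>\<^bsub>M\<^esub> K \<noteq> Q' <+>\<^bsub>M\<^esub> K \<Longrightarrow> l2 (Q <+>\<^bsub>M\<^esub> K) < l2 (Q' <+>\<^bsub>M\<^esub> K)"
      using sm sub(2) set_add_upper2[OF Q(1) K] set_add_least[OF KG(2) Q(5) KG(1)] by (intro l2) auto
    have "Q' \<subseteq> Q" if eq: "Q \<inter> K = Q' \<inter> K" "Q <+>\<^bsub>M\<^esub> K = Q' <+>\<^bsub>M\<^esub> K"
    proof
      fix x assume x: "x \<in> Q'"
      then have "x \<in> Q <+>\<^bsub>M\<^esub> K" using eq(2) set_add_upper1[OF Q(2) K] by blast
      then obtain q k where qk: "q \<in> Q" "k \<in> K" "x = q \<oplus>\<^bsub>M\<^esub> k" by (auto simp: set_add_iff)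
      have c: "q \<in> carrier M" "k \<in> carrier M" "x \<in> carrier M"
        using qk x submodule_subset[OF Q(1)] submodule_subset[OF K] submodule_subset[OF Q(2)] by auto
      then have "k = x \<ominus>\<^bsub>M\<^esub> q" using qk by (simp add: add_minus_cancel)
      moreover have "x \<ominus>\<^bsub>M\<^esub> q \<in> Q'" using qk x Q(4) submodule_minus_mem[OF Q(2)] by blast
      ultimately have "k \<in> Q' \<inter> K" using qk(2) by simp
      then have "k \<in> Q" using eq(1) by blast
      then show "x \<in> Q" using qk submodule_add_mem[OF Q(1)] by blast
    qed
    then show ?thesis using le1 le2 Q(4) by fastforce
  qed
  then show ?thesis unfolding fin_length_between_def by (intro exI[of _ "\<lambda>Q. l1 (Q \<inter> K) + l2 (Q <+>\<^bsub>M\<^esub> K)"]) blast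
qed

lemma fin_length_between_mono:
  "fin_length_between R M H G \<Longrightarrow> K \<subseteq> G \<Longrightarrow> fin_length_between R M H K"
  unfolding fin_length_between_def by (meson order_trans)

lemma fin_length_iff_between: "fin_length R M \<longleftrightarrow> fin_length_between R M {\<zero>\<^bsub>M\<^esub>} (carrier M)"
  unfolding fin_length_def fin_length_between_def
  using submodule_subset[of _ R M] submodule_zero_mem[of _ R M] by (metis empty_subsetI insert_subset)

text \<open>A submodule \<open>Q\<close> between \<open>G\<close> and \<open>G + R x\<close> is
  determined by the left ideal of all \<open>a\<close> with \<open>a x \<in> Q\<close>, so a rank on
  left ideals measures the interval.\<close>

lemma fin_length_between_cyclic:
  assumes "fin_length R (regular_module R)" and G: "submodule G R M" and x: "x \<in> carrier M"
  shows "fin_length_between R M G (G <+>\<^bsub>M\<^esub> (\<lambda>a. a \<odot>\<^bsub>M\<^esub> x) ` carrier R)"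
proof -
  obtain l :: "_ \<Rightarrow> nat" where l: "\<And>H K. submodule H R (regular_module R) \<Longrightarrow>
      submodule K R (regular_module R) \<Longrightarrow> H \<subset> K \<Longrightarrow> l H < l K"
    using assms(1) unfolding fin_length_def by metis
  have hom: "module_hom R (regular_module R) M (\<lambda>a. a \<odot>\<^bsub>M\<^esub> x)"
    using x by (intro module_homI R.left_module_regular left_module_axioms mod_homI)
      (auto simp: smult_closed smult_l_distr smult_assoc1)
  let ?f = "\<lambda>Q. {a \<in> carrier R. a \<odot>\<^bsub>M\<^esub> x \<in> Q}"
  have "l (?f Q) < l (?f Q')"
    if Q: "submodule Q R M" "submodule Q' R M" "G \<subseteq> Q" "Q \<subset> Q'" "Q' \<subseteq> G <+>\<^bsub>M\<^esub> (\<lambda>a. a \<odot>\<^bsub>M\<^esub> x) ` carrier R"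
    for Q Q'
  proof (rule l)
    show "submodule (?f Q) R (regular_module R)" "submodule (?f Q') R (regular_module R)"
      using module_hom.vimage_submodule[OF hom] Q by simp_all
    obtain y where y: "y \<in> Q'" "y \<notin> Q" using Q(4) by blast
    then have "y \<in> G <+>\<^bsub>M\<^esub> (\<lambda>a. a \<odot>\<^bsub>M\<^esub> x) ` carrier R" using Q(5) by blast
    then obtain g a where ga: "g \<in> G" "a \<in> carrier R" "y = g \<oplus>\<^bsub>M\<^esub> a \<odot>\<^bsub>M\<^esub> x"
      unfolding set_add_iff by blast
    have c: "g \<in> carrier M" "a \<odot>\<^bsub>M\<^esub> x \<in> carrier M" using ga x smult_closed submodule_subset[OF G] by auto
    then have "a \<odot>\<^bsub>M\<^esub> x = y \<ominus>\<^bsub>M\<^esub> g" using ga by (simp add: add_minus_cancel)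
    moreover have "g \<in> Q'" using ga Q(3,4) by blast
    then have "y \<ominus>\<^bsub>M\<^esub> g \<in> Q'" using y(1) by (rule submodule_minus_mem[OF Q(2), rotated])
    ultimately have "a \<in> ?f Q'" using ga(2) by simp
    moreover have "a \<notin> ?f Q" using y ga Q(3) submodule_add_mem[OF Q(1)] by blast
    moreover have "?f Q \<subseteq> ?f Q'" using Q(4) by blast
    ultimately show "?f Q \<subset> ?f Q'" by blast
  qed
  then show ?thesis unfolding fin_length_between_def by (intro exI[of _ "\<lambda>Q. l (?f Q)"]) blast
qed

lemma fin_length_of_fin_gen:
  assumes "fin_length R (regular_module R)" "fin_gen R M"
  shows "fin_length R M"
proof -
  obtain S where S: "finite S" "S \<subseteq> carrier M" "submodule_gen R M S = carrier M"
    using assms(2) by (auto simp: fin_gen_def)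
  have "fin_length_between R M {\<zero>\<^bsub>M\<^esub>} (submodule_gen R M S)"
    using S(1,2)
  proof (induction S rule: finite_induct)
    case empty
    have "submodule_gen R M {} \<subseteq> {\<zero>\<^bsub>M\<^esub>}" by (rule submodule_gen_least[OF submodule_zero]) auto
    then show ?case unfolding fin_length_between_def by (intro exI[of _ "\<lambda>_. 0"]) blast
  next
    case (insert x S)
    let ?G = "submodule_gen R M S" and ?C = "(\<lambda>a. a \<odot>\<^bsub>M\<^esub> x) ` carrier R"
    have G: "submodule ?G R M" and C: "submodule ?C R M" and x: "x \<in> carrier M"
      using insert.prems by (auto intro: submodule_gen_submodule submodule_cyclic)
    have "insert x S \<subseteq> ?G <+>\<^bsub>M\<^esub> ?C"
      using set_add_upper1[OF G C] set_add_upper2[OF G C] submodule_gen_upper[of S] cyclic_self[OF x] by blast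
    then have "submodule_gen R M (insert x S) \<subseteq> ?G <+>\<^bsub>M\<^esub> ?C"
      by (rule submodule_gen_least[OF submodule_set_add[OF G C]])
    moreover have "fin_length_between R M {\<zero>\<^bsub>M\<^esub>} (?G <+>\<^bsub>M\<^esub> ?C)"
    proof (rule fin_length_between_trans[OF G])
      show "fin_length_between R M {\<zero>\<^bsub>M\<^esub>} ?G" using insert.IH insert.prems by simp
      show "fin_length_between R M ?G (?G <+>\<^bsub>M\<^esub> ?C)" by (rule fin_length_between_cyclic[OF assms(1) G x])
    qed (use submodule_zero_mem[OF G] set_add_upper1[OF G C] submodule_set_add[OF G C] in auto)
    ultimately show ?case using fin_length_between_mono by blast
  qed
  then show ?thesis using S(3) fin_length_iff_between by simp
qed

text \<open>A maximal finitely generated submodule absorbs every further generator. Together with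
  the converse this makes finite generation pass to submodules, since finite length does.\<close>

lemma fin_gen_of_fin_length:
  assumes "fin_length R M"
  shows "fin_gen R M"
proof -
  let ?Q = "\<lambda>H. \<exists>S. finite S \<and> S \<subseteq> carrier M \<and> H = submodule_gen R M S"
  have "submodule (submodule_gen R M {}) R M" by (rule submodule_gen_submodule) simp
  moreover have "?Q (submodule_gen R M {})" by blast
  ultimately have "\<exists>H. submodule H R M \<and> ?Q H \<and> (\<forall>K. submodule K R M \<and> ?Q K \<and> H \<subseteq> K \<longrightarrow> K = H)"
    by (rule fin_length_maximal[OF assms])
  then obtain H where "submodule H R M \<and> ?Q H \<and> (\<forall>K. submodule K R M \<and> ?Q K \<and> H \<subseteq> K \<longrightarrow> K = H)"
    by (rule exE)
  then have H: "submodule H R M" "?Q H" "\<And>K. submodule K R M \<Longrightarrow> ?Q K \<Longrightarrow> H \<subseteq> K \<Longrightarrow> K = H"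
    by simp_all
  obtain S where S: "finite S" "S \<subseteq> carrier M" "H = submodule_gen R M S" using H(2) by blast
  have "x \<in> H" if x: "x \<in> carrier M" for x
  proof -
    let ?K = "submodule_gen R M (insert x S)"
    have K: "submodule ?K R M" using S x by (intro submodule_gen_submodule) auto
    have "H \<subseteq> ?K" unfolding S(3) using submodule_gen_upper[of "insert x S"]
      by (intro submodule_gen_least[OF K]) auto
    moreover have "?Q ?K" using S x by (intro exI[of _ "insert x S"]) auto
    ultimately have "?K = H" using H(3) K by blast
    then show ?thesis using submodule_gen_upper[of "insert x S"] by blast
  qed
  then show ?thesis unfolding fin_gen_def using S submodule_subset[OF H(1)] by blast
qed

lemma fin_length_sub:
  assumes "fin_length R M" and H: "submodule H R M"
  shows "fin_length R (M\<lparr>carrier := H\<rparr>)"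
proof -
  obtain l :: "_ \<Rightarrow> nat" where "\<And>H K. submodule H R M \<Longrightarrow> submodule K R M \<Longrightarrow> H \<subset> K \<Longrightarrow> l H < l K"
    using assms(1) unfolding fin_length_def by metis
  then show ?thesis unfolding fin_length_def submodule_sub_iff[OF H] by (intro exI[of _ l]) simp
qed

end

lemma (in module_hom) fin_length_image:
  assumes "fin_length A X" and surj: "f ` carrier X = carrier Y"
  shows "fin_length A Y"
proof -
  obtain l :: "_ \<Rightarrow> nat" where l: "\<And>H K. submodule H A X \<Longrightarrow> submodule K A X \<Longrightarrow> H \<subset> K \<Longrightarrow> l H < l K"
    using assms(1) unfolding fin_length_def by metis
  let ?f = "\<lambda>Q. {x \<in> carrier X. f x \<in> Q}"
  have "l (?f H) < l (?f K)" if HK: "submodule H A Y" "submodule K A Y" "H \<subset> K" for H K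
  proof (rule l)
    obtain y where y: "y \<in> K" "y \<notin> H" using HK(3) by blast
    then obtain x where "x \<in> carrier X" "y = f x" using surj submodule_subset[OF HK(2)] by blast
    then show "?f H \<subset> ?f K" using y HK(3) by blast
  qed (use HK vimage_submodule in auto)
  then show ?thesis unfolding fin_length_def by (intro exI[of _ "\<lambda>Q. l (?f Q)"]) blast
qed

section \<open>Finite length of artinian commutative rings\<close>

lemma artinian_minimal:
  assumes "artinian_cring R" "submodule H0 R (regular_module R)" "Q H0"
  shows "\<exists>H. submodule H R (regular_module R) \<and> Q H \<and>
    (\<forall>K. submodule K R (regular_module R) \<and> Q K \<and> K \<subseteq> H \<longrightarrow> K = H)"
proof (rule ccontr)
  assume no: "\<not> ?thesis"
  let ?P = "\<lambda>H. submodule H R (regular_module R) \<and> Q H"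
  have step: "\<exists>K. ?P K \<and> K \<subset> H" if "?P H" for H using that no by auto
  have "\<exists>C. \<forall>n. ?P (C n) \<and> C (Suc n) \<subset> C n"
    using assms(2,3) step by (intro dependent_nat_choice) blast+
  then obtain C where C: "\<And>n. ?P (C n)" "\<And>n. C (Suc n) \<subset> C n" by blast
  have "cring R" using assms(1) by (simp add: artinian_cring_def)
  then have "\<forall>n. ideal (C n) R \<and> C (Suc n) \<subseteq> C n"
    using C cring.submodule_regular_ideal by blast
  then obtain n where "\<forall>m\<ge>n. C m = C n" using assms(1) unfolding artinian_cring_def by blast
  then show False using C(2)[of n] by (metis le_SucI order_refl psubset_eq)
qed

text \<open>Let \<open>a\<close> be the least ideal with \<open>R/a\<close> of finite length. Then \<open>a = m a\<close> for every maximal ideal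
  \<open>m\<close>, since otherwise \<open>a\<close> has a maximal proper subideal containing \<open>m a\<close>. If \<open>a \<noteq> 0\<close>, an ideal \<open>(c)\<close> minimal
  subject to \<open>c a \<noteq> 0\<close> satisfies \<open>m c = (c)\<close> for all \<open>m\<close>, so the annihilator of \<open>c\<close> lies in
  no maximal ideal.\<close>

lemma artinian_fin_length:
  assumes art: "artinian_cring R"
  shows "fin_length R (regular_module R)"
proof -
  interpret R: cring R using art by (simp add: artinian_cring_def)
  let ?R = "regular_module R"
  interpret M: left_module R ?R by (rule R.left_module_regular)
  have minus: "x \<ominus>\<^bsub>?R\<^esub> y = x \<ominus>\<^bsub>R\<^esub> y" for x y by (simp add: a_minus_def a_inv_def m_inv_def)
  have "fin_length_between R ?R (carrier R) (carrier R)"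
    unfolding fin_length_between_def by (intro exI[of _ "\<lambda>_. 0"]) auto
  then obtain a where a: "submodule a R ?R" "fin_length_between R ?R a (carrier R)"
    and a_min: "\<And>K. submodule K R ?R \<Longrightarrow> fin_length_between R ?R K (carrier R) \<Longrightarrow> K \<subseteq> a \<Longrightarrow> K = a"
    using artinian_minimal[OF art M.submodule_carrier, of "\<lambda>K. fin_length_between R ?R K (carrier R)"]
    by (metis regular_module_simps(1))
  note ac = submodule_subset[OF a(1), simplified, THEN subsetD]
  have a_sub: "a \<subseteq> submodule_gen R ?R {u \<otimes>\<^bsub>R\<^esub> y | u y. u \<in> m \<and> y \<in> a}" (is "a \<subseteq> ?ma")
    if m: "submodule m R ?R" "\<one>\<^bsub>R\<^esub> \<notin> m" "\<forall>K. submodule K R ?R \<and> m \<subset> K \<longrightarrow> \<one>\<^bsub>R\<^esub> \<in> K" for m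
  proof (rule ccontr)
    assume "\<not> a \<subseteq> ?ma"
    then obtain v where v: "v \<in> a" "v \<notin> ?ma" by blast
    note mc = submodule_subset[OF m(1), simplified, THEN subsetD]
    have ma: "submodule ?ma R ?R"
      using mc ac by (intro M.submodule_gen_submodule) auto
    obtain H where "submodule H R ?R \<and> ?ma \<subseteq> H \<and> v \<notin> H \<and> (\<forall>K. submodule K R ?R \<and> H \<subset> K \<longrightarrow> v \<in> K)"
      using M.exists_maximal_avoiding[OF ma v(2)] by (rule exE)
    then have H: "submodule H R ?R" "?ma \<subseteq> H" "v \<notin> H"
      and H_max: "\<And>K. submodule K R ?R \<Longrightarrow> H \<subset> K \<Longrightarrow> v \<in> K" by simp_all
    note Hc = submodule_subset[OF H(1), simplified, THEN subsetD]
    have maH: "u \<otimes>\<^bsub>R\<^esub> y \<in> H" if "u \<in> m" "y \<in> a" for u y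
      by (rule subsetD[OF H(2)], rule subsetD[OF M.submodule_gen_upper]) (use that in blast)
    \<comment> \<open>Maximality of \<open>H\<close> without \<open>v\<close> puts \<open>v\<close>
      into \<open>H + R y\<close>; the summand in \<open>H\<close> equals \<open>v - r y\<close> and
      therefore stays in \<open>a\<close>.\<close>
    have reach: "\<exists>h\<in>H \<inter> a. \<exists>r\<in>carrier R. v = h \<oplus>\<^bsub>R\<^esub> r \<otimes>\<^bsub>R\<^esub> y" if y: "y \<in> a" "y \<notin> H" for y
    proof -
      let ?C = "(\<lambda>r. r \<otimes>\<^bsub>R\<^esub> y) ` carrier R"
      have C: "submodule ?C R ?R" using M.submodule_cyclic[of y] ac[OF y(1)] by simp
      have "H \<subset> H <+>\<^bsub>?R\<^esub> ?C"
        using M.set_add_upper1[OF H(1) C] M.set_add_upper2[OF H(1) C] M.cyclic_self[of y] ac[OF y(1)] y(2) by auto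
      then have "v \<in> H <+>\<^bsub>?R\<^esub> ?C" using H_max M.submodule_set_add[OF H(1) C] by blast
      then obtain h r where hr: "h \<in> H" "r \<in> carrier R" "v = h \<oplus>\<^bsub>R\<^esub> r \<otimes>\<^bsub>R\<^esub> y" unfolding set_add_iff by auto
      have "r \<otimes>\<^bsub>R\<^esub> y \<in> a" using submodule_smult_mem[OF a(1) hr(2) y(1)] by simp
      moreover have "h = v \<ominus>\<^bsub>R\<^esub> r \<otimes>\<^bsub>R\<^esub> y"
        using hr Hc ac[OF y(1)] by (simp add: a_minus_def R.a_assoc R.r_neg)
      ultimately have "h \<in> a" using submodule_minus_mem[OF a(1) v(1)] by (simp add: minus)
      then show ?thesis using hr by blast
    qed
    have b: "submodule (H \<inter> a) R ?R" by (rule M.submodule_Int[OF H(1) a(1)])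
    \<comment> \<open>Hence \<open>a/(H \<inter> a)\<close> is simple. For \<open>z \<in> a\<close>
      outside \<open>H\<close> write \<open>v = h + r z\<close>. Here \<open>r\<close> is not in
      \<open>m\<close>, because \<open>m a \<subseteq> H\<close>; so \<open>1 = u + s r\<close> with
      \<open>u \<in> m\<close>, and \<open>z = u z + s (v - h)\<close> lies in
      \<open>Q\<close>.\<close>
    have top: "Q = a" if Q: "submodule Q R ?R" "H \<inter> a \<subset> Q" "Q \<subseteq> a" for Q
    proof -
      obtain y where y: "y \<in> Q" "y \<notin> H" using Q(2,3) by blast
      then obtain h r where "h \<in> H \<inter> a" "r \<in> carrier R" "v = h \<oplus>\<^bsub>R\<^esub> r \<otimes>\<^bsub>R\<^esub> y" using reach Q(3) by blast
      then have vQ: "v \<in> Q"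
        using Q(2) y(1) submodule_add_mem[OF Q(1)] submodule_smult_mem[OF Q(1)] by auto
      have "z \<in> Q" if z: "z \<in> a" for z
      proof (cases "z \<in> H")
        case False
        then obtain h r where hr: "h \<in> H" "h \<in> a" "r \<in> carrier R" "v = h \<oplus>\<^bsub>R\<^esub> r \<otimes>\<^bsub>R\<^esub> z" using reach z by blast
        note zc = ac[OF z]
        have "r \<notin> m"
        proof
          assume "r \<in> m"
          then have "r \<otimes>\<^bsub>R\<^esub> z \<in> H" using maH z by blast
          then show False using hr H(3) submodule_add_mem[OF H(1)] by auto
        qed
        let ?C = "(\<lambda>s. s \<otimes>\<^bsub>R\<^esub> r) ` carrier R"
        have C: "submodule ?C R ?R" using M.submodule_cyclic[of r] hr(3) by simp
        have "m \<subset> m <+>\<^bsub>?R\<^esub> ?C"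
          using M.set_add_upper1[OF m(1) C] M.set_add_upper2[OF m(1) C] M.cyclic_self[of r] hr(3) \<open>r \<notin> m\<close> by auto
        then have "\<one>\<^bsub>R\<^esub> \<in> m <+>\<^bsub>?R\<^esub> ?C" using m(3) M.submodule_set_add[OF m(1) C] by blast
        then obtain u s where us: "u \<in> m" "s \<in> carrier R" "\<one>\<^bsub>R\<^esub> = u \<oplus>\<^bsub>R\<^esub> s \<otimes>\<^bsub>R\<^esub> r" unfolding set_add_iff by auto
        have "z = (u \<oplus>\<^bsub>R\<^esub> s \<otimes>\<^bsub>R\<^esub> r) \<otimes>\<^bsub>R\<^esub> z" using zc by (simp add: us(3)[symmetric])
        also have "\<dots> = u \<otimes>\<^bsub>R\<^esub> z \<oplus>\<^bsub>R\<^esub> s \<otimes>\<^bsub>R\<^esub> (r \<otimes>\<^bsub>R\<^esub> z)"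
          using us mc hr(3) zc by (simp add: R.l_distr R.m_assoc)
        finally have eq: "z = u \<otimes>\<^bsub>R\<^esub> z \<oplus>\<^bsub>R\<^esub> s \<otimes>\<^bsub>R\<^esub> (r \<otimes>\<^bsub>R\<^esub> z)" .
        have "r \<otimes>\<^bsub>R\<^esub> z = v \<ominus>\<^bsub>R\<^esub> h"
          using hr ac[OF hr(2)] zc by (simp add: a_minus_def R.a_ac R.r_neg1 R.r_neg2)
        moreover have "h \<in> Q" using hr Q(2) by blast
        ultimately have "r \<otimes>\<^bsub>R\<^esub> z \<in> Q" using vQ submodule_minus_mem[OF Q(1)] by (simp add: minus)
        then have "s \<otimes>\<^bsub>R\<^esub> (r \<otimes>\<^bsub>R\<^esub> z) \<in> Q" using submodule_smult_mem[OF Q(1) us(2)] by simp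
        moreover have "u \<otimes>\<^bsub>R\<^esub> z \<in> Q"
          using maH[OF us(1) z] submodule_smult_mem[OF a(1) mc[OF us(1)] z] Q(2) by auto
        ultimately have "u \<otimes>\<^bsub>R\<^esub> z \<oplus>\<^bsub>R\<^esub> s \<otimes>\<^bsub>R\<^esub> (r \<otimes>\<^bsub>R\<^esub> z) \<in> Q" using submodule_add_mem[OF Q(1)] by simp
        then show ?thesis using eq by simp
      qed (use Q(2) z in blast)
      then show ?thesis using Q(3) by blast
    qed
    \<comment> \<open>The interval has only two levels, so the rank that is \<open>1\<close> at
      \<open>a\<close> and \<open>0\<close> elsewhere is strict on it. Then
      \<open>R/(H \<inter> a)\<close> has finite length, against the choice of
      \<open>a\<close>.\<close>
    have "Q \<noteq> a \<and> Q' = a" if "submodule Q' R ?R" "H \<inter> a \<subseteq> Q" "Q \<subset> Q'" "Q' \<subseteq> a" for Q Q'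
      using top[of Q'] that by (metis order_less_le_trans psubset_eq subset_psubset_trans)
    then have "(if Q = a then 1 else 0 :: nat) < (if Q' = a then 1 else 0)"
      if "submodule Q' R ?R" "H \<inter> a \<subseteq> Q" "Q \<subset> Q'" "Q' \<subseteq> a" for Q Q'
      using that by simp
    then have "fin_length_between R ?R (H \<inter> a) a"
      unfolding fin_length_between_def by (intro exI[of _ "\<lambda>Q. if Q = a then 1 else 0"]) blast
    then have "fin_length_between R ?R (H \<inter> a) (carrier R)"
      by (rule M.fin_length_between_trans[OF a(1) Int_lower2 submodule_subset[OF a(1)] M.submodule_carrier,
            simplified, OF _ a(2)])
    then have "H \<inter> a = a" using a_min b by blast
    then show False using v(1) H(3) by blast
  qed
  have "a = {\<zero>\<^bsub>R\<^esub>}"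
  proof (rule ccontr)
    assume "a \<noteq> {\<zero>\<^bsub>R\<^esub>}"
    then obtain v where v: "v \<in> a" "v \<noteq> \<zero>\<^bsub>R\<^esub>" using submodule_zero_mem[OF a(1)] by auto
    let ?Q = "\<lambda>c. \<exists>x\<in>c. \<exists>y\<in>a. x \<otimes>\<^bsub>R\<^esub> y \<noteq> \<zero>\<^bsub>R\<^esub>"
    have "?Q (carrier R)" using v ac by (intro bexI[of _ "\<one>\<^bsub>R\<^esub>"] bexI[of _ v]) auto
    then have "\<exists>c. submodule c R ?R \<and> ?Q c \<and> (\<forall>K. submodule K R ?R \<and> ?Q K \<and> K \<subseteq> c \<longrightarrow> K = c)"
      using M.submodule_carrier by (intro artinian_minimal[OF art]) auto
    then obtain c where "submodule c R ?R \<and> ?Q c \<and> (\<forall>K. submodule K R ?R \<and> ?Q K \<and> K \<subseteq> c \<longrightarrow> K = c)"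
      by (rule exE)
    then have c: "submodule c R ?R" "?Q c" "\<And>K. submodule K R ?R \<Longrightarrow> ?Q K \<Longrightarrow> K \<subseteq> c \<Longrightarrow> K = c"
      by simp_all
    obtain x y where xy: "x \<in> c" "y \<in> a" "x \<otimes>\<^bsub>R\<^esub> y \<noteq> \<zero>\<^bsub>R\<^esub>" using c(2) by blast
    have x: "x \<in> carrier R" using xy(1) submodule_subset[OF c(1)] by auto
    have hom: "module_hom R ?R ?R (\<lambda>r. r \<otimes>\<^bsub>R\<^esub> x)"
      using x by (intro module_homI M.left_module_axioms mod_homI) (auto simp: R.l_distr R.m_assoc)
    let ?ann = "{r \<in> carrier R. r \<otimes>\<^bsub>R\<^esub> x = \<zero>\<^bsub>R\<^esub>}"
    have ann: "submodule {r \<in> carrier R. r \<otimes>\<^bsub>R\<^esub> x = \<zero>\<^bsub>R\<^esub>} R ?R"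
      using module_hom.kernel_submodule[OF hom] by simp
    have not: "\<one>\<^bsub>R\<^esub> \<notin> {r \<in> carrier R. r \<otimes>\<^bsub>R\<^esub> x = \<zero>\<^bsub>R\<^esub>}" using x xy ac by auto
    obtain m where "submodule m R ?R \<and> ?ann \<subseteq> m \<and> \<one>\<^bsub>R\<^esub> \<notin> m \<and> (\<forall>K. submodule K R ?R \<and> m \<subset> K \<longrightarrow> \<one>\<^bsub>R\<^esub> \<in> K)"
      using M.exists_maximal_avoiding[OF ann not] by (rule exE)
    then have m: "submodule m R ?R" "?ann \<subseteq> m" "\<one>\<^bsub>R\<^esub> \<notin> m"
      "\<forall>K. submodule K R ?R \<and> m \<subset> K \<longrightarrow> \<one>\<^bsub>R\<^esub> \<in> K" by simp_all
    note mc = submodule_subset[OF m(1), simplified, THEN subsetD]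
    let ?mx = "(\<lambda>r. r \<otimes>\<^bsub>R\<^esub> x) ` m"
    have mx: "submodule ?mx R ?R" by (rule module_hom.image_submodule[OF hom m(1)])
    \<comment> \<open>Otherwise \<open>m a\<close> annihilates \<open>x\<close>; as
      \<open>a \<subseteq> m a\<close>, so does \<open>a\<close>, against
      \<open>x y \<noteq> 0\<close>.\<close>
    have "?Q ?mx"
    proof (rule ccontr)
      assume no: "\<not> ?Q ?mx"
      have "u \<otimes>\<^bsub>R\<^esub> z \<in> {r \<in> carrier R. r \<otimes>\<^bsub>R\<^esub> x = \<zero>\<^bsub>R\<^esub>}" if uz: "u \<in> m" "z \<in> a" for u z
      proof -
        have "u \<otimes>\<^bsub>R\<^esub> z \<otimes>\<^bsub>R\<^esub> x = u \<otimes>\<^bsub>R\<^esub> x \<otimes>\<^bsub>R\<^esub> z" using mc ac uz x by (simp add: R.m_ac)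
        also have "\<dots> = \<zero>\<^bsub>R\<^esub>" using no uz by blast
        finally show ?thesis using mc ac uz by simp
      qed
      then have "submodule_gen R ?R {u \<otimes>\<^bsub>R\<^esub> z | u z. u \<in> m \<and> z \<in> a} \<subseteq> {r \<in> carrier R. r \<otimes>\<^bsub>R\<^esub> x = \<zero>\<^bsub>R\<^esub>}"
        by (intro M.submodule_gen_least[OF ann]) blast
      then have "y \<otimes>\<^bsub>R\<^esub> x = \<zero>\<^bsub>R\<^esub>" using a_sub[OF m(1,3,4)] xy(2) by blast
      then show False using xy x ac R.m_comm by metis
    qed
    moreover have "?mx \<subseteq> c" using mc xy(1) submodule_smult_mem[OF c(1)] by auto
    ultimately have "?mx = c" using c(3) mx by blast
    then obtain u where u: "u \<in> m" "x = u \<otimes>\<^bsub>R\<^esub> x" using xy(1) by blast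
    have "(\<one>\<^bsub>R\<^esub> \<ominus>\<^bsub>R\<^esub> u) \<otimes>\<^bsub>R\<^esub> x = x \<ominus>\<^bsub>R\<^esub> u \<otimes>\<^bsub>R\<^esub> x"
      using x mc[OF u(1)] by (simp add: a_minus_def R.l_distr R.l_minus)
    then have "(\<one>\<^bsub>R\<^esub> \<ominus>\<^bsub>R\<^esub> u) \<otimes>\<^bsub>R\<^esub> x = \<zero>\<^bsub>R\<^esub>" using u(2) x by (simp add: a_minus_def R.r_neg)
    then have "\<one>\<^bsub>R\<^esub> \<ominus>\<^bsub>R\<^esub> u \<in> m" using m(2) mc[OF u(1)] by auto
    then have "(\<one>\<^bsub>R\<^esub> \<ominus>\<^bsub>R\<^esub> u) \<oplus>\<^bsub>R\<^esub> u \<in> m" using submodule_add_mem[OF m(1)] u(1) by simp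
    then show False using m(3) mc[OF u(1)] by (simp add: a_minus_def R.a_assoc R.l_neg)
  qed
  then show ?thesis using a(2) M.fin_length_iff_between by simp
qed

section \<open>Finitely generated modules over an artin algebra\<close>

text \<open>The base ring acts through \<open>r 1\<close>. The sets of values of homomorphisms that
  occur below are stable under this action but need not be stable under \<open>A\<close>.\<close>

definition restrict_scalars ::
    "('r, 'a, 'd) module_scheme \<Rightarrow> ('a, 'm, 'e) module_scheme \<Rightarrow> ('r, 'm) module" where
  "restrict_scalars A X = \<lparr>carrier = carrier X, mult = mult X, one = one X, zero = zero X, add = add X,
     smult = (\<lambda>r x. (r \<odot>\<^bsub>A\<^esub> \<one>\<^bsub>A\<^esub>) \<odot>\<^bsub>X\<^esub> x)\<rparr>"

lemma restrict_scalars_simps [simp]: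
  "carrier (restrict_scalars A X) = carrier X" "\<zero>\<^bsub>restrict_scalars A X\<^esub> = \<zero>\<^bsub>X\<^esub>"
  "add (restrict_scalars A X) = add X" "r \<odot>\<^bsub>restrict_scalars A X\<^esub> x = (r \<odot>\<^bsub>A\<^esub> \<one>\<^bsub>A\<^esub>) \<odot>\<^bsub>X\<^esub> x"
  by (simp_all add: restrict_scalars_def)

lemma injective_fgD:
  fixes X Y :: "'a fgmod"
  assumes "injective_fg A I" "fg_module A X" "fg_module A Y" "f \<in> mod_hom A X Y"
    and "inj_on f (carrier X)" "g \<in> mod_hom A X I"
  shows "\<exists>h\<in>mod_hom A Y I. \<forall>x\<in>carrier X. h (f x) = g x"
  using assms unfolding injective_fg_def by simp

lemma projective_fgD:
  fixes X Y :: "'a fgmod"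
  assumes "projective_fg A P" "fg_module A X" "fg_module A Y" "f \<in> mod_hom A X Y"
    and "f ` carrier X = carrier Y" "g \<in> mod_hom A P Y"
  shows "\<exists>h\<in>mod_hom A P X. \<forall>x\<in>carrier P. f (h x) = g x"
  using assms unfolding projective_fg_def by simp

lemma a_kernel_eq: "a_kernel X Y f = {x \<in> carrier X. f x = \<zero>\<^bsub>Y\<^esub>}"
  by (simp add: a_kernel_def kernel_def)

section \<open>Iterates of an endomorphism and Fitting's lemma\<close>

lemma mod_hom_funpow:
  assumes "c \<in> mod_hom A X X"
  shows "c ^^ n \<in> mod_hom A X X"
proof (induction n)
  case 0
  then show ?case by (simp add: mod_hom_def)
next
  case (Suc n)
  then show ?case using mod_hom_comp[OF Suc assms] by (simp add: comp_def)
qed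

context left_module
begin

lemma endo_funpow_closed: "c \<in> mod_hom R M M \<Longrightarrow> x \<in> carrier M \<Longrightarrow> (c ^^ n) x \<in> carrier M"
  using mod_hom_closed[OF mod_hom_funpow] .

lemma endo_module_hom: "c \<in> mod_hom R M M \<Longrightarrow> module_hom R M M (c ^^ n)"
  by (intro module_homI left_module_axioms mod_hom_funpow)

text \<open>Only positive exponents compete for the minimal image, so the stable image lies in the
  image of \<open>c\<close> itself; \<open>uniserial_endo\<close> relies on this.\<close>

lemma endo_image_stable:
  assumes fl: "fin_length R M" and c: "c \<in> mod_hom R M M"
  shows "\<exists>n. \<forall>k. (c ^^ (Suc n + k)) ` carrier M = (c ^^ Suc n) ` carrier M"
proof -
  let ?Q = "\<lambda>H. \<exists>n. H = (c ^^ Suc n) ` carrier M"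
  have sm: "submodule ((c ^^ n) ` carrier M) R M" for n
    by (rule module_hom.image_submodule[OF endo_module_hom[OF c] submodule_carrier])
  have "\<exists>H. submodule H R M \<and> ?Q H \<and> (\<forall>K. submodule K R M \<and> ?Q K \<and> K \<subseteq> H \<longrightarrow> K = H)"
    by (rule fin_length_minimal[OF fl sm[of "Suc 0"]]) blast
  then obtain H where "submodule H R M \<and> ?Q H \<and> (\<forall>K. submodule K R M \<and> ?Q K \<and> K \<subseteq> H \<longrightarrow> K = H)"
    by (rule exE)
  then have H: "?Q H" "\<And>K. submodule K R M \<Longrightarrow> ?Q K \<Longrightarrow> K \<subseteq> H \<Longrightarrow> K = H" by simp_all
  obtain n where n: "H = (c ^^ Suc n) ` carrier M" using H(1) by (rule exE)
  have "(c ^^ (Suc n + k)) ` carrier M = H" for k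
  proof (rule H(2)[OF sm])
    show "\<exists>na. (c ^^ (Suc n + k)) ` carrier M = (c ^^ Suc na) ` carrier M"
      by (rule exI[of _ "n + k"]) simp
    have "(c ^^ (Suc n + k)) x = (c ^^ Suc n) ((c ^^ k) x)" for x by (simp only: funpow_add comp_apply)
    then show "(c ^^ (Suc n + k)) ` carrier M \<subseteq> H" unfolding n
      using endo_funpow_closed[OF c] by auto
  qed
  then show ?thesis unfolding n by blast
qed

text \<open>Injective powers can be cancelled from a stable image: \<open>c^m x = c^m (c y)\<close>
  gives \<open>x = c y\<close>.\<close>

lemma endo_inj_imp_surj:
  assumes fl: "fin_length R M" and c: "c \<in> mod_hom R M M" and inj: "inj_on c (carrier M)"
  shows "c ` carrier M = carrier M"
proof -
  obtain n where n: "(c ^^ (Suc n + 1)) ` carrier M = (c ^^ Suc n) ` carrier M"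
    using endo_image_stable[OF fl c] by blast
  have "inj_on (c ^^ m) (carrier M)" for m
  proof (induction m)
    case (Suc m)
    then show ?case using inj endo_funpow_closed[OF c]
      by (auto simp: inj_on_def)
  qed simp
  note inj_n = this[of "Suc n"]
  have "x \<in> c ` carrier M" if x: "x \<in> carrier M" for x
  proof -
    have "(c ^^ Suc n) x \<in> (c ^^ (Suc n + 1)) ` carrier M" using n x by blast
    then obtain y where y: "y \<in> carrier M" "(c ^^ Suc n) x = (c ^^ (Suc n + 1)) y" by blast
    have "(c ^^ (Suc n + 1)) y = (c ^^ Suc n) (c y)" by (simp add: funpow_swap1)
    then have "x = c y" using inj_onD[OF inj_n, of x "c y"] y x mod_hom_closed[OF c] by simp
    then show ?thesis using y by blast
  qed
  then show ?thesis using mod_hom_closed[OF c] by blast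
qed

text \<open>Dually, the kernels of the powers become stable. If \<open>c x = 0\<close>, write
  \<open>x = c^n y\<close>; then \<open>y\<close> lies in the kernel of \<open>c^(n+1)\<close>,
  which is that of \<open>c^n\<close>, and \<open>x = 0\<close>.\<close>

lemma endo_surj_imp_inj:
  assumes fl: "fin_length R M" and c: "c \<in> mod_hom R M M" and surj: "c ` carrier M = carrier M"
  shows "inj_on c (carrier M)"
proof -
  let ?K = "\<lambda>n. {x \<in> carrier M. (c ^^ n) x = \<zero>\<^bsub>M\<^esub>}"
  let ?Q = "\<lambda>H. \<exists>n. H = ?K n"
  have sm: "submodule (?K n) R M" for n
    by (rule module_hom.kernel_submodule[OF endo_module_hom[OF c]])
  have "\<exists>H. submodule H R M \<and> ?Q H \<and> (\<forall>K. submodule K R M \<and> ?Q K \<and> H \<subseteq> K \<longrightarrow> K = H)"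
    by (rule fin_length_maximal[OF fl sm[of 0]]) blast
  then obtain H where "submodule H R M \<and> ?Q H \<and> (\<forall>K. submodule K R M \<and> ?Q K \<and> H \<subseteq> K \<longrightarrow> K = H)"
    by (rule exE)
  then obtain n where n: "\<And>K. submodule K R M \<Longrightarrow> ?Q K \<Longrightarrow> ?K n \<subseteq> K \<Longrightarrow> K = ?K n" by auto
  interpret c: module_hom R M M c by (intro module_homI left_module_axioms c)
  have eq: "?K (Suc n) = ?K n"
  proof (rule n[OF sm])
    show "\<exists>na. ?K (Suc n) = ?K na" by (rule exI[of _ "Suc n"]) (rule refl)
  qed (auto simp: c.zero)
  have "(c ^^ m) ` carrier M = carrier M" for m
  proof (induction m)
    case (Suc m)
    then show ?case using surj by (metis funpow.simps(2) image_comp)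
  qed simp
  note surj_n = this[of n]
  have "x = \<zero>\<^bsub>M\<^esub>" if x: "x \<in> carrier M" "c x = \<zero>\<^bsub>M\<^esub>" for x
  proof -
    obtain y where y: "y \<in> carrier M" "x = (c ^^ n) y" using surj_n x(1) by blast
    then have "y \<in> ?K (Suc n)" using x by simp
    then have "y \<in> ?K n" by (simp only: eq)
    then show ?thesis using y by simp
  qed
  then show ?thesis using c.inj_on_iff by blast
qed

text \<open>Fitting's argument writes \<open>M\<close> as the sum of the kernel and the image of a
  high power. By comparability one of the two contains the other, so it is all of
  \<open>M\<close>.\<close>

lemma uniserial_endo:
  assumes fl: "fin_length R M" and us: "uniserial R M" and c: "c \<in> mod_hom R M M"
  shows "c ` carrier M = carrier M \<or> (\<exists>n. \<forall>x\<in>carrier M. (c ^^ n) x = \<zero>\<^bsub>M\<^esub>)"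
proof -
  obtain n where "(c ^^ (Suc n + Suc n)) ` carrier M = (c ^^ Suc n) ` carrier M"
    using endo_image_stable[OF fl c] by blast
  then obtain m where m: "m = Suc n" "(c ^^ (m + m)) ` carrier M = (c ^^ m) ` carrier M" by blast
  interpret h: module_hom R M M "c ^^ m" by (rule endo_module_hom[OF c])
  let ?K = "{x \<in> carrier M. (c ^^ m) x = \<zero>\<^bsub>M\<^esub>}" and ?I = "(c ^^ m) ` carrier M"
  have K: "submodule ?K R M" and I: "submodule ?I R M"
    using h.kernel_submodule h.image_submodule[OF submodule_carrier] .
  have split: "\<exists>y\<in>carrier M. x \<ominus>\<^bsub>M\<^esub> (c ^^ m) y \<in> ?K" if x: "x \<in> carrier M" for x
  proof -
    have "(c ^^ m) x \<in> (c ^^ (m + m)) ` carrier M" using m(2) x by blast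
    then obtain y where y: "y \<in> carrier M" "(c ^^ m) x = (c ^^ m) ((c ^^ m) y)"
      by (auto simp: funpow_add)
    then have "x \<ominus>\<^bsub>M\<^esub> (c ^^ m) y \<in> ?K"
      using x h.closed by (simp add: h.minus minus_eq_zero_iff)
    then show ?thesis using y by blast
  qed
  have "?K \<subseteq> ?I \<or> ?I \<subseteq> ?K" using us K I unfolding uniserial_def by blast
  then show ?thesis
  proof
    assume KI: "?K \<subseteq> ?I"
    have "x \<in> c ` carrier M" if x: "x \<in> carrier M" for x
    proof -
      obtain y where y: "y \<in> carrier M" "x \<ominus>\<^bsub>M\<^esub> (c ^^ m) y \<in> ?I" using split[OF x] KI by blast
      then have "(x \<ominus>\<^bsub>M\<^esub> (c ^^ m) y) \<oplus>\<^bsub>M\<^esub> (c ^^ m) y \<in> ?I" using submodule_add_mem[OF I] by blast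
      then have "x \<in> ?I" using minus_add_cancel[of x "(c ^^ m) y"] x y h.closed by simp
      then obtain z where "z \<in> carrier M" "x = c ((c ^^ n) z)" using m(1) by auto
      then show ?thesis using endo_funpow_closed[OF c] by blast
    qed
    then show ?thesis using mod_hom_closed[OF c] by blast
  next
    assume IK: "?I \<subseteq> ?K"
    have "(c ^^ m) x = \<zero>\<^bsub>M\<^esub>" if x: "x \<in> carrier M" for x
    proof -
      obtain y where y: "y \<in> carrier M" "x \<ominus>\<^bsub>M\<^esub> (c ^^ m) y \<in> ?K" using split[OF x] by blast
      then have "(x \<ominus>\<^bsub>M\<^esub> (c ^^ m) y) \<oplus>\<^bsub>M\<^esub> (c ^^ m) y \<in> ?K" using submodule_add_mem[OF K] IK by blast
      then show ?thesis using minus_add_cancel[of x "(c ^^ m) y"] x y h.closed by simp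
    qed
    then show ?thesis by blast
  qed
qed

end

section \<open>Passage to the base ring and closure properties of finitely generated modules\<close>

context artin_algebra
begin

lemma scalar_closed: "r \<in> carrier R \<Longrightarrow> r \<odot>\<^bsub>A\<^esub> \<one>\<^bsub>A\<^esub> \<in> carrier A"
  by (simp add: R.smult_closed)

lemma scalar_mult_left:
  "r \<in> carrier R \<Longrightarrow> a \<in> carrier A \<Longrightarrow> (r \<odot>\<^bsub>A\<^esub> \<one>\<^bsub>A\<^esub>) \<otimes>\<^bsub>A\<^esub> a = r \<odot>\<^bsub>A\<^esub> a"
  by (simp add: smult_mult_left)

lemma scalar_mult_right:
  "r \<in> carrier R \<Longrightarrow> a \<in> carrier A \<Longrightarrow> a \<otimes>\<^bsub>A\<^esub> (r \<odot>\<^bsub>A\<^esub> \<one>\<^bsub>A\<^esub>) = r \<odot>\<^bsub>A\<^esub> a"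
  by (simp add: smult_mult_right)

lemma scalar_central:
  "r \<in> carrier R \<Longrightarrow> a \<in> carrier A \<Longrightarrow> (r \<odot>\<^bsub>A\<^esub> \<one>\<^bsub>A\<^esub>) \<otimes>\<^bsub>A\<^esub> a = a \<otimes>\<^bsub>A\<^esub> (r \<odot>\<^bsub>A\<^esub> \<one>\<^bsub>A\<^esub>)"
  by (simp add: scalar_mult_left scalar_mult_right)

lemma left_module_base: "left_module R A"
  by (intro left_module.intro left_module_axioms.intro R.R.ring_axioms R.M.abelian_group_axioms)
    (auto simp: R.smult_closed R.smult_l_distr R.smult_r_distr R.smult_assoc1)

lemma left_module_restrict_scalars:
  assumes "left_module A X"
  shows "left_module R (restrict_scalars A X)"
proof -
  interpret X: left_module A X by fact
  have "abelian_group (restrict_scalars A X)"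
  proof (rule abelian_groupI)
    show "\<exists>y\<in>carrier (restrict_scalars A X). y \<oplus>\<^bsub>restrict_scalars A X\<^esub> x = \<zero>\<^bsub>restrict_scalars A X\<^esub>"
      if "x \<in> carrier (restrict_scalars A X)" for x
      using that by (intro bexI[of _ "\<ominus>\<^bsub>X\<^esub> x"]) (auto simp: X.M.l_neg)
  qed (auto simp: X.M.a_ac)
  moreover have "((r \<otimes>\<^bsub>R\<^esub> s) \<odot>\<^bsub>A\<^esub> \<one>\<^bsub>A\<^esub>) = (r \<odot>\<^bsub>A\<^esub> \<one>\<^bsub>A\<^esub>) \<otimes>\<^bsub>A\<^esub> (s \<odot>\<^bsub>A\<^esub> \<one>\<^bsub>A\<^esub>)"
    if "r \<in> carrier R" "s \<in> carrier R" for r s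
    using that by (simp add: scalar_mult_left scalar_closed R.smult_assoc1)
  ultimately show ?thesis
    by (intro left_module.intro left_module_axioms.intro R.R.ring_axioms)
      (auto simp: scalar_closed X.smult_closed R.smult_l_distr X.smult_l_distr X.smult_r_distr
        X.smult_assoc1 X.smult_one)
qed

lemma submodule_restrict_scalars:
  assumes "left_module A X" "submodule H A X"
  shows "submodule H R (restrict_scalars A X)"
  using submoduleD[OF assms(2)]
  by (intro left_module.submoduleI[OF left_module_restrict_scalars[OF assms(1)]]) (auto simp: scalar_closed)

lemma mod_hom_restrict_scalars:
  assumes "f \<in> mod_hom A X Y"
  shows "f \<in> mod_hom R (restrict_scalars A X) (restrict_scalars A Y)"
  using mod_homD[OF assms] by (intro mod_homI) (auto simp: scalar_closed)

text \<open>Products of \<open>R\<close>-generators of \<open>A\<close> with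
  \<open>A\<close>-generators of \<open>X\<close> suffice. For a generator \<open>x\<close> the
  \<open>a\<close> with \<open>a x \<in> H\<close> form an \<open>R\<close>-submodule containing
  \<open>T\<close>; the \<open>x\<close> with \<open>A x \<subseteq> H\<close> then form an
  \<open>A\<close>-submodule containing \<open>S\<close>.\<close>

lemma fin_gen_restrict_scalars:
  assumes "fg_module A X"
  shows "fin_gen R (restrict_scalars A X)"
proof -
  interpret X: left_module A X using assms by (simp add: fg_module_def)
  interpret XR: left_module R "restrict_scalars A X" by (rule left_module_restrict_scalars[OF X.left_module_axioms])
  interpret B: left_module R A by (rule left_module_base)
  obtain S where S: "finite S" "S \<subseteq> carrier X" "submodule_gen A X S = carrier X"
    using assms unfolding fg_module_def fin_gen_def by blast
  obtain T where T: "finite T" "T \<subseteq> carrier A" "submodule_gen R A T = carrier A"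
    using fin_gen unfolding fin_gen_def by blast
  let ?U = "(\<lambda>(a, x). a \<odot>\<^bsub>X\<^esub> x) ` (T \<times> S)"
  have U: "?U \<subseteq> carrier X" using S(2) T(2) by (auto intro: X.smult_closed)
  have "carrier X \<subseteq> H" if H: "submodule H R (restrict_scalars A X)" "?U \<subseteq> H" for H
  proof -
    have Hs: "(r \<odot>\<^bsub>A\<^esub> \<one>\<^bsub>A\<^esub>) \<odot>\<^bsub>X\<^esub> x \<in> H" if "r \<in> carrier R" "x \<in> H" for r x
      using submodule_smult_mem[OF H(1) that] by simp
    note Hadd = submodule_add_mem[OF H(1), simplified] and Hzero = submodule_zero_mem[OF H(1), simplified]
    have Sx: "a \<odot>\<^bsub>X\<^esub> x \<in> H" if x: "x \<in> S" and a: "a \<in> carrier A" for a x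
    proof -
      have xc: "x \<in> carrier X" using x S(2) by blast
      let ?V = "{a \<in> carrier A. a \<odot>\<^bsub>X\<^esub> x \<in> H}"
      have "submodule ?V R A"
      proof (rule B.submoduleI)
        show "r \<odot>\<^bsub>A\<^esub> b \<in> ?V" if r: "r \<in> carrier R" and b: "b \<in> ?V" for r b
        proof -
          have "(r \<odot>\<^bsub>A\<^esub> b) \<odot>\<^bsub>X\<^esub> x = (r \<odot>\<^bsub>A\<^esub> \<one>\<^bsub>A\<^esub>) \<odot>\<^bsub>X\<^esub> (b \<odot>\<^bsub>X\<^esub> x)"
            using r b xc scalar_closed[OF r] by (simp add: X.smult_assoc1[symmetric] scalar_mult_left)
          then show ?thesis using Hs r b by (simp add: R.smult_closed)
        qed
      qed (auto simp: X.smult_zero_left xc X.smult_l_distr Hadd Hzero)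
      moreover have "T \<subseteq> ?V" using T(2) x H(2) by auto
      ultimately have "submodule_gen R A T \<subseteq> ?V" by (rule B.submodule_gen_least)
      then show ?thesis using a T(3) by blast
    qed
    let ?V = "{x \<in> carrier X. \<forall>a\<in>carrier A. a \<odot>\<^bsub>X\<^esub> x \<in> H}"
    have "submodule ?V A X"
      by (rule X.submoduleI)
        (auto simp: X.smult_zero_right X.smult_closed X.smult_r_distr X.smult_assoc1[symmetric] Hadd Hzero)
    moreover have "S \<subseteq> ?V" using Sx S(2) by blast
    ultimately have "submodule_gen A X S \<subseteq> ?V" by (rule X.submodule_gen_least)
    then have V: "carrier X \<subseteq> ?V" using S(3) by simp
    show ?thesis
    proof
      fix x assume x: "x \<in> carrier X"
      then have "\<one>\<^bsub>A\<^esub> \<odot>\<^bsub>X\<^esub> x \<in> H" using V A.one_closed by blast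
      then show "x \<in> H" using X.smult_one[OF x] by simp
    qed
  qed
  then have "carrier X \<subseteq> submodule_gen R (restrict_scalars A X) ?U"
    unfolding submodule_gen_def by blast
  moreover have "submodule_gen R (restrict_scalars A X) ?U \<subseteq> carrier X"
    using XR.submodule_gen_least[OF XR.submodule_carrier, of ?U] U by simp
  ultimately show ?thesis
    unfolding fin_gen_def using S(1) T(1) U by (intro exI[of _ ?U]) auto
qed

lemma fin_length_restrict_scalars:
  assumes "fg_module A X"
  shows "fin_length R (restrict_scalars A X)"
proof -
  have "left_module R (restrict_scalars A X)"
    using assms by (simp add: fg_module_def left_module_restrict_scalars)
  then show ?thesis
    using left_module.fin_length_of_fin_gen artinian_fin_length[OF artinian] fin_gen_restrict_scalars[OF assms]
    by blast
qed

text \<open>Submodules over \<open>A\<close> are submodules over \<open>R\<close>, so a rank over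
  \<open>R\<close> serves over \<open>A\<close>.\<close>

lemma fg_fin_length:
  assumes "fg_module A X"
  shows "fin_length A X"
proof -
  have X: "left_module A X" using assms by (simp add: fg_module_def)
  obtain l :: "_ \<Rightarrow> nat" where "\<And>H K. submodule H R (restrict_scalars A X) \<Longrightarrow>
      submodule K R (restrict_scalars A X) \<Longrightarrow> H \<subset> K \<Longrightarrow> l H < l K"
    using fin_length_restrict_scalars[OF assms] unfolding fin_length_def by metis
  then show ?thesis
    unfolding fin_length_def using submodule_restrict_scalars[OF X] by (intro exI[of _ l]) simp
qed

lemma fg_moduleI: "left_module A X \<Longrightarrow> fin_length A X \<Longrightarrow> fg_module A X"
  by (simp add: fg_module_def left_module.fin_gen_of_fin_length)

lemma fg_left_module: "fg_module A X \<Longrightarrow> left_module A X"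
  by (simp add: fg_module_def)

lemma fg_regular: "fg_module A (regular_module A)"
proof -
  interpret X: left_module A "regular_module A" by (rule A.left_module_regular)
  have "submodule_gen A (regular_module A) {\<one>\<^bsub>A\<^esub>} = carrier A"
  proof
    show "submodule_gen A (regular_module A) {\<one>\<^bsub>A\<^esub>} \<subseteq> carrier A"
      using X.submodule_gen_least[OF X.submodule_carrier] by simp
    have "submodule (submodule_gen A (regular_module A) {\<one>\<^bsub>A\<^esub>}) A (regular_module A)"
      by (rule X.submodule_gen_submodule) simp
    then show "carrier A \<subseteq> submodule_gen A (regular_module A) {\<one>\<^bsub>A\<^esub>}"
      using submodule_smult_mem[of _ A "regular_module A" _ "\<one>\<^bsub>A\<^esub>"] X.submodule_gen_upper[of "{\<one>\<^bsub>A\<^esub>}"] by fastforce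
  qed
  then show ?thesis
    unfolding fg_module_def fin_gen_def using X.left_module_axioms by (intro conjI exI[of _ "{\<one>\<^bsub>A\<^esub>}"]) auto
qed

lemma fg_sub:
  assumes "fg_module A X" "submodule H A X"
  shows "fg_module A (X\<lparr>carrier := H\<rparr>)"
  by (rule fg_moduleI)
    (use assms fg_left_module[OF assms(1)] fg_fin_length left_module.left_module_sub left_module.fin_length_sub in blast)+

lemma fg_image:
  assumes "fg_module A X" "left_module A Y" "f \<in> mod_hom A X Y" "f ` carrier X = carrier Y"
  shows "fg_module A Y"
  by (rule fg_moduleI[OF assms(2)], rule module_hom.fin_length_image[of _ X])
    (use assms fg_left_module[OF assms(1)] fg_fin_length module_homI in blast)+

lemma fg_quot:
  assumes "fg_module A X" "submodule N A X"
  shows "fg_module A (quot_mod X N)"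
proof -
  interpret X: left_module A X by (rule fg_left_module[OF assms(1)])
  show ?thesis
    by (rule fg_image[OF assms(1) X.left_module_quot_mod[OF assms(2)] X.quot_proj_hom[OF assms(2)]])
      (simp add: X.quot_carrier)
qed

lemma fg_dsum:
  assumes "fg_module A X" "fg_module A Y"
  shows "fg_module A (dsum X Y)"
proof -
  interpret X: left_module A X by (rule fg_left_module[OF assms(1)])
  interpret Y: left_module A Y by (rule fg_left_module[OF assms(2)])
  interpret XY: left_module A "dsum X Y" by (intro left_module_dsum X.left_module_axioms Y.left_module_axioms)
  obtain S where S: "finite S" "S \<subseteq> carrier X" "submodule_gen A X S = carrier X"
    using assms(1) unfolding fg_module_def fin_gen_def by blast
  obtain T where T: "finite T" "T \<subseteq> carrier Y" "submodule_gen A Y T = carrier Y"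
    using assms(2) unfolding fg_module_def fin_gen_def by blast
  interpret i: module_hom A X "dsum X Y" "\<lambda>x. (x, \<zero>\<^bsub>Y\<^esub>)"
    by (intro module_homI X.left_module_axioms XY.left_module_axioms mod_homI) (auto simp: Y.smult_zero_right)
  interpret j: module_hom A Y "dsum X Y" "\<lambda>y. (\<zero>\<^bsub>X\<^esub>, y)"
    by (intro module_homI Y.left_module_axioms XY.left_module_axioms mod_homI) (auto simp: X.smult_zero_right)
  let ?U = "(\<lambda>x. (x, \<zero>\<^bsub>Y\<^esub>)) ` S \<union> (\<lambda>y. (\<zero>\<^bsub>X\<^esub>, y)) ` T"
  have U: "?U \<subseteq> carrier (dsum X Y)" using S(2) T(2) by auto
  let ?H = "submodule_gen A (dsum X Y) ?U"
  have H: "submodule ?H A (dsum X Y)" by (rule XY.submodule_gen_submodule[OF U])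
  have UH: "?U \<subseteq> ?H" by (rule XY.submodule_gen_upper)
  have "submodule_gen A X S \<subseteq> {x \<in> carrier X. (x, \<zero>\<^bsub>Y\<^esub>) \<in> ?H}"
    by (rule X.submodule_gen_least[OF i.vimage_submodule[OF H]]) (use UH S(2) in blast)
  moreover have "submodule_gen A Y T \<subseteq> {y \<in> carrier Y. (\<zero>\<^bsub>X\<^esub>, y) \<in> ?H}"
    by (rule Y.submodule_gen_least[OF j.vimage_submodule[OF H]]) (use UH T(2) in blast)
  ultimately have c: "x \<in> carrier X \<Longrightarrow> (x, \<zero>\<^bsub>Y\<^esub>) \<in> ?H" "y \<in> carrier Y \<Longrightarrow> (\<zero>\<^bsub>X\<^esub>, y) \<in> ?H" for x y
    using S(3) T(3) by blast+
  have "(x, y) \<in> ?H" if "x \<in> carrier X" "y \<in> carrier Y" for x y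
    using submodule_add_mem[OF H c(1)[OF that(1)] c(2)[OF that(2)]] that by simp
  then have "carrier (dsum X Y) \<subseteq> ?H" by auto
  then have "?H = carrier (dsum X Y)" using submodule_subset[OF H] by blast
  then show ?thesis
    unfolding fg_module_def fin_gen_def using XY.left_module_axioms S(1) T(1) U
    by (intro conjI exI[of _ ?U]) auto
qed

text \<open>Injectivity, projectivity and almost splitness are tested only on modules of type
  \<open>'a fgmod\<close>. These mutually inverse isomorphisms carry the tests over to finitely
  generated modules on any carrier type.\<close>

lemma fg_module_transport:
  assumes "fg_module A X"
  shows "\<exists>(Y :: 'a fgmod) f g. fg_module A Y \<and> f \<in> mod_hom A X Y \<and> g \<in> mod_hom A Y X \<and>
    (\<forall>x\<in>carrier X. g (f x) = x) \<and> (\<forall>y\<in>carrier Y. f (g y) = y)"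
proof -
  obtain Y :: "'a fgmod" and f where Y: "fg_module A Y" "f \<in> mod_hom A X Y" "bij_betw f (carrier X) (carrier Y)"
    using fg_module_iso_universe[OF assms] by blast
  obtain g where "g \<in> mod_hom A Y X" "\<forall>x\<in>carrier X. g (f x) = x" "\<forall>y\<in>carrier Y. f (g y) = y"
    using inv_mod_hom[OF fg_left_module[OF assms] fg_left_module[OF Y(1)] Y(2,3)] by metis
  then show ?thesis using Y by blast
qed

lemma injective_extend:
  assumes "injective_fg A I" and Y: "fg_module A Y" and X: "submodule X A Y"
    and g: "g \<in> mod_hom A (Y\<lparr>carrier := X\<rparr>) I"
  shows "\<exists>h\<in>mod_hom A Y I. \<forall>x\<in>X. h x = g x"
proof -
  obtain X' :: "'a fgmod" and p p' where p: "fg_module A X'" "p \<in> mod_hom A (Y\<lparr>carrier := X\<rparr>) X'"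
    "p' \<in> mod_hom A X' (Y\<lparr>carrier := X\<rparr>)"
    "\<forall>x\<in>carrier (Y\<lparr>carrier := X\<rparr>). p' (p x) = x" "\<forall>y\<in>carrier X'. p (p' y) = y"
    using fg_module_transport[OF fg_sub[OF Y X]] by metis
  obtain Y' :: "'a fgmod" and q q' where q: "fg_module A Y'" "q \<in> mod_hom A Y Y'"
    "q' \<in> mod_hom A Y' Y" "\<forall>x\<in>carrier Y. q' (q x) = x" "\<forall>y\<in>carrier Y'. q (q' y) = y"
    using fg_module_transport[OF Y] by metis
  note sub = submodule_subset[OF X]
  have f: "(\<lambda>x. q (p' x)) \<in> mod_hom A X' Y'"
    by (rule mod_hom_comp[OF mod_hom_of_sub_codomain[OF p(3) sub] q(2)])
  have "inj_on (\<lambda>x. q (p' x)) (carrier X')"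
  proof (rule inj_onI)
    fix x y assume xy: "x \<in> carrier X'" "y \<in> carrier X'" "q (p' x) = q (p' y)"
    have "p' x \<in> X" "p' y \<in> X" using mod_hom_closed[OF p(3)] xy by auto
    then have "p' x = p' y" using q(4) xy(3) sub by (metis subsetD)
    then show "x = y" using p(5) xy by metis
  qed
  moreover have "(\<lambda>x. g (p' x)) \<in> mod_hom A X' I" by (rule mod_hom_comp[OF p(3) g])
  ultimately have "\<exists>h\<in>mod_hom A Y' I. \<forall>x\<in>carrier X'. h (q (p' x)) = g (p' x)"
    by (rule injective_fgD[OF assms(1) p(1) q(1) f])
  then obtain h where h: "h \<in> mod_hom A Y' I" "\<forall>x\<in>carrier X'. h (q (p' x)) = g (p' x)"
    by (rule bexE)
  have "h (q x) = g x" if "x \<in> X" for x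
    using h(2) p(4) mod_hom_closed[OF p(2), of x] that by fastforce
  then show ?thesis using mod_hom_comp[OF q(2) h(1)] by (intro bexI[of _ "\<lambda>x. h (q x)"]) auto
qed

lemma projective_lift:
  assumes "projective_fg A P" and X: "fg_module A X" and Y: "fg_module A Y"
    and f: "f \<in> mod_hom A X Y" "f ` carrier X = carrier Y" and g: "g \<in> mod_hom A P Y"
  shows "\<exists>h\<in>mod_hom A P X. \<forall>x\<in>carrier P. f (h x) = g x"
proof -
  obtain X' :: "'a fgmod" and p p' where p: "fg_module A X'" "p \<in> mod_hom A X X'"
    "p' \<in> mod_hom A X' X" "\<forall>x\<in>carrier X. p' (p x) = x" "\<forall>y\<in>carrier X'. p (p' y) = y"
    using fg_module_transport[OF X] by metis
  obtain Y' :: "'a fgmod" and q q' where q: "fg_module A Y'" "q \<in> mod_hom A Y Y'"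
    "q' \<in> mod_hom A Y' Y" "\<forall>x\<in>carrier Y. q' (q x) = x" "\<forall>y\<in>carrier Y'. q (q' y) = y"
    using fg_module_transport[OF Y] by metis
  have f': "(\<lambda>x. q (f (p' x))) \<in> mod_hom A X' Y'"
    by (rule mod_hom_comp[OF mod_hom_comp[OF p(3) f(1)] q(2)])
  have "y \<in> (\<lambda>x. q (f (p' x))) ` carrier X'" if y: "y \<in> carrier Y'" for y
  proof -
    have "q' y \<in> f ` carrier X" using mod_hom_closed[OF q(3) y] f(2) by simp
    then obtain x where x: "x \<in> carrier X" "q' y = f x" by blast
    then have "q (f (p' (p x))) = q (q' y)" using p(4) by simp
    then have "q (f (p' (p x))) = y" using q(5) y by simp
    then show ?thesis using mod_hom_closed[OF p(2) x(1)] by blast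
  qed
  then have "(\<lambda>x. q (f (p' x))) ` carrier X' = carrier Y'" using mod_hom_closed[OF f'] by blast
  moreover have "(\<lambda>x. q (g x)) \<in> mod_hom A P Y'" by (rule mod_hom_comp[OF g q(2)])
  ultimately have "\<exists>h\<in>mod_hom A P X'. \<forall>x\<in>carrier P. q (f (p' (h x))) = q (g x)"
    by (rule projective_fgD[OF assms(1) p(1) q(1) f'])
  then obtain h where h: "h \<in> mod_hom A P X'" "\<forall>x\<in>carrier P. q (f (p' (h x))) = q (g x)"
    by (rule bexE)
  have "f (p' (h x)) = g x" if "x \<in> carrier P" for x
  proof -
    have "f (p' (h x)) \<in> carrier Y" "g x \<in> carrier Y"
      using mod_hom_closed[OF f(1)] mod_hom_closed[OF p(3)] mod_hom_closed[OF h(1)] mod_hom_closed[OF g] that by auto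
    then show ?thesis using h(2) that q(4) by metis
  qed
  then show ?thesis using mod_hom_comp[OF h(1) p(3)] by (intro bexI[of _ "\<lambda>x. p' (h x)"]) auto
qed

lemma left_almost_split_extend:
  assumes las: "left_almost_split A X Y f" and Z: "fg_module A Z" and u: "u \<in> mod_hom A X Z"
    and not_split: "\<not> split_mono A X Z u"
  shows "\<exists>v\<in>mod_hom A Y Z. \<forall>x\<in>carrier X. v (f x) = u x"
proof -
  obtain Z' :: "'a fgmod" and q q' where q: "fg_module A Z'" "q \<in> mod_hom A Z Z'"
    "q' \<in> mod_hom A Z' Z" "\<forall>x\<in>carrier Z. q' (q x) = x" "\<forall>y\<in>carrier Z'. q (q' y) = y"
    using fg_module_transport[OF Z] by metis
  have "\<not> split_mono A X Z' (\<lambda>x. q (u x))"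
  proof
    assume "split_mono A X Z' (\<lambda>x. q (u x))"
    then obtain h where h: "h \<in> mod_hom A Z' X" "\<forall>x\<in>carrier X. h (q (u x)) = x"
      unfolding split_mono_def by (rule bexE)
    then show False
      using not_split mod_hom_comp[OF q(2) h(1)] unfolding split_mono_def by (metis (no_types, lifting))
  qed
  then have "\<exists>v\<in>mod_hom A Y Z'. \<forall>x\<in>carrier X. v (f x) = q (u x)"
    using las q(1) mod_hom_comp[OF u q(2)] unfolding left_almost_split_def by simp
  then obtain v where v: "v \<in> mod_hom A Y Z'" "\<forall>x\<in>carrier X. v (f x) = q (u x)"
    by (rule bexE)
  have "q' (v (f x)) = u x" if "x \<in> carrier X" for x
    using v(2) that q(4) mod_hom_closed[OF u] by simp
  then show ?thesis using mod_hom_comp[OF v(1) q(3)] by (intro bexI[of _ "\<lambda>x. q' (v x)"]) auto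
qed

end

section \<open>Right almost split from left almost split\<close>

text \<open>\<open>v\<close> maps into the kernel of \<open>g\<close>, which is the image of
  \<open>f\<close>, and fixes that image; so \<open>v\<close> followed by the inverse of
  \<open>f\<close> is a retraction. It is applied to \<open>1 - h g\<close> for a section
  \<open>h\<close>, and to an iterate of an endomorphism of \<open>Y\<close>.\<close>

lemma split_mono_of_endo:
  assumes X: "left_module A X" and Y: "left_module A Y" and Z: "left_module A Z"
    and f: "f \<in> mod_hom A X Y" "inj_on f (carrier X)" and im: "f ` carrier X = a_kernel Y Z g"
    and v: "v \<in> mod_hom A Y Y" "\<And>x. x \<in> carrier X \<Longrightarrow> v (f x) = f x" "\<And>y. y \<in> carrier Y \<Longrightarrow> g (v y) = \<zero>\<^bsub>Z\<^esub>"
  shows "split_mono A X Y f"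
proof -
  interpret f: module_hom A X Y f by (intro module_homI X Y f)
  have sm: "submodule (f ` carrier X) A Y" by (rule f.image_submodule[OF f.X.submodule_carrier])
  have "f \<in> mod_hom A X (Y\<lparr>carrier := f ` carrier X\<rparr>)" by (rule mod_hom_sub_codomain[OF f(1)]) simp
  moreover have "bij_betw f (carrier X) (carrier (Y\<lparr>carrier := f ` carrier X\<rparr>))"
    using f(2) by (simp add: bij_betw_def)
  ultimately obtain f' where f': "f' \<in> mod_hom A (Y\<lparr>carrier := f ` carrier X\<rparr>) X"
    "\<And>x. x \<in> carrier X \<Longrightarrow> f' (f x) = x"
    using inv_mod_hom[OF X f.Y.left_module_sub[OF sm]] by metis
  have "v \<in> mod_hom A Y (Y\<lparr>carrier := f ` carrier X\<rparr>)"
    by (rule mod_hom_sub_codomain[OF v(1)]) (use im v(3) mod_hom_closed[OF v(1)] in \<open>auto simp: a_kernel_eq\<close>)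
  from mod_hom_comp[OF this f'(1)] have "(\<lambda>y. f' (v y)) \<in> mod_hom A Y X" .
  then show ?thesis unfolding split_mono_def using v(2) f'(2) by (intro bexI[of _ "\<lambda>y. f' (v y)"]) auto
qed

context artin_algebra
begin

text \<open>If \<open>u : W \<rightarrow> Z\<close> does not factor through \<open>g\<close>, its pullback along \<open>g\<close> does not split, so \<open>Y\<close> maps to
  the pullback. The induced endomorphism of \<open>Z\<close> factors through \<open>u\<close>; being nilpotent it would
  split the sequence, so it is invertible and splits \<open>u\<close>.\<close>

lemma right_almost_split_of_left:
  assumes se: "short_exact A X f Y g Z" and las: "left_almost_split A X Y f"
    and endo: "\<And>c. c \<in> mod_hom A Z Z \<Longrightarrow>
      c ` carrier Z = carrier Z \<or> (\<exists>n. \<forall>z\<in>carrier Z. (c ^^ n) z = \<zero>\<^bsub>Z\<^esub>)"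
  shows "right_almost_split A Y Z g"
proof -
  have fg: "fg_module A X" "fg_module A Y" "fg_module A Z"
    and f: "f \<in> mod_hom A X Y" "inj_on f (carrier X)" and g: "g \<in> mod_hom A Y Z"
    and im: "f ` carrier X = a_kernel Y Z g" and surj: "g ` carrier Y = carrier Z"
    using se by (auto simp: short_exact_def)
  note X = fg_left_module[OF fg(1)] and Y = fg_left_module[OF fg(2)] and Z = fg_left_module[OF fg(3)]
  interpret f: module_hom A X Y f by (intro module_homI X Y f)
  interpret g: module_hom A Y Z g by (intro module_homI Y Z g)
  note nsplit = split_mono_of_endo[OF X Y Z f im]
  have not_split: "\<not> split_mono A X Y f" using las by (simp add: left_almost_split_def)
  have gf: "g (f x) = \<zero>\<^bsub>Z\<^esub>" if "x \<in> carrier X" for x using im that by (auto simp: a_kernel_eq)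
  have "\<not> split_epi A Y Z g"
  proof
    assume "split_epi A Y Z g"
    then obtain h where h: "h \<in> mod_hom A Z Y" "\<forall>z\<in>carrier Z. g (h z) = z"
      unfolding split_epi_def by (rule bexE)
    interpret h: module_hom A Z Y h by (intro module_homI Y Z h)
    have "(\<lambda>y. y \<ominus>\<^bsub>Y\<^esub> h (g y)) \<in> mod_hom A Y Y"
      by (intro mod_hom_minus Y mod_hom_comp[OF g h(1)]) (simp add: mod_hom_def)
    then have "split_mono A X Y f"
    proof (rule nsplit)
      show "f x \<ominus>\<^bsub>Y\<^esub> h (g (f x)) = f x" if "x \<in> carrier X" for x
        using that f.closed by (simp add: gf h.zero f.Y.minus_zero)
      show "g (y \<ominus>\<^bsub>Y\<^esub> h (g y)) = \<zero>\<^bsub>Z\<^esub>" if "y \<in> carrier Y" for y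
        using that g.closed h.closed h(2) by (simp add: g.minus g.Y.minus_eq_zero_iff)
    qed
    then show False using not_split by simp
  qed
  moreover have "\<exists>v\<in>mod_hom A W Y. \<forall>w\<in>carrier W. g (v w) = h w"
    if h: "h \<in> mod_hom A W Z" and fgW: "fg_module A W" and ns: "\<not> split_epi A W Z h"
    for W :: "'a fgmod" and h
  proof -
    note W = fg_left_module[OF fgW]
    interpret h: module_hom A W Z h by (intro module_homI W Z h)
    define E where "E = {(y, w). y \<in> carrier Y \<and> w \<in> carrier W \<and> g y = h w}"
    interpret YW: left_module A "dsum Y W" by (intro left_module_dsum Y W)
    have E: "submodule E A (dsum Y W)"
      by (rule YW.submoduleI)
        (auto simp: E_def g.zero h.zero g.add h.add g.smult h.smult f.Y.smult_closed h.X.smult_closed)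
    define E' where "E' = (dsum Y W)\<lparr>carrier := E\<rparr>"
    have fgE: "fg_module A E'" unfolding E'_def by (rule fg_sub[OF fg_dsum[OF fg(2) fgW] E])
    note E' = fg_left_module[OF fgE]
    have p1: "fst \<in> mod_hom A E' Y" and p2: "snd \<in> mod_hom A E' W"
      unfolding E'_def by (intro mod_hom_sub_domain dsum_fst_hom dsum_snd_hom submodule_subset[OF E])+
    have i: "(\<lambda>x. (f x, \<zero>\<^bsub>W\<^esub>)) \<in> mod_hom A X E'"
      unfolding E'_def
    proof (rule mod_hom_sub_codomain)
      show "(\<lambda>x. (f x, \<zero>\<^bsub>W\<^esub>)) \<in> mod_hom A X (dsum Y W)" by (intro mod_hom_pair f mod_hom_zero W)
      show "(\<lambda>x. (f x, \<zero>\<^bsub>W\<^esub>)) ` carrier X \<subseteq> E" using f.closed gf by (auto simp: E_def h.zero)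
    qed
    show ?thesis
    proof (cases "split_mono A X E' (\<lambda>x. (f x, \<zero>\<^bsub>W\<^esub>))")
      case True
      then obtain r where r: "r \<in> mod_hom A E' X" "\<forall>x\<in>carrier X. r (f x, \<zero>\<^bsub>W\<^esub>) = x"
        unfolding split_mono_def by (rule bexE)
      interpret p2: module_hom A E' W snd by (intro module_homI E' W p2)
      have surj2: "snd ` carrier E' = carrier W"
      proof
        show "carrier W \<subseteq> snd ` carrier E'"
        proof
          fix w assume w: "w \<in> carrier W"
          then have "h w \<in> g ` carrier Y" using surj h.closed by blast
          then obtain y where "y \<in> carrier Y" "h w = g y" by blast
          then have "(y, w) \<in> carrier E'" using w by (simp add: E'_def E_def)
          then show "w \<in> snd ` carrier E'" by force
        qed
      qed (use p2.closed in blast)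
      \<comment> \<open>A retraction \<open>r\<close> from the pullback to \<open>X\<close> removes
        the ambiguity in the choice of preimages: \<open>fst e - f (r e)\<close> depends only on
        \<open>snd e\<close>, and \<open>g\<close> still maps it to
        \<open>h (snd e)\<close>.\<close>
      have k: "(\<lambda>e. fst e \<ominus>\<^bsub>Y\<^esub> f (r e)) \<in> mod_hom A E' Y"
        by (intro mod_hom_minus Y p1 mod_hom_comp[OF r(1) f(1)])
      have "fst e \<ominus>\<^bsub>Y\<^esub> f (r e) = \<zero>\<^bsub>Y\<^esub>" if e: "e \<in> carrier E'" "snd e = \<zero>\<^bsub>W\<^esub>" for e
      proof -
        have y: "fst e \<in> carrier Y" "g (fst e) = \<zero>\<^bsub>Z\<^esub>" using e by (auto simp: E'_def E_def h.zero)
        then have "fst e \<in> f ` carrier X" using im by (simp add: a_kernel_eq)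
        then obtain x where x: "x \<in> carrier X" "fst e = f x" by blast
        then have "e = (f x, \<zero>\<^bsub>W\<^esub>)" using e(2) by (metis prod.collapse)
        then show ?thesis using r(2) x f.closed by (simp add: f.Y.minus_eq_zero_iff)
      qed
      from p2.factor[OF Y surj2 k this] obtain v where v: "v \<in> mod_hom A W Y"
        "\<And>e. e \<in> carrier E' \<Longrightarrow> v (snd e) = fst e \<ominus>\<^bsub>Y\<^esub> f (r e)" by metis
      have "g (v w) = h w" if "w \<in> carrier W" for w
      proof -
        have "w \<in> snd ` carrier E'" using that surj2 by simp
        then obtain e where e: "e \<in> carrier E'" "w = snd e" by blast
        have c: "fst e \<in> carrier Y" "r e \<in> carrier X" "g (fst e) = h w"
          using e mod_hom_closed[OF r(1)] by (auto simp: E'_def E_def)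
        then show ?thesis using e v(2) gf f.closed h.closed[OF that]
          by (simp add: g.minus g.Y.minus_zero)
      qed
      then show ?thesis using v(1) by blast
    next
      case False
      from left_almost_split_extend[OF las fgE i False]
      obtain v where v: "v \<in> mod_hom A Y E'" "\<forall>x\<in>carrier X. v (f x) = (f x, \<zero>\<^bsub>W\<^esub>)" by (rule bexE)
      have v1: "(\<lambda>y. fst (v y)) \<in> mod_hom A Y Y" and v2: "(\<lambda>y. snd (v y)) \<in> mod_hom A Y W"
        by (rule mod_hom_comp[OF v(1) p1], rule mod_hom_comp[OF v(1) p2])
      have ghv: "g (fst (v y)) = h (snd (v y))" if "y \<in> carrier Y" for y
        using mod_hom_closed[OF v(1) that] by (auto simp: E'_def E_def)
      have "snd (v y) = \<zero>\<^bsub>W\<^esub>" if y: "y \<in> carrier Y" "g y = \<zero>\<^bsub>Z\<^esub>" for y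
      proof -
        have "y \<in> f ` carrier X" using y im by (simp add: a_kernel_eq)
        then show ?thesis using v(2) by auto
      qed
      from g.factor[OF W surj v2 this] obtain k where k: "k \<in> mod_hom A Z W"
        "\<And>y. y \<in> carrier Y \<Longrightarrow> k (g y) = snd (v y)" by metis
      define c where "c = (\<lambda>z. h (k z))"
      have c: "c \<in> mod_hom A Z Z" unfolding c_def by (rule mod_hom_comp[OF k(1) h])
      have cg: "c (g y) = g (fst (v y))" if "y \<in> carrier Y" for y
        using k(2)[OF that] ghv[OF that] by (simp add: c_def)
      have False
      proof (cases "c ` carrier Z = carrier Z")
        case True
        then have "bij_betw c (carrier Z) (carrier Z)"
          using g.Y.endo_surj_imp_inj[OF fg_fin_length[OF fg(3)] c True] by (simp add: bij_betw_def)
        then obtain c' where c': "c' \<in> mod_hom A Z Z" "\<And>z. z \<in> carrier Z \<Longrightarrow> c (c' z) = z"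
          using inv_mod_hom[OF Z Z c] by metis
        have "(\<lambda>z. k (c' z)) \<in> mod_hom A Z W" by (rule mod_hom_comp[OF c'(1) k(1)])
        then have "split_epi A W Z h"
          unfolding split_epi_def using c'(2) by (intro bexI[of _ "\<lambda>z. k (c' z)"]) (auto simp: c_def)
        then show False using ns by simp
      next
        case False
        then obtain n where n: "\<forall>z\<in>carrier Z. (c ^^ n) z = \<zero>\<^bsub>Z\<^esub>" using endo[OF c] by blast
        \<comment> \<open>\<open>g\<close> intertwines \<open>v1'\<close> with \<open>c\<close>, so
          the \<open>n\<close>-th power of \<open>v1'\<close> maps \<open>Y\<close> into the kernel
          of \<open>g\<close> while fixing the image of \<open>f\<close>.\<close>
        define v1' where "v1' = (\<lambda>y. fst (v y))"
        have v1'_closed: "(v1' ^^ m) y \<in> carrier Y" if "y \<in> carrier Y" for m y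
          using f.Y.endo_funpow_closed v1 that unfolding v1'_def .
        have cgn: "g ((v1' ^^ m) y) = (c ^^ m) (g y)" if "y \<in> carrier Y" for m y
        proof (induction m)
          case (Suc m)
          have "g ((v1' ^^ Suc m) y) = c (g ((v1' ^^ m) y))"
            using cg[OF v1'_closed[OF that]] by (simp add: v1'_def)
          then show ?case using Suc by simp
        qed simp
        have fixed: "(v1' ^^ m) (f x) = f x" if "x \<in> carrier X" for m x
          by (induction m) (use v(2) that in \<open>auto simp: v1'_def\<close>)
        have "v1' ^^ n \<in> mod_hom A Y Y" unfolding v1'_def by (rule mod_hom_funpow[OF v1])
        then have "split_mono A X Y f"
          by (rule nsplit) (use fixed cgn n g.closed in auto)
        then show False using not_split by simp
      qed
      then show ?thesis ..
    qed
  qed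
  ultimately show ?thesis using g unfolding right_almost_split_def by simp
qed

end

section \<open>Double annihilators\<close>

text \<open>A substitute for Matlis duality: \<open>U\<close> plays the part of the injective hull of a simple \<open>R\<close>-module, and
  \<open>G\<close> that of the dual of \<open>W\<close>. Every submodule of \<open>W\<close> is its own double annihilator; this is shown along
  a composition series, since a functional killing a maximal submodule \<open>V1\<close> of \<open>V\<close> has values in the
  one-dimensional socle of \<open>U\<close> on \<open>V\<close>.\<close>

lemma separation:
  assumes R: "cring R" and Z: "left_module R Z" and fl: "fin_length R Z" and U: "left_module R U"
    and t: "t \<in> carrier U" "t \<noteq> \<zero>\<^bsub>U\<^esub>"
    and ess: "\<And>u. u \<in> carrier U \<Longrightarrow> u \<noteq> \<zero>\<^bsub>U\<^esub> \<Longrightarrow> \<exists>r\<in>carrier R. r \<odot>\<^bsub>U\<^esub> u = t"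
    and G: "G \<subseteq> mod_hom R Z U"
    and G_smult: "\<And>w r. w \<in> G \<Longrightarrow> r \<in> carrier R \<Longrightarrow> \<exists>w'\<in>G. \<forall>z\<in>carrier Z. w' z = r \<odot>\<^bsub>U\<^esub> w z"
    and G_minus: "\<And>w w'. w \<in> G \<Longrightarrow> w' \<in> G \<Longrightarrow> \<exists>w''\<in>G. \<forall>z\<in>carrier Z. w'' z = w z \<ominus>\<^bsub>U\<^esub> w' z"
    and W: "submodule W R Z" and W_faithful: "\<And>v. v \<in> W \<Longrightarrow> v \<noteq> \<zero>\<^bsub>Z\<^esub> \<Longrightarrow> \<exists>w\<in>G. w v \<noteq> \<zero>\<^bsub>U\<^esub>"
    and V: "submodule V R Z" "V \<subseteq> W" and v: "v \<in> W" "v \<notin> V"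
  shows "\<exists>w\<in>G. (\<forall>x\<in>V. w x = \<zero>\<^bsub>U\<^esub>) \<and> w v \<noteq> \<zero>\<^bsub>U\<^esub>"
proof -
  interpret R: cring R by fact
  interpret Z: left_module R Z by fact
  interpret U: left_module R U by fact
  obtain l :: "_ \<Rightarrow> nat" where l: "\<And>H K. submodule H R Z \<Longrightarrow> submodule K R Z \<Longrightarrow> H \<subset> K \<Longrightarrow> l H < l K"
    using fl unfolding fin_length_def by metis
  have hom: "module_hom R Z U w" if "w \<in> G" for w
    using G that by (intro module_homI Z U) auto
  note Wc = submodule_subset[OF W, THEN subsetD]
  show ?thesis
    using V v
  proof (induction V arbitrary: v rule: measure_induct_rule[where f = l])
    case (less V)
    note V = less.prems(1,2) and v = less.prems(3,4)
    note Vc = submodule_subset[OF V(1), THEN subsetD]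
    show ?case
    proof (cases "V = {\<zero>\<^bsub>Z\<^esub>}")
      case True
      then have "v \<noteq> \<zero>\<^bsub>Z\<^esub>" using v by blast
      then obtain w where w: "w \<in> G" "w v \<noteq> \<zero>\<^bsub>U\<^esub>" using W_faithful v(1) by blast
      then show ?thesis using module_hom.zero[OF hom[OF w(1)]] True by (intro bexI[of _ w]) auto
    next
      case False
      then have "{\<zero>\<^bsub>Z\<^esub>} \<subset> V" using submodule_zero_mem[OF V(1)] by blast
      then have "\<exists>H. submodule H R Z \<and> H \<subset> V \<and> (\<forall>K. submodule K R Z \<and> K \<subset> V \<and> H \<subseteq> K \<longrightarrow> K = H)"
        by (rule Z.fin_length_maximal[OF fl Z.submodule_zero])
      then obtain V1 where "submodule V1 R Z \<and> V1 \<subset> V \<and> (\<forall>K. submodule K R Z \<and> K \<subset> V \<and> V1 \<subseteq> K \<longrightarrow> K = V1)"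
        by (rule exE)
      then have V1: "submodule V1 R Z" "V1 \<subset> V"
        and V1_max: "\<And>K. submodule K R Z \<Longrightarrow> K \<subset> V \<Longrightarrow> V1 \<subseteq> K \<Longrightarrow> K = V1" by simp_all
      note V1c = submodule_subset[OF V1(1), THEN subsetD]
      have IH: "\<exists>w\<in>G. (\<forall>x\<in>V1. w x = \<zero>\<^bsub>U\<^esub>) \<and> w v \<noteq> \<zero>\<^bsub>U\<^esub>" if "v \<in> W" "v \<notin> V1" for v
        using less.IH[OF l[OF V1(1) V(1) V1(2)] V1(1) _ that] V1(2) V(2) by blast
      have gen: "\<exists>q\<in>V1. \<exists>r\<in>carrier R. x = q \<oplus>\<^bsub>Z\<^esub> r \<odot>\<^bsub>Z\<^esub> y" if y: "y \<in> V" "y \<notin> V1" and x: "x \<in> V" for x y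
      proof -
        let ?C = "(\<lambda>r. r \<odot>\<^bsub>Z\<^esub> y) ` carrier R"
        have C: "submodule ?C R Z" by (rule Z.submodule_cyclic[OF Vc[OF y(1)]])
        have "V1 <+>\<^bsub>Z\<^esub> ?C \<subseteq> V"
          by (rule Z.set_add_least[OF V(1) _ Z.cyclic_least[OF V(1) y(1)]]) (use V1(2) in blast)
        moreover have "V1 <+>\<^bsub>Z\<^esub> ?C \<noteq> V1"
          using Z.set_add_upper2[OF V1(1) C] Z.cyclic_self[OF Vc[OF y(1)]] y(2) by blast
        ultimately have "V1 <+>\<^bsub>Z\<^esub> ?C = V"
          using V1_max[OF Z.submodule_set_add[OF V1(1) C] _ Z.set_add_upper1[OF V1(1) C]] by blast
        then have "x \<in> V1 <+>\<^bsub>Z\<^esub> ?C" using x by simp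
        then show ?thesis unfolding set_add_iff by blast
      qed
      obtain v1 where v1: "v1 \<in> V" "v1 \<notin> V1" using V1(2) by blast
      note c1 = Vc[OF v1(1)]
      have kill: "\<forall>x\<in>V. w x = \<zero>\<^bsub>U\<^esub>" if w: "w \<in> G" "\<forall>x\<in>V1. w x = \<zero>\<^bsub>U\<^esub>" "w v1 = \<zero>\<^bsub>U\<^esub>" for w
      proof
        interpret w: module_hom R Z U w by (rule hom[OF w(1)])
        fix x assume "x \<in> V"
        then obtain q r where "q \<in> V1" "r \<in> carrier R" "x = q \<oplus>\<^bsub>Z\<^esub> r \<odot>\<^bsub>Z\<^esub> v1" using gen v1 by blast
        then show "w x = \<zero>\<^bsub>U\<^esub>"
          using w V1c c1 by (simp add: w.add w.smult Z.smult_closed U.smult_zero_right)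
      qed
      \<comment> \<open>\<open>r v1\<close> is outside \<open>V1\<close> because \<open>w\<close>
        sends it to \<open>t \<noteq> 0\<close>. As \<open>V/V1\<close> is simple, \<open>v1\<close>
        is a multiple of \<open>r v1\<close> modulo \<open>V1\<close>, so \<open>w v1\<close> is a
        multiple of \<open>t\<close>.\<close>
      have key: "\<exists>r\<in>carrier R. w v1 = r \<odot>\<^bsub>U\<^esub> t" if w: "w \<in> G" "\<forall>x\<in>V1. w x = \<zero>\<^bsub>U\<^esub>" for w
      proof (cases "w v1 = \<zero>\<^bsub>U\<^esub>")
        case True
        then show ?thesis using t(1) by (intro bexI[of _ "\<zero>\<^bsub>R\<^esub>"]) (auto simp: U.smult_zero_left)
      next
        case False
        interpret w: module_hom R Z U w by (rule hom[OF w(1)])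
        obtain r where r: "r \<in> carrier R" "r \<odot>\<^bsub>U\<^esub> w v1 = t" using ess[OF w.closed[OF c1] False] by blast
        have "r \<odot>\<^bsub>Z\<^esub> v1 \<notin> V1" using w(2) r t(2) c1 w.smult by metis
        moreover have "r \<odot>\<^bsub>Z\<^esub> v1 \<in> V" by (rule submodule_smult_mem[OF V(1) r(1) v1(1)])
        ultimately obtain q r' where "q \<in> V1" "r' \<in> carrier R" "v1 = q \<oplus>\<^bsub>Z\<^esub> r' \<odot>\<^bsub>Z\<^esub> (r \<odot>\<^bsub>Z\<^esub> v1)"
          using gen v1(1) by blast
        note q = this
        have "w v1 = w (q \<oplus>\<^bsub>Z\<^esub> r' \<odot>\<^bsub>Z\<^esub> (r \<odot>\<^bsub>Z\<^esub> v1))" using q(3) by (rule arg_cong)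
        also have "\<dots> = r' \<odot>\<^bsub>U\<^esub> t"
          using q(1,2) w(2) r c1 V1c t(1) by (simp add: w.add w.smult Z.smult_closed U.smult_closed)
        finally show ?thesis using q(2) by blast
      qed
      have "v1 \<in> W" using v1(1) V(2) by blast
      then obtain w0 where w0: "w0 \<in> G" "\<forall>x\<in>V1. w0 x = \<zero>\<^bsub>U\<^esub>" "w0 v1 \<noteq> \<zero>\<^bsub>U\<^esub>" using IH[OF _ v1(2)] by blast
      obtain r where r: "r \<in> carrier R" "r \<odot>\<^bsub>U\<^esub> w0 v1 = t"
        using ess[OF module_hom.closed[OF hom[OF w0(1)] c1] w0(3)] by blast
      obtain w1 where w1: "w1 \<in> G" "\<forall>z\<in>carrier Z. w1 z = r \<odot>\<^bsub>U\<^esub> w0 z" using G_smult[OF w0(1) r(1)] by blast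
      interpret w1: module_hom R Z U w1 by (rule hom[OF w1(1)])
      have w1_V1: "\<forall>x\<in>V1. w1 x = \<zero>\<^bsub>U\<^esub>" using w1(2) w0(2) V1c r(1) by (simp add: U.smult_zero_right)
      have w1_v1: "w1 v1 = t" using w1(2) c1 r(2) by simp
      note vc = Wc[OF v(1)]
      show ?thesis
      proof (rule ccontr)
        assume "\<not> ?thesis"
        then have no: "w v = \<zero>\<^bsub>U\<^esub>" if "w \<in> G" "\<forall>x\<in>V. w x = \<zero>\<^bsub>U\<^esub>" for w using that by blast
        \<comment> \<open>If \<open>r (w1 v) = t\<close>, then \<open>r v1\<close> is not in
          \<open>V1\<close>: else \<open>r w1\<close> would kill \<open>V\<close> and thus
          \<open>v\<close>. So \<open>v1 = r' r v1\<close> modulo \<open>V1\<close>; then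
          \<open>w1 - r' r w1\<close> kills \<open>V\<close> and therefore \<open>v\<close>, which
          means \<open>w1 v = r' t\<close>.\<close>
        have "\<exists>r0\<in>carrier R. w1 v = r0 \<odot>\<^bsub>U\<^esub> t"
        proof (cases "w1 v = \<zero>\<^bsub>U\<^esub>")
          case True
          then show ?thesis using t(1) by (intro bexI[of _ "\<zero>\<^bsub>R\<^esub>"]) (auto simp: U.smult_zero_left)
        next
          case False
          obtain r where r: "r \<in> carrier R" "r \<odot>\<^bsub>U\<^esub> w1 v = t" using ess[OF w1.closed[OF vc] False] by blast
          obtain w' where w': "w' \<in> G" "\<forall>z\<in>carrier Z. w' z = r \<odot>\<^bsub>U\<^esub> w1 z" using G_smult[OF w1(1) r(1)] by blast
          have w'_V1: "\<forall>x\<in>V1. w' x = \<zero>\<^bsub>U\<^esub>" using w'(2) w1_V1 V1c r(1) by (simp add: U.smult_zero_right)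
          have "r \<odot>\<^bsub>Z\<^esub> v1 \<notin> V1"
          proof
            assume "r \<odot>\<^bsub>Z\<^esub> v1 \<in> V1"
            then have "w1 (r \<odot>\<^bsub>Z\<^esub> v1) = \<zero>\<^bsub>U\<^esub>" using w1_V1 by blast
            then have "w' v1 = \<zero>\<^bsub>U\<^esub>" using w'(2) c1 r(1) by (simp add: w1.smult)
            then have "w' v = \<zero>\<^bsub>U\<^esub>" using no[OF w'(1) kill[OF w'(1) w'_V1]] by blast
            then show False using w'(2) vc r(2) t(2) by simp
          qed
          moreover have "r \<odot>\<^bsub>Z\<^esub> v1 \<in> V" by (rule submodule_smult_mem[OF V(1) r(1) v1(1)])
          ultimately obtain q r' where q: "q \<in> V1" "r' \<in> carrier R" "v1 = q \<oplus>\<^bsub>Z\<^esub> r' \<odot>\<^bsub>Z\<^esub> (r \<odot>\<^bsub>Z\<^esub> v1)"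
            using gen v1(1) by blast
          have "w1 v1 = w1 (q \<oplus>\<^bsub>Z\<^esub> r' \<odot>\<^bsub>Z\<^esub> (r \<odot>\<^bsub>Z\<^esub> v1))" using q(3) by (rule arg_cong)
          also have "\<dots> = r' \<odot>\<^bsub>U\<^esub> w' v1"
            using q(1,2) w1_V1 r(1) c1 V1c w'(2) w1.closed
            by (simp add: w1.add w1.smult Z.smult_closed U.smult_closed)
          finally have eq: "w1 v1 = r' \<odot>\<^bsub>U\<^esub> w' v1" .
          obtain w2 where w2: "w2 \<in> G" "\<forall>z\<in>carrier Z. w2 z = r' \<odot>\<^bsub>U\<^esub> w' z" using G_smult[OF w'(1) q(2)] by blast
          obtain w3 where w3: "w3 \<in> G" "\<forall>z\<in>carrier Z. w3 z = w1 z \<ominus>\<^bsub>U\<^esub> w2 z" using G_minus[OF w1(1) w2(1)] by blast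
          have "\<forall>x\<in>V1. w3 x = \<zero>\<^bsub>U\<^esub>"
            using w3(2) w2(2) w'_V1 w1_V1 V1c q(2) by (simp add: U.smult_zero_right U.minus_zero)
          moreover have "w3 v1 = \<zero>\<^bsub>U\<^esub>"
            using w3(2) w2(2) c1 eq w1.closed[OF c1] by (simp add: U.minus_eq_zero_iff)
          ultimately have "w3 v = \<zero>\<^bsub>U\<^esub>" using no[OF w3(1) kill[OF w3(1)]] by blast
          then have "w1 v = w2 v"
            using w3(2) vc w1.closed[OF vc] module_hom.closed[OF hom[OF w2(1)] vc]
            by (simp add: U.minus_eq_zero_iff)
          then have "w1 v = r' \<odot>\<^bsub>U\<^esub> t" using w2(2) w'(2) vc r(2) by simp
          then show ?thesis using q(2) by blast
        qed
        then obtain r0 where r0: "r0 \<in> carrier R" "w1 v = r0 \<odot>\<^bsub>U\<^esub> t" by blast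
        \<comment> \<open>\<open>v\<close> is corrected by the multiple of \<open>v1\<close> on
          which \<open>w1\<close> takes the same value. The new vector is still outside
          \<open>V1\<close>. But a \<open>w\<close> that kills \<open>V1\<close> agrees on
          \<open>V\<close>, hence also at \<open>v\<close>, with a multiple of \<open>w1\<close>,
          and so kills it; commutativity of \<open>R\<close> enters here.\<close>
        let ?v = "v \<ominus>\<^bsub>Z\<^esub> r0 \<odot>\<^bsub>Z\<^esub> v1"
        have rv1: "r0 \<odot>\<^bsub>Z\<^esub> v1 \<in> V" by (rule submodule_smult_mem[OF V(1) r0(1) v1(1)])
        have "?v \<in> W" using submodule_minus_mem[OF W v(1)] rv1 V(2) by blast
        moreover have "?v \<notin> V1"
        proof
          assume "?v \<in> V1"
          then have "?v \<oplus>\<^bsub>Z\<^esub> r0 \<odot>\<^bsub>Z\<^esub> v1 \<in> V" using submodule_add_mem[OF V(1)] rv1 V1(2) by blast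
          then show False using v(2) Z.minus_add_cancel[OF vc Vc[OF rv1]] by simp
        qed
        ultimately obtain w where w: "w \<in> G" "\<forall>x\<in>V1. w x = \<zero>\<^bsub>U\<^esub>" "w ?v \<noteq> \<zero>\<^bsub>U\<^esub>" using IH by blast
        interpret w: module_hom R Z U w by (rule hom[OF w(1)])
        obtain r where r: "r \<in> carrier R" "w v1 = r \<odot>\<^bsub>U\<^esub> t" using key[OF w(1,2)] by blast
        obtain w2 where w2: "w2 \<in> G" "\<forall>z\<in>carrier Z. w2 z = r \<odot>\<^bsub>U\<^esub> w1 z" using G_smult[OF w1(1) r(1)] by blast
        obtain w3 where w3: "w3 \<in> G" "\<forall>z\<in>carrier Z. w3 z = w z \<ominus>\<^bsub>U\<^esub> w2 z" using G_minus[OF w(1) w2(1)] by blast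
        have "\<forall>x\<in>V1. w3 x = \<zero>\<^bsub>U\<^esub>"
          using w3(2) w2(2) w1_V1 w(2) V1c r(1) by (simp add: U.smult_zero_right U.minus_zero)
        moreover have "w3 v1 = \<zero>\<^bsub>U\<^esub>"
          using w3(2) w2(2) c1 w1_v1 r t(1) by (simp add: U.minus_eq_zero_iff U.smult_closed)
        ultimately have "w3 v = \<zero>\<^bsub>U\<^esub>" using no[OF w3(1) kill[OF w3(1)]] by blast
        then have "w v = w2 v"
          using w3(2) vc w.closed[OF vc] module_hom.closed[OF hom[OF w2(1)] vc]
          by (simp add: U.minus_eq_zero_iff)
        then have "w v = r \<odot>\<^bsub>U\<^esub> (r0 \<odot>\<^bsub>U\<^esub> t)" using w2(2) vc r0(2) by simp
        moreover have "r \<odot>\<^bsub>U\<^esub> (r0 \<odot>\<^bsub>U\<^esub> t) = r0 \<odot>\<^bsub>U\<^esub> (r \<odot>\<^bsub>U\<^esub> t)"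
          using r(1) r0(1) t(1) by (simp add: U.smult_assoc1[symmetric] R.m_comm)
        ultimately have "w ?v = \<zero>\<^bsub>U\<^esub>"
          using vc c1 r r0(1) t(1) by (simp add: w.minus w.smult Z.smult_closed U.minus_eq_zero_iff U.smult_closed)
        then show False using w(3) by simp
      qed
    qed
  qed
qed

section \<open>A primitive idempotent for a simple module, and the socle of an indecomposable
  injective module\<close>

context artin_algebra
begin

text \<open>A left ideal \<open>Q\<close> minimal subject to \<open>Q t \<noteq> 0\<close> is the
  projective cover of the simple module \<open>A t\<close>. Some \<open>q \<in> Q\<close> fixes
  \<open>t\<close>; right multiplication by \<open>q\<close> maps \<open>Q\<close> onto itself by
  minimality, hence injectively by finite length, and the preimage \<open>f\<close> of
  \<open>q\<close> is idempotent because \<open>(f f) q = f q\<close>. Minimality also makes each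
  \<open>y f\<close> with \<open>y f t \<noteq> 0\<close> a generator of \<open>Q\<close>.\<close>

lemma exists_local_idempotent:
  assumes X: "left_module A X" and t: "t \<in> carrier X" "t \<noteq> \<zero>\<^bsub>X\<^esub>"
    and simple: "\<And>a. a \<in> carrier A \<Longrightarrow> a \<odot>\<^bsub>X\<^esub> t \<noteq> \<zero>\<^bsub>X\<^esub> \<Longrightarrow> \<exists>c\<in>carrier A. c \<odot>\<^bsub>X\<^esub> (a \<odot>\<^bsub>X\<^esub> t) = t"
  shows "\<exists>f\<in>carrier A. f \<odot>\<^bsub>X\<^esub> t = t \<and>
    (\<forall>y\<in>carrier A. (y \<otimes>\<^bsub>A\<^esub> f) \<odot>\<^bsub>X\<^esub> t \<noteq> \<zero>\<^bsub>X\<^esub> \<longrightarrow> (\<exists>a\<in>carrier A. a \<otimes>\<^bsub>A\<^esub> (y \<otimes>\<^bsub>A\<^esub> f) = f)) \<and> f \<otimes>\<^bsub>A\<^esub> f = f"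
proof -
  interpret X: left_module A X by fact
  let ?A = "regular_module A"
  interpret B: left_module A ?A by (rule A.left_module_regular)
  have fl: "fin_length A ?A" by (rule fg_fin_length[OF fg_regular])
  let ?Q = "\<lambda>H. \<exists>q\<in>H. q \<odot>\<^bsub>X\<^esub> t \<noteq> \<zero>\<^bsub>X\<^esub>"
  have "?Q (carrier ?A)" using t by (intro bexI[of _ "\<one>\<^bsub>A\<^esub>"]) (auto simp: X.smult_one)
  then have "\<exists>H. submodule H A ?A \<and> ?Q H \<and> (\<forall>K. submodule K A ?A \<and> ?Q K \<and> K \<subseteq> H \<longrightarrow> K = H)"
    by (rule B.fin_length_minimal[OF fl B.submodule_carrier])
  then obtain Q where "submodule Q A ?A \<and> ?Q Q \<and> (\<forall>K. submodule K A ?A \<and> ?Q K \<and> K \<subseteq> Q \<longrightarrow> K = Q)"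
    by (rule exE)
  then have Q: "submodule Q A ?A" "?Q Q"
    and Q_min: "\<And>K. submodule K A ?A \<Longrightarrow> ?Q K \<Longrightarrow> K \<subseteq> Q \<Longrightarrow> K = Q" by simp_all
  note Qc = submodule_subset[OF Q(1), simplified, THEN subsetD]
  note Qs = submodule_smult_mem[OF Q(1), simplified]
  obtain q0 where q0: "q0 \<in> Q" "q0 \<odot>\<^bsub>X\<^esub> t \<noteq> \<zero>\<^bsub>X\<^esub>" using Q(2) by blast
  obtain c where c: "c \<in> carrier A" "c \<odot>\<^bsub>X\<^esub> (q0 \<odot>\<^bsub>X\<^esub> t) = t" using simple[OF Qc[OF q0(1)] q0(2)] by blast
  define q where "q = c \<otimes>\<^bsub>A\<^esub> q0"
  have q: "q \<in> Q" "q \<odot>\<^bsub>X\<^esub> t = t" using Qs[OF c(1) q0(1)] c Qc[OF q0(1)] t by (auto simp: q_def X.smult_assoc1)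
  note qc = Qc[OF q(1)]
  define m where "m = (\<lambda>y. y \<otimes>\<^bsub>A\<^esub> q)"
  have m_hom: "m \<in> mod_hom A (?A\<lparr>carrier := Q\<rparr>) (?A\<lparr>carrier := Q\<rparr>)"
    unfolding m_def by (rule mod_homI) (use Qc qc Qs q(1) in \<open>auto simp: A.l_distr A.m_assoc\<close>)
  interpret Qm: left_module A "?A\<lparr>carrier := Q\<rparr>" by (rule B.left_module_sub[OF Q(1)])
  have "submodule (m ` Q) A (?A\<lparr>carrier := Q\<rparr>)"
    using module_hom.image_submodule[OF module_homI[OF Qm.left_module_axioms Qm.left_module_axioms m_hom] Qm.submodule_carrier]
    by simp
  then have "submodule (m ` Q) A ?A" "m ` Q \<subseteq> Q" using B.submodule_sub_iff[OF Q(1)] by auto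
  moreover have "?Q (m ` Q)"
    using q qc t by (intro bexI[of _ "m q"]) (auto simp: m_def X.smult_assoc1)
  ultimately have surj: "m ` Q = Q" using Q_min by blast
  then have inj: "inj_on m Q"
    using Qm.endo_surj_imp_inj[OF B.fin_length_sub[OF fl Q(1)] m_hom] by simp
  obtain f where f: "f \<in> Q" "f \<otimes>\<^bsub>A\<^esub> q = q" using surj q(1) unfolding m_def by (metis imageE)
  note fc = Qc[OF f(1)]
  have "m (f \<otimes>\<^bsub>A\<^esub> f) = m f" using f(2) fc qc by (simp add: m_def A.m_assoc)
  then have ff: "f \<otimes>\<^bsub>A\<^esub> f = f" using inj Qs[OF fc f(1)] f(1) by (meson inj_onD)
  have ft: "f \<odot>\<^bsub>X\<^esub> t = t" using f(2) q(2) fc qc t(1) X.smult_assoc1 by metis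
  have "\<exists>a\<in>carrier A. a \<otimes>\<^bsub>A\<^esub> (y \<otimes>\<^bsub>A\<^esub> f) = f" if y: "y \<in> carrier A" "(y \<otimes>\<^bsub>A\<^esub> f) \<odot>\<^bsub>X\<^esub> t \<noteq> \<zero>\<^bsub>X\<^esub>" for y
  proof -
    let ?C = "(\<lambda>a. a \<odot>\<^bsub>?A\<^esub> (y \<otimes>\<^bsub>A\<^esub> f)) ` carrier A"
    have yc: "y \<otimes>\<^bsub>A\<^esub> f \<in> carrier ?A" using y fc by simp
    have "?C \<subseteq> Q" by (rule B.cyclic_least[OF Q(1) Qs[OF y(1) f(1)]])
    moreover have "?Q ?C" using B.cyclic_self[OF yc] y(2) by blast
    ultimately have "?C = Q" using Q_min[OF B.submodule_cyclic[OF yc]] by blast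
    then have "f \<in> ?C" using f(1) by simp
    then obtain a where "a \<in> carrier A" "f = a \<otimes>\<^bsub>A\<^esub> (y \<otimes>\<^bsub>A\<^esub> f)" by auto
    then show ?thesis by metis
  qed
  then show ?thesis using fc ff ft by blast
qed

text \<open>No injective hull is constructed. Take \<open>B \<supseteq> H\<close> maximal with
  \<open>B \<inter> K = 0\<close> and extend the projection \<open>B + K \<rightarrow> K\<close> to
  an endomorphism \<open>e\<close> of \<open>I\<close>. Maximality gives \<open>ker e = B\<close>
  and \<open>e(I) \<inter> B = 0\<close>; by finite length \<open>e\<close> is bijective on
  \<open>e(I)\<close>, so \<open>I\<close> is the direct sum of \<open>B\<close>, which contains
  \<open>H\<close>, and \<open>e(I)\<close>, which contains \<open>K\<close>.\<close>

lemma injective_indecomposable_uniform: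
  assumes inj: "injective_fg A I" and ind: "indecomposable A I"
    and H: "submodule H A I" and K: "submodule K A I" and HK: "H \<inter> K = {\<zero>\<^bsub>I\<^esub>}"
  shows "H = {\<zero>\<^bsub>I\<^esub>} \<or> K = {\<zero>\<^bsub>I\<^esub>}"
proof (rule ccontr)
  assume neg: "\<not> ?thesis"
  have fg: "fg_module A I" using inj by (simp add: injective_fg_def)
  note fl = fg_fin_length[OF fg]
  interpret I: left_module A I by (rule fg_left_module[OF fg])
  have "\<exists>B. submodule B A I \<and> (H \<subseteq> B \<and> B \<inter> K = {\<zero>\<^bsub>I\<^esub>}) \<and>
      (\<forall>C. submodule C A I \<and> (H \<subseteq> C \<and> C \<inter> K = {\<zero>\<^bsub>I\<^esub>}) \<and> B \<subseteq> C \<longrightarrow> C = B)"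
    by (rule I.fin_length_maximal[OF fl H]) (simp add: HK)
  then obtain B where "submodule B A I \<and> (H \<subseteq> B \<and> B \<inter> K = {\<zero>\<^bsub>I\<^esub>}) \<and>
      (\<forall>C. submodule C A I \<and> (H \<subseteq> C \<and> C \<inter> K = {\<zero>\<^bsub>I\<^esub>}) \<and> B \<subseteq> C \<longrightarrow> C = B)" by (rule exE)
  then have B: "submodule B A I" "H \<subseteq> B" "B \<inter> K = {\<zero>\<^bsub>I\<^esub>}"
    and max: "\<And>C. submodule C A I \<Longrightarrow> H \<subseteq> C \<and> C \<inter> K = {\<zero>\<^bsub>I\<^esub>} \<and> B \<subseteq> C \<Longrightarrow> C = B" by simp_all
  have B_max: "C = B" if "submodule C A I" "B \<subseteq> C" "C \<inter> K = {\<zero>\<^bsub>I\<^esub>}" for C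
    using max[OF that(1)] that(2,3) B(2) by blast
  note Bc = submodule_subset[OF B(1), THEN subsetD] and Kc = submodule_subset[OF K, THEN subsetD]
  let ?S = "B <+>\<^bsub>I\<^esub> K"
  have S: "submodule ?S A I" by (rule I.submodule_set_add[OF B(1) K])
  let ?D = "dsum (I\<lparr>carrier := B\<rparr>) (I\<lparr>carrier := K\<rparr>)"
  have lmB: "left_module A (I\<lparr>carrier := B\<rparr>)" and lmK: "left_module A (I\<lparr>carrier := K\<rparr>)"
    and lmS: "left_module A (I\<lparr>carrier := ?S\<rparr>)"
    by (intro I.left_module_sub B K S)+
  have "(\<lambda>(x, y). x \<oplus>\<^bsub>I\<^esub> y) \<in> mod_hom A ?D I"
    using mod_hom_copair[OF I.left_module_axioms mod_hom_incl[OF submodule_subset[OF B(1)]]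
        mod_hom_incl[OF submodule_subset[OF K]]] .
  then have "(\<lambda>(x, y). x \<oplus>\<^bsub>I\<^esub> y) \<in> mod_hom A ?D (I\<lparr>carrier := ?S\<rparr>)"
  proof (rule mod_hom_sub_codomain)
    show "(\<lambda>(x, y). x \<oplus>\<^bsub>I\<^esub> y) ` carrier ?D \<subseteq> ?S"
    proof
      fix z assume "z \<in> (\<lambda>(x, y). x \<oplus>\<^bsub>I\<^esub> y) ` carrier ?D"
      then obtain x y where "x \<in> B" "y \<in> K" "z = x \<oplus>\<^bsub>I\<^esub> y" by auto
      then show "z \<in> ?S" unfolding set_add_iff by blast
    qed
  qed
  then interpret s: module_hom A ?D "I\<lparr>carrier := ?S\<rparr>" "\<lambda>(x, y). x \<oplus>\<^bsub>I\<^esub> y"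
    by (intro module_homI left_module_dsum lmB lmK lmS)
  have s_surj: "(\<lambda>(x, y). x \<oplus>\<^bsub>I\<^esub> y) ` carrier ?D = carrier (I\<lparr>carrier := ?S\<rparr>)"
    by (force simp: set_add_iff image_iff)
  have snd: "snd \<in> mod_hom A ?D I"
    by (rule mod_hom_of_sub_codomain[OF dsum_snd_hom submodule_subset[OF K]])
  have ker: "snd p = \<zero>\<^bsub>I\<^esub>"
    if p: "p \<in> carrier ?D" "(case p of (x, y) \<Rightarrow> x \<oplus>\<^bsub>I\<^esub> y) = \<zero>\<^bsub>I\<lparr>carrier := ?S\<rparr>\<^esub>" for p
  proof -
    obtain b k where bk: "p = (b, k)" "b \<in> B" "k \<in> K" using p(1) by auto
    then have "b \<oplus>\<^bsub>I\<^esub> k = \<zero>\<^bsub>I\<^esub>" using p(2) by simp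
    then have "k = \<ominus>\<^bsub>I\<^esub> b" using bk Bc Kc I.M.a_comm I.M.minus_equality by metis
    then have "k \<in> B \<inter> K" using bk submodule_uminus_mem[OF B(1)] by simp
    then show ?thesis using B(3) bk by simp
  qed
  obtain p where p: "p \<in> mod_hom A (I\<lparr>carrier := ?S\<rparr>) I"
    "\<And>z. z \<in> carrier ?D \<Longrightarrow> p (case z of (x, y) \<Rightarrow> x \<oplus>\<^bsub>I\<^esub> y) = snd z"
    using s.factor[OF I.left_module_axioms s_surj snd ker] by metis
  obtain e where e: "e \<in> mod_hom A I I" "\<forall>x\<in>?S. e x = p x" using injective_extend[OF inj fg S p(1)] by blast
  interpret e: module_hom A I I e by (intro module_homI I.left_module_axioms e)
  have e_sum: "e (b \<oplus>\<^bsub>I\<^esub> k) = k" if "b \<in> B" "k \<in> K" for b k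
  proof -
    have "b \<oplus>\<^bsub>I\<^esub> k \<in> ?S" using that unfolding set_add_iff by blast
    then show ?thesis using e(2) p(2)[of "(b, k)"] that by simp
  qed
  have e_K: "e k = k" if "k \<in> K" for k
    using e_sum[OF submodule_zero_mem[OF B(1)] that] Kc[OF that] by simp
  have e_B: "e b = \<zero>\<^bsub>I\<^esub>" if "b \<in> B" for b
    using e_sum[OF that submodule_zero_mem[OF K]] Bc[OF that] by simp
  let ?k = "{x \<in> carrier I. e x = \<zero>\<^bsub>I\<^esub>}" and ?E = "e ` carrier I"
  have E: "submodule ?E A I" by (rule e.image_submodule[OF I.submodule_carrier])
  have ker_e: "?k = B"
  proof (rule B_max[OF e.kernel_submodule])
    show "B \<subseteq> ?k" using e_B Bc by blast
    show "?k \<inter> K = {\<zero>\<^bsub>I\<^esub>}" using e_K e.zero submodule_zero_mem[OF K] by auto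
  qed
  \<comment> \<open>The preimage of \<open>B\<close> under \<open>e\<close> contains
    \<open>B\<close>, and it meets \<open>K\<close> only in \<open>B \<inter> K\<close> because
    \<open>e\<close> is the identity on \<open>K\<close>; by maximality it equals
    \<open>B\<close>.\<close>
  have EB: "?E \<inter> B = {\<zero>\<^bsub>I\<^esub>}"
  proof (rule ccontr)
    assume "?E \<inter> B \<noteq> {\<zero>\<^bsub>I\<^esub>}"
    then obtain x where x: "x \<in> carrier I" "e x \<in> B" "e x \<noteq> \<zero>\<^bsub>I\<^esub>"
      using submodule_zero_mem[OF I.submodule_Int[OF E B(1)]] by blast
    let ?C = "{x \<in> carrier I. e x \<in> B}"
    have C: "submodule ?C A I" by (rule e.vimage_submodule[OF B(1)])
    have "B \<subseteq> ?C" using e_B Bc submodule_zero_mem[OF B(1)] by auto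
    moreover have "x \<in> ?C" "x \<notin> B" using x e_B by auto
    ultimately have "?C \<inter> K \<noteq> {\<zero>\<^bsub>I\<^esub>}" using B_max[OF C] by blast
    then obtain k where "k \<in> K" "e k \<in> B" "k \<noteq> \<zero>\<^bsub>I\<^esub>"
      using submodule_zero_mem[OF I.submodule_Int[OF C K]] by blast
    then show False using e_K B(3) by auto
  qed
  have eE: "e \<in> mod_hom A (I\<lparr>carrier := ?E\<rparr>) (I\<lparr>carrier := ?E\<rparr>)"
    using mod_hom_sub_domain[OF e(1) submodule_subset[OF E]] submodule_subset[OF E]
    by (intro mod_hom_sub_codomain) auto
  interpret E: left_module A "I\<lparr>carrier := ?E\<rparr>" by (rule I.left_module_sub[OF E])
  have "inj_on e (carrier (I\<lparr>carrier := ?E\<rparr>))"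
    using EB ker_e submodule_subset[OF E] module_hom.inj_on_iff[OF module_homI[OF E.left_module_axioms E.left_module_axioms eE]]
    by auto
  then have surjE: "e ` ?E = ?E"
    using E.endo_inj_imp_surj[OF I.fin_length_sub[OF fl E] eE] by simp
  have "x \<in> B <+>\<^bsub>I\<^esub> ?E" if x: "x \<in> carrier I" for x
  proof -
    have "e x \<in> e ` ?E" using surjE x by blast
    then obtain y where y: "y \<in> ?E" "e x = e y" by blast
    have yc: "y \<in> carrier I" using y submodule_subset[OF E] by blast
    then have "x \<ominus>\<^bsub>I\<^esub> y \<in> ?k" using x y(2) e.eq_iff_minus_kernel[OF x yc] by simp
    then have "x \<ominus>\<^bsub>I\<^esub> y \<in> B" using ker_e by simp
    then show ?thesis unfolding set_add_iff using y(1) I.minus_add_cancel[OF x yc] by metis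
  qed
  then have "B <+>\<^bsub>I\<^esub> ?E = carrier I" using submodule_subset[OF I.submodule_set_add[OF B(1) E]] by blast
  then have "B = {\<zero>\<^bsub>I\<^esub>} \<or> ?E = {\<zero>\<^bsub>I\<^esub>}"
    using ind B(1) E EB unfolding indecomposable_def by (simp add: Int_commute)
  then show False
  proof
    assume "B = {\<zero>\<^bsub>I\<^esub>}"
    then show False using neg B(2) submodule_zero_mem[OF H] by blast
  next
    assume "?E = {\<zero>\<^bsub>I\<^esub>}"
    then have "K \<subseteq> {\<zero>\<^bsub>I\<^esub>}" using e_K Kc by force
    then show False using neg submodule_zero_mem[OF K] by blast
  qed
qed

text \<open>A minimal nonzero submodule meets every nonzero one and so lies in it; any nonzero
  \<open>t\<close> in it will do.\<close>

lemma injective_indecomposable_socle: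
  assumes inj: "injective_fg A I" and ind: "indecomposable A I"
  shows "\<exists>t\<in>carrier I. t \<noteq> \<zero>\<^bsub>I\<^esub> \<and> (\<forall>H. submodule H A I \<and> H \<noteq> {\<zero>\<^bsub>I\<^esub>} \<longrightarrow> t \<in> H)"
proof -
  have fg: "fg_module A I" using inj by (simp add: injective_fg_def)
  interpret I: left_module A I by (rule fg_left_module[OF fg])
  have "carrier I \<noteq> {\<zero>\<^bsub>I\<^esub>}" using ind by (simp add: indecomposable_def)
  then have "\<exists>T. submodule T A I \<and> T \<noteq> {\<zero>\<^bsub>I\<^esub>} \<and> (\<forall>K. submodule K A I \<and> K \<noteq> {\<zero>\<^bsub>I\<^esub>} \<and> K \<subseteq> T \<longrightarrow> K = T)"
    by (rule I.fin_length_minimal[OF fg_fin_length[OF fg] I.submodule_carrier])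
  then obtain T where "submodule T A I \<and> T \<noteq> {\<zero>\<^bsub>I\<^esub>} \<and> (\<forall>K. submodule K A I \<and> K \<noteq> {\<zero>\<^bsub>I\<^esub>} \<and> K \<subseteq> T \<longrightarrow> K = T)"
    by (rule exE)
  then have T: "submodule T A I" "T \<noteq> {\<zero>\<^bsub>I\<^esub>}" "\<And>K. submodule K A I \<Longrightarrow> K \<noteq> {\<zero>\<^bsub>I\<^esub>} \<Longrightarrow> K \<subseteq> T \<Longrightarrow> K = T"
    by simp_all
  obtain t where t: "t \<in> T" "t \<noteq> \<zero>\<^bsub>I\<^esub>" using T(2) submodule_zero_mem[OF T(1)] by blast
  have "t \<in> H" if H: "submodule H A I" "H \<noteq> {\<zero>\<^bsub>I\<^esub>}" for H
  proof -
    have "H \<inter> T \<noteq> {\<zero>\<^bsub>I\<^esub>}" using injective_indecomposable_uniform[OF inj ind H(1) T(1)] H(2) T(2) by blast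
    then have "H \<inter> T = T" using T(3)[OF I.submodule_Int[OF H(1) T(1)]] by blast
    then show ?thesis using t(1) by blast
  qed
  then show ?thesis using t submodule_subset[OF T(1)] by blast
qed

end

section \<open>Radical and socle series\<close>

text \<open>For submodules \<open>B \<subseteq> C\<close> of \<open>X\<close> this says that \<open>C/B\<close> is simple or zero.\<close>

definition simple_step ::
    "('a, 'c) ring_scheme \<Rightarrow> ('a, 'm, 'd) module_scheme \<Rightarrow> 'm set \<Rightarrow> 'm set \<Rightarrow> bool" where
  "simple_step A X B C \<longleftrightarrow> (\<forall>y\<in>C. y \<notin> B \<longrightarrow> (\<forall>x\<in>C. \<exists>a\<in>carrier A. x \<ominus>\<^bsub>X\<^esub> a \<odot>\<^bsub>X\<^esub> y \<in> B))"

text \<open>For a submodule \<open>B\<close> this is the preimage of the socle of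
  \<open>X/B\<close>, in the form valid over a ring of finite length; the socle series becomes its
  iteration.\<close>

definition rad_colon ::
    "('a, 'c) ring_scheme \<Rightarrow> ('a, 'm, 'd) module_scheme \<Rightarrow> 'm set \<Rightarrow> 'm set" where
  "rad_colon A X B = {x \<in> carrier X. \<forall>a\<in>jacobson_radical A. a \<odot>\<^bsub>X\<^esub> x \<in> B}"

lemma simple_stepD:
  assumes "simple_step A X B C" "y \<in> C" "y \<notin> B" "x \<in> C"
  shows "\<exists>a\<in>carrier A. x \<ominus>\<^bsub>X\<^esub> a \<odot>\<^bsub>X\<^esub> y \<in> B"
  using assms unfolding simple_step_def by simp

context left_module
begin

lemma mem_set_add_cyclic:
  assumes B: "submodule B R M" and y: "y \<in> carrier M" and x: "x \<in> B <+>\<^bsub>M\<^esub> (\<lambda>a. a \<odot>\<^bsub>M\<^esub> y) ` carrier R"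
  shows "\<exists>a\<in>carrier R. x \<ominus>\<^bsub>M\<^esub> a \<odot>\<^bsub>M\<^esub> y \<in> B"
proof -
  obtain b a where ba: "b \<in> B" "a \<in> carrier R" "x = b \<oplus>\<^bsub>M\<^esub> a \<odot>\<^bsub>M\<^esub> y" using x unfolding set_add_iff by blast
  then have "x \<ominus>\<^bsub>M\<^esub> a \<odot>\<^bsub>M\<^esub> y = b" using submodule_subset[OF B] y by (auto simp: add_minus_cancel smult_closed)
  then show ?thesis using ba by (intro bexI[of _ a]) simp_all
qed

lemma mem_of_minus_mem:
  assumes B: "submodule B R M" and "x \<in> carrier M" "y \<in> B" "x \<ominus>\<^bsub>M\<^esub> y \<in> B"
  shows "x \<in> B"
  using submodule_add_mem[OF B assms(4,3)] minus_add_cancel[of x y] assms(2,3) submodule_subset[OF B] by auto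

lemma simple_stepI:
  assumes B: "submodule B R M" and C: "submodule C R M" and BC: "B \<subseteq> C"
    and max: "\<And>K. submodule K R M \<Longrightarrow> B \<subseteq> K \<Longrightarrow> K \<subseteq> C \<Longrightarrow> K \<noteq> B \<Longrightarrow> K = C"
  shows "simple_step R M B C"
  unfolding simple_step_def
proof (intro ballI impI)
  fix y x assume y: "y \<in> C" "y \<notin> B" and x: "x \<in> C"
  let ?K = "(\<lambda>a. a \<odot>\<^bsub>M\<^esub> y) ` carrier R"
  have yc: "y \<in> carrier M" using y submodule_subset[OF C] by blast
  have K: "submodule ?K R M" by (rule submodule_cyclic[OF yc])
  have "B <+>\<^bsub>M\<^esub> ?K = C"
  proof (rule max[OF submodule_set_add[OF B K] set_add_upper1[OF B K]])
    show "B <+>\<^bsub>M\<^esub> ?K \<subseteq> C" by (rule set_add_least[OF C BC cyclic_least[OF C y(1)]])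
    show "B <+>\<^bsub>M\<^esub> ?K \<noteq> B" using set_add_upper2[OF B K] cyclic_self[OF yc] y(2) by blast
  qed
  then show "\<exists>a\<in>carrier R. x \<ominus>\<^bsub>M\<^esub> a \<odot>\<^bsub>M\<^esub> y \<in> B" using mem_set_add_cyclic[OF B yc] x by blast
qed

text \<open>All elements are multiples of \<open>w\<close> modulo \<open>B\<close>, so it is enough
  to recover \<open>w\<close> from each of its multiples outside \<open>B\<close>.\<close>

lemma simple_step_cyclic:
  assumes B: "submodule B R M" and w: "w \<in> carrier M"
    and inv: "\<And>d. d \<in> carrier R \<Longrightarrow> d \<odot>\<^bsub>M\<^esub> w \<notin> B \<Longrightarrow> \<exists>e\<in>carrier R. w \<ominus>\<^bsub>M\<^esub> e \<odot>\<^bsub>M\<^esub> (d \<odot>\<^bsub>M\<^esub> w) \<in> B"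
  shows "simple_step R M B (B <+>\<^bsub>M\<^esub> (\<lambda>a. a \<odot>\<^bsub>M\<^esub> w) ` carrier R)"
  unfolding simple_step_def
proof (intro ballI impI)
  let ?C = "B <+>\<^bsub>M\<^esub> (\<lambda>a. a \<odot>\<^bsub>M\<^esub> w) ` carrier R"
  fix z x assume z: "z \<in> ?C" "z \<notin> B" and x: "x \<in> ?C"
  have "?C \<subseteq> carrier M" by (rule submodule_subset[OF submodule_set_add[OF B submodule_cyclic[OF w]]])
  then have c: "z \<in> carrier M" "x \<in> carrier M" using z x by auto
  interpret p: module_hom R M "quot_mod M B" "\<lambda>x. B +>\<^bsub>M\<^esub> x" by (rule quot_proj_module_hom[OF B])
  obtain d where d: "d \<in> carrier R" "z \<ominus>\<^bsub>M\<^esub> d \<odot>\<^bsub>M\<^esub> w \<in> B" using mem_set_add_cyclic[OF B w z(1)] by blast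
  obtain d' where d': "d' \<in> carrier R" "x \<ominus>\<^bsub>M\<^esub> d' \<odot>\<^bsub>M\<^esub> w \<in> B" using mem_set_add_cyclic[OF B w x] by blast
  have "d \<odot>\<^bsub>M\<^esub> w \<notin> B" using mem_of_minus_mem[OF B c(1) _ d(2)] z(2) by blast
  then obtain e where e: "e \<in> carrier R" "w \<ominus>\<^bsub>M\<^esub> e \<odot>\<^bsub>M\<^esub> (d \<odot>\<^bsub>M\<^esub> w) \<in> B" using inv d(1) by blast
  have eqs: "B +>\<^bsub>M\<^esub> x = B +>\<^bsub>M\<^esub> (d' \<odot>\<^bsub>M\<^esub> w)" "B +>\<^bsub>M\<^esub> z = B +>\<^bsub>M\<^esub> (d \<odot>\<^bsub>M\<^esub> w)"
      "B +>\<^bsub>M\<^esub> w = B +>\<^bsub>M\<^esub> (e \<odot>\<^bsub>M\<^esub> (d \<odot>\<^bsub>M\<^esub> w))"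
    using coset_eq_iff[OF B] d d' e c w by (simp_all add: smult_closed)
  have "B +>\<^bsub>M\<^esub> x = d' \<odot>\<^bsub>quot_mod M B\<^esub> (B +>\<^bsub>M\<^esub> (e \<odot>\<^bsub>M\<^esub> (d \<odot>\<^bsub>M\<^esub> w)))"
    unfolding eqs(1) eqs(3)[symmetric] by (rule p.smult[OF d'(1) w])
  also have "\<dots> = d' \<odot>\<^bsub>quot_mod M B\<^esub> (B +>\<^bsub>M\<^esub> (e \<odot>\<^bsub>M\<^esub> z))"
    using p.smult[OF e(1) c(1)] p.smult[OF e(1), of "d \<odot>\<^bsub>M\<^esub> w"] d(1) w eqs(2) by (simp add: smult_closed)
  also have "\<dots> = B +>\<^bsub>M\<^esub> ((d' \<otimes>\<^bsub>R\<^esub> e) \<odot>\<^bsub>M\<^esub> z)"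
    using p.smult[OF d'(1), of "e \<odot>\<^bsub>M\<^esub> z"] d'(1) e(1) c(1) by (simp add: smult_closed smult_assoc1)
  finally have "B +>\<^bsub>M\<^esub> x = B +>\<^bsub>M\<^esub> ((d' \<otimes>\<^bsub>R\<^esub> e) \<odot>\<^bsub>M\<^esub> z)" .
  then have "x \<ominus>\<^bsub>M\<^esub> (d' \<otimes>\<^bsub>R\<^esub> e) \<odot>\<^bsub>M\<^esub> z \<in> B" using coset_eq_iff[OF B] c d'(1) e(1) by (simp add: smult_closed)
  then show "\<exists>a\<in>carrier R. x \<ominus>\<^bsub>M\<^esub> a \<odot>\<^bsub>M\<^esub> z \<in> B" using d'(1) e(1) by blast
qed

text \<open>For \<open>x\<close> outside \<open>B\<close> the \<open>c\<close> with
  \<open>c x \<in> B\<close> form a maximal left ideal: a larger one contains some \<open>k\<close>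
  such that \<open>x\<close> is a multiple of \<open>k x\<close> modulo \<open>B\<close>.\<close>

lemma rad_kills_simple_step:
  assumes B: "submodule B R M" and C: "submodule C R M" and step: "simple_step R M B C"
    and a: "a \<in> jacobson_radical R" and x: "x \<in> C"
  shows "a \<odot>\<^bsub>M\<^esub> x \<in> B"
proof (cases "x \<in> B")
  case True
  then show ?thesis using submodule_smult_mem[OF B] a by (auto simp: jacobson_radical_def)
next
  case False
  have xc: "x \<in> carrier M" using x submodule_subset[OF C] by blast
  interpret A: left_module R "regular_module R" by (rule R.left_module_regular)
  have hom: "module_hom R (regular_module R) M (\<lambda>a. a \<odot>\<^bsub>M\<^esub> x)"
    using xc by (intro module_homI A.left_module_axioms left_module_axioms mod_homI)
      (auto simp: smult_closed smult_l_distr smult_assoc1)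
  let ?m = "{c \<in> carrier R. c \<odot>\<^bsub>M\<^esub> x \<in> B}"
  have m: "submodule ?m R (regular_module R)"
    using module_hom.vimage_submodule[OF hom B] by simp
  have one: "\<one>\<^bsub>R\<^esub> \<notin> ?m" using False xc by (simp add: smult_one)
  have "K = carrier R" if K: "submodule K R (regular_module R)" "?m \<subseteq> K" "K \<noteq> ?m" for K
  proof -
    note Kc = submodule_subset[OF K(1), simplified, THEN subsetD]
    obtain k where k: "k \<in> K" "k \<notin> ?m" using K(2,3) by blast
    note kc = Kc[OF k(1)]
    have "k \<odot>\<^bsub>M\<^esub> x \<in> C" "k \<odot>\<^bsub>M\<^esub> x \<notin> B" using k kc submodule_smult_mem[OF C kc x] by auto
    then obtain c where c: "c \<in> carrier R" "x \<ominus>\<^bsub>M\<^esub> c \<odot>\<^bsub>M\<^esub> (k \<odot>\<^bsub>M\<^esub> x) \<in> B" using simple_stepD[OF step _ _ x] by blast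
    have "(\<one>\<^bsub>R\<^esub> \<ominus>\<^bsub>R\<^esub> c \<otimes>\<^bsub>R\<^esub> k) \<odot>\<^bsub>M\<^esub> x = x \<ominus>\<^bsub>M\<^esub> c \<odot>\<^bsub>M\<^esub> (k \<odot>\<^bsub>M\<^esub> x)"
      using c(1) kc xc
      by (simp add: a_minus_def smult_l_distr smult_uminus_left smult_assoc1 smult_one smult_closed)
    then have "\<one>\<^bsub>R\<^esub> \<ominus>\<^bsub>R\<^esub> c \<otimes>\<^bsub>R\<^esub> k \<in> K" using c kc K(2) by auto
    moreover have "c \<otimes>\<^bsub>R\<^esub> k \<in> K" using submodule_smult_mem[OF K(1) c(1) k(1)] by simp
    ultimately have "(\<one>\<^bsub>R\<^esub> \<ominus>\<^bsub>R\<^esub> c \<otimes>\<^bsub>R\<^esub> k) \<oplus>\<^bsub>R\<^esub> c \<otimes>\<^bsub>R\<^esub> k \<in> K" using submodule_add_mem[OF K(1)] by simp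
    then have "\<one>\<^bsub>R\<^esub> \<in> K" using c kc by (simp add: a_minus_def R.a_assoc R.l_neg)
    then have "r \<in> K" if "r \<in> carrier R" for r using submodule_smult_mem[OF K(1) that] that by fastforce
    then show ?thesis using Kc by blast
  qed
  then have "maximal_left_ideal R ?m"
    unfolding maximal_left_ideal_def using m one by auto
  then have "a \<in> ?m" using a unfolding jacobson_radical_def by blast
  then show ?thesis by simp
qed

end

context ring
begin

lemma maximal_left_ideal_simple_step:
  assumes "maximal_left_ideal R m"
  shows "simple_step R (regular_module R) m (carrier R)"
proof -
  interpret A: left_module R "regular_module R" by (rule left_module_regular)
  have m: "submodule m R (regular_module R)" "m \<noteq> carrier R"
    "\<And>K. submodule K R (regular_module R) \<Longrightarrow> m \<subseteq> K \<Longrightarrow> K = m \<or> K = carrier R"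
    using assms by (auto simp: maximal_left_ideal_def)
  show ?thesis
    by (rule A.simple_stepI[OF m(1) A.submodule_carrier, simplified])
      (use m submodule_subset[OF m(1)] in auto)
qed

lemma jacobson_closed: "a \<in> jacobson_radical R \<Longrightarrow> a \<in> carrier R"
  by (simp add: jacobson_radical_def)

text \<open>The radical is defined by left ideals. It is closed under right multiplication because
  it annihilates each simple module \<open>R/m\<close>, in particular the class of
  \<open>b\<close>.\<close>

lemma jacobson_mult_right:
  assumes "a \<in> jacobson_radical R" "b \<in> carrier R"
  shows "a \<otimes> b \<in> jacobson_radical R"
proof -
  interpret A: left_module R "regular_module R" by (rule left_module_regular)
  have "a \<otimes> b \<in> m" if "maximal_left_ideal R m" for m
    using A.rad_kills_simple_step[OF _ A.submodule_carrier _ assms(1), of m b]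
      maximal_left_ideal_simple_step[OF that] that assms(2)
    by (simp add: maximal_left_ideal_def)
  then show ?thesis using assms jacobson_closed by (auto simp: jacobson_radical_def)
qed

end

section \<open>Powers of the radical, layers of the socle, and semisimplicity\<close>

context left_module
begin

lemma rad_colon_submodule:
  assumes B: "submodule B R M"
  shows "submodule (rad_colon R M B) R M"
proof (rule submoduleI)
  show "b \<odot>\<^bsub>M\<^esub> x \<in> rad_colon R M B" if "b \<in> carrier R" "x \<in> rad_colon R M B" for b x
    using that R.jacobson_mult_right R.jacobson_closed
    by (auto simp: rad_colon_def smult_closed smult_assoc1[symmetric])
qed (use R.jacobson_closed submoduleD[OF B] in \<open>auto simp: rad_colon_def smult_zero_right smult_r_distr\<close>)

lemma rad_pow_submodule: "submodule (rad_pow R M i) R M"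
proof (induction i)
  case 0
  then show ?case using submodule_carrier by simp
next
  case (Suc i)
  have "{a \<odot>\<^bsub>M\<^esub> x | a x. a \<in> jacobson_radical R \<and> x \<in> rad_pow R M i} \<subseteq> carrier M"
    using R.jacobson_closed submodule_subset[OF Suc] by (auto intro: smult_closed)
  then show ?case using submodule_gen_submodule by simp
qed

lemma rad_pow_Suc_mem:
  assumes "a \<in> jacobson_radical R" "x \<in> rad_pow R M i"
  shows "a \<odot>\<^bsub>M\<^esub> x \<in> rad_pow R M (Suc i)"
proof -
  have "a \<odot>\<^bsub>M\<^esub> x \<in> {a \<odot>\<^bsub>M\<^esub> x | a x. a \<in> jacobson_radical R \<and> x \<in> rad_pow R M i}" using assms by blast
  then show ?thesis using submodule_gen_upper by fastforce
qed

lemma rad_pow_Suc_least: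
  assumes "submodule B R M" "\<And>a x. a \<in> jacobson_radical R \<Longrightarrow> x \<in> rad_pow R M i \<Longrightarrow> a \<odot>\<^bsub>M\<^esub> x \<in> B"
  shows "rad_pow R M (Suc i) \<subseteq> B"
  unfolding rad_pow.simps by (rule submodule_gen_least[OF assms(1)]) (use assms(2) in blast)

lemma rad_pow_Suc_subset: "rad_pow R M (Suc i) \<subseteq> rad_pow R M i"
  by (rule rad_pow_Suc_least[OF rad_pow_submodule])
    (use R.jacobson_closed submodule_smult_mem[OF rad_pow_submodule] in blast)

text \<open>This takes the place of Nakayama's lemma: a proper submodule of \<open>C\<close> stays
  proper after \<open>J C\<close> is added.\<close>

lemma exists_maximal_below:
  assumes fl: "fin_length R M" and B: "submodule B R M" and C: "submodule C R M" and BC: "B \<subset> C"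
  shows "\<exists>K. submodule K R M \<and> B \<subseteq> K \<and> K \<subset> C \<and> (\<forall>a\<in>jacobson_radical R. \<forall>x\<in>C. a \<odot>\<^bsub>M\<^esub> x \<in> K)"
proof -
  have "\<exists>K. submodule K R M \<and> (B \<subseteq> K \<and> K \<subset> C) \<and> (\<forall>K'. submodule K' R M \<and> (B \<subseteq> K' \<and> K' \<subset> C) \<and> K \<subseteq> K' \<longrightarrow> K' = K)"
    by (rule fin_length_maximal[OF fl B]) (use BC in blast)
  then obtain K where "submodule K R M \<and> (B \<subseteq> K \<and> K \<subset> C) \<and> (\<forall>K'. submodule K' R M \<and> (B \<subseteq> K' \<and> K' \<subset> C) \<and> K \<subseteq> K' \<longrightarrow> K' = K)"
    by (rule exE)
  then have K: "submodule K R M" "B \<subseteq> K" "K \<subset> C"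
    and max: "\<And>K'. submodule K' R M \<Longrightarrow> B \<subseteq> K' \<and> K' \<subset> C \<Longrightarrow> K \<subseteq> K' \<Longrightarrow> K' = K" by simp_all
  have KC: "K \<subseteq> C" using K(3) by blast
  have "simple_step R M K C"
  proof (rule simple_stepI[OF K(1) C KC])
    show "K' = C" if K': "submodule K' R M" "K \<subseteq> K'" "K' \<subseteq> C" "K' \<noteq> K" for K'
      using max[OF K'(1) _ K'(2)] K'(2-4) K(2) by blast
  qed
  then show ?thesis using K rad_kills_simple_step[OF K(1) C] by blast
qed

text \<open>Dual to \<open>exists_maximal_below\<close>: a nonzero submodule of \<open>M/B\<close>
  contains a simple one, and \<open>J\<close> kills it.\<close>

lemma exists_minimal_above:
  assumes fl: "fin_length R M" and B: "submodule B R M" and C: "submodule C R M" and BC: "B \<subset> C"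
  shows "\<exists>K. submodule K R M \<and> B \<subset> K \<and> K \<subseteq> C \<and> (\<forall>a\<in>jacobson_radical R. \<forall>x\<in>K. a \<odot>\<^bsub>M\<^esub> x \<in> B)"
proof -
  have "\<exists>K. submodule K R M \<and> (B \<subset> K \<and> K \<subseteq> C) \<and> (\<forall>K'. submodule K' R M \<and> (B \<subset> K' \<and> K' \<subseteq> C) \<and> K' \<subseteq> K \<longrightarrow> K' = K)"
    by (rule fin_length_minimal[OF fl C]) (use BC in blast)
  then obtain K where "submodule K R M \<and> (B \<subset> K \<and> K \<subseteq> C) \<and> (\<forall>K'. submodule K' R M \<and> (B \<subset> K' \<and> K' \<subseteq> C) \<and> K' \<subseteq> K \<longrightarrow> K' = K)"
    by (rule exE)
  then have K: "submodule K R M" "B \<subset> K" "K \<subseteq> C"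
    and min: "\<And>K'. submodule K' R M \<Longrightarrow> B \<subset> K' \<and> K' \<subseteq> C \<Longrightarrow> K' \<subseteq> K \<Longrightarrow> K' = K" by simp_all
  have BK: "B \<subseteq> K" using K(2) by blast
  have "simple_step R M B K"
  proof (rule simple_stepI[OF B K(1) BK])
    show "K' = K" if K': "submodule K' R M" "B \<subseteq> K'" "K' \<subseteq> K" "K' \<noteq> B" for K'
      using min[OF K'(1) _ K'(3)] K'(2-4) K(3) by blast
  qed
  then show ?thesis using K rad_kills_simple_step[OF B K(1)] by blast
qed

text \<open>If the intersection of finitely many maximal left ideals \<open>m1, \<dots>, mk\<close> annihilates \<open>y\<close> modulo \<open>B\<close>,
  write \<open>1 = q + u\<close> with \<open>u \<in> mk\<close> and \<open>q \<in> m1 \<inter> \<dots> \<inter> m(k-1)\<close>; then \<open>q y\<close> generates a simple module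
  modulo \<open>B\<close> and \<open>u y\<close> is annihilated by \<open>m1 \<inter> \<dots> \<inter> m(k-1)\<close>.\<close>

lemma semisimple_of_finite_Inter:
  assumes F: "finite F" "\<And>m. m \<in> F \<Longrightarrow> maximal_left_ideal R m"
    and B: "submodule B R M" and C: "submodule C R M" and G: "submodule G R M" and BC: "B \<subseteq> C" and BG: "B \<subseteq> G"
    and simples: "\<And>K. submodule K R M \<Longrightarrow> B \<subseteq> K \<Longrightarrow> K \<subseteq> C \<Longrightarrow> simple_step R M B K \<Longrightarrow> K \<subseteq> G"
    and y: "y \<in> C" "\<And>a. a \<in> carrier R \<Longrightarrow> (\<And>m. m \<in> F \<Longrightarrow> a \<in> m) \<Longrightarrow> a \<odot>\<^bsub>M\<^esub> y \<in> B"
  shows "y \<in> G"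
  using F y
proof (induction F arbitrary: y rule: finite_induct)
  case empty
  then show ?case using BG submodule_subset[OF C] smult_one[of y] by (metis R.one_closed empty_iff subsetD)
next
  case (insert m F)
  have m: "maximal_left_ideal R m" and sm: "submodule m R (regular_module R)"
    using insert.prems(1)[of m] by (simp_all add: maximal_left_ideal_def)
  have smF: "submodule m' R (regular_module R)" if "m' \<in> F" for m'
    using insert.prems(1)[of m'] that by (simp add: maximal_left_ideal_def)
  note y = insert.prems(2,3)
  have yc: "y \<in> carrier M" using y(1) submodule_subset[OF C] by blast
  show ?case
  proof (cases "\<exists>q\<in>carrier R. (\<forall>m'\<in>F. q \<in> m') \<and> q \<notin> m")
    \<comment> \<open>\<open>m\<close> contains the intersection over \<open>F\<close>, so the
      condition on \<open>y\<close> already holds for \<open>F\<close>.\<close>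
    case False
    show ?thesis
    proof (rule insert.IH[OF _ y(1)])
      show "a \<odot>\<^bsub>M\<^esub> y \<in> B" if a: "a \<in> carrier R" "\<And>m'. m' \<in> F \<Longrightarrow> a \<in> m'" for a
      proof (rule y(2)[OF a(1)])
        have "a \<in> m" using False a by blast
        then show "a \<in> m'" if "m' \<in> insert m F" for m' using that a(2) by blast
      qed
    qed (use insert.prems(1) in blast)
  next
    case True
    then obtain q0 where q0: "q0 \<in> carrier R" "\<forall>m'\<in>F. q0 \<in> m'" "q0 \<notin> m" by blast
    have minus: "x \<ominus>\<^bsub>regular_module R\<^esub> y = x \<ominus>\<^bsub>R\<^esub> y" for x y by (simp add: a_minus_def a_inv_def m_inv_def)
    note stepm = simple_stepD[OF R.maximal_left_ideal_simple_step[OF m], simplified minus, simplified]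
    obtain c where c: "c \<in> carrier R" "\<one>\<^bsub>R\<^esub> \<ominus>\<^bsub>R\<^esub> c \<otimes>\<^bsub>R\<^esub> q0 \<in> m" using stepm[OF q0(1,3) R.one_closed] by blast
    define q where "q = c \<otimes>\<^bsub>R\<^esub> q0"
    define u where "u = \<one>\<^bsub>R\<^esub> \<ominus>\<^bsub>R\<^esub> q"
    have qc: "q \<in> carrier R" using c(1) q0(1) by (simp add: q_def)
    have u: "u \<in> m" using c(2) by (simp add: u_def q_def)
    have uc: "u \<in> carrier R" using qc by (simp add: u_def)
    have qF: "q \<in> m'" if "m' \<in> F" for m'
      unfolding q_def using submodule_smult_mem[OF smF[OF that] c(1)] q0(2) that by simp
    have one: "\<one>\<^bsub>R\<^esub> = q \<oplus>\<^bsub>R\<^esub> u" 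
    proof -
      have "u \<oplus>\<^bsub>R\<^esub> q = \<one>\<^bsub>R\<^esub>" using qc by (simp add: u_def a_minus_def R.a_assoc R.l_neg)
      then show ?thesis using R.a_comm[OF uc qc] by simp
    qed
    have au: "a \<otimes>\<^bsub>R\<^esub> u = a \<ominus>\<^bsub>R\<^esub> a \<otimes>\<^bsub>R\<^esub> q" "a \<otimes>\<^bsub>R\<^esub> q = a \<ominus>\<^bsub>R\<^esub> a \<otimes>\<^bsub>R\<^esub> u" if a: "a \<in> carrier R" for a
    proof -
      have "a = a \<otimes>\<^bsub>R\<^esub> (q \<oplus>\<^bsub>R\<^esub> u)" using a by (simp add: one[symmetric])
      also have "\<dots> = a \<otimes>\<^bsub>R\<^esub> q \<oplus>\<^bsub>R\<^esub> a \<otimes>\<^bsub>R\<^esub> u" using a qc uc by (simp add: R.r_distr)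
      finally have eq: "a = a \<otimes>\<^bsub>R\<^esub> q \<oplus>\<^bsub>R\<^esub> a \<otimes>\<^bsub>R\<^esub> u" .
      have cl: "a \<otimes>\<^bsub>R\<^esub> q \<in> carrier R" "a \<otimes>\<^bsub>R\<^esub> u \<in> carrier R" using a qc uc by auto
      interpret A: left_module R "regular_module R" by (rule R.left_module_regular)
      note cancel = A.add_minus_cancel[unfolded minus regular_module_simps, OF cl]
      show "a \<otimes>\<^bsub>R\<^esub> u = a \<ominus>\<^bsub>R\<^esub> a \<otimes>\<^bsub>R\<^esub> q" "a \<otimes>\<^bsub>R\<^esub> q = a \<ominus>\<^bsub>R\<^esub> a \<otimes>\<^bsub>R\<^esub> u"
        using cancel eq by metis+
    qed
    let ?w = "q \<odot>\<^bsub>M\<^esub> y"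
    have w: "?w \<in> C" by (rule submodule_smult_mem[OF C qc y(1)])
    have wc: "?w \<in> carrier M" using w submodule_subset[OF C] by blast
    \<comment> \<open>\<open>m\<close> is only a left ideal, so \<open>a q \<in> m\<close> for
      \<open>a \<in> m\<close> has to be read off from \<open>a q = a - a u\<close>.\<close>
    have killw: "a \<odot>\<^bsub>M\<^esub> ?w \<in> B" if "a \<in> m" for a
    proof -
      have a: "a \<in> carrier R" using that submodule_subset[OF sm] by auto
      have "a \<otimes>\<^bsub>R\<^esub> q \<in> m'" if "m' \<in> insert m F" for m'
      proof (cases "m' = m")
        case True
        have "a \<otimes>\<^bsub>R\<^esub> u \<in> m" using submodule_smult_mem[OF sm a u] by simp
        then show ?thesis using submodule_minus_mem[OF sm \<open>a \<in> m\<close>] au(2)[OF a] True minus by metis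
      next
        case False
        then show ?thesis using submodule_smult_mem[OF smF a] qF that by auto
      qed
      then have "(a \<otimes>\<^bsub>R\<^esub> q) \<odot>\<^bsub>M\<^esub> y \<in> B" using y(2) a qc by blast
      then show ?thesis using a qc yc by (simp add: smult_assoc1)
    qed
    let ?K = "B <+>\<^bsub>M\<^esub> (\<lambda>a. a \<odot>\<^bsub>M\<^esub> ?w) ` carrier R"
    note K = submodule_cyclic[OF wc]
    have "simple_step R M B ?K"
    proof (rule simple_step_cyclic[OF B wc])
      fix d assume d: "d \<in> carrier R" "d \<odot>\<^bsub>M\<^esub> ?w \<notin> B"
      then have "d \<notin> m" using killw by blast
      then obtain e where e: "e \<in> carrier R" "\<one>\<^bsub>R\<^esub> \<ominus>\<^bsub>R\<^esub> e \<otimes>\<^bsub>R\<^esub> d \<in> m" using stepm[OF d(1) _ R.one_closed] by blast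
      have "(\<one>\<^bsub>R\<^esub> \<ominus>\<^bsub>R\<^esub> e \<otimes>\<^bsub>R\<^esub> d) \<odot>\<^bsub>M\<^esub> ?w = ?w \<ominus>\<^bsub>M\<^esub> e \<odot>\<^bsub>M\<^esub> (d \<odot>\<^bsub>M\<^esub> ?w)"
        using d(1) e(1) wc
        by (simp add: a_minus_def smult_l_distr smult_uminus_left smult_assoc1 smult_one smult_closed)
      then show "\<exists>e\<in>carrier R. ?w \<ominus>\<^bsub>M\<^esub> e \<odot>\<^bsub>M\<^esub> (d \<odot>\<^bsub>M\<^esub> ?w) \<in> B" using killw[OF e(2)] e(1) by auto
    qed
    then have "?K \<subseteq> G"
      by (intro simples submodule_set_add[OF B K] set_add_upper1[OF B K] set_add_least[OF C BC cyclic_least[OF C w]])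
    then have qG: "?w \<in> G" using set_add_upper2[OF B K] cyclic_self[OF wc] by blast
    have "u \<odot>\<^bsub>M\<^esub> y \<in> G"
    proof (rule insert.IH)
      show "u \<odot>\<^bsub>M\<^esub> y \<in> C" by (rule submodule_smult_mem[OF C uc y(1)])
      show "a \<odot>\<^bsub>M\<^esub> (u \<odot>\<^bsub>M\<^esub> y) \<in> B" if a: "a \<in> carrier R" "\<And>m'. m' \<in> F \<Longrightarrow> a \<in> m'" for a
      proof -
        have "a \<otimes>\<^bsub>R\<^esub> u \<in> m'" if m': "m' \<in> insert m F" for m'
        proof (cases "m' = m")
          case True
          then show ?thesis using submodule_smult_mem[OF sm a(1) u] by simp
        next
          case False
          then have F': "m' \<in> F" using m' by blast
          have "a \<otimes>\<^bsub>R\<^esub> q \<in> m'" using submodule_smult_mem[OF smF[OF F'] a(1) qF[OF F']] by simp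
          then show ?thesis using submodule_minus_mem[OF smF[OF F'] a(2)[OF F']] au(1)[OF a(1)] minus by metis
        qed
        then have "(a \<otimes>\<^bsub>R\<^esub> u) \<odot>\<^bsub>M\<^esub> y \<in> B" using y(2) a(1) uc by blast
        then show ?thesis using a(1) uc yc by (simp add: smult_assoc1)
      qed
    qed (use insert.prems(1) in blast)
    then have "?w \<oplus>\<^bsub>M\<^esub> u \<odot>\<^bsub>M\<^esub> y \<in> G" using submodule_add_mem[OF G qG] by blast
    moreover have "?w \<oplus>\<^bsub>M\<^esub> u \<odot>\<^bsub>M\<^esub> y = y"
      using smult_l_distr[OF qc uc yc] smult_one[OF yc] by (simp add: one[symmetric])
    ultimately show ?thesis by simp
  qed
qed

text \<open>With finite length \<open>J\<close> is a finite intersection of maximal left ideals: a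
  minimal finite intersection is contained in each of them. The target \<open>G\<close> stands for a
  sum of simple submodules modulo \<open>B\<close>, so that no infinite sums are formed.\<close>

lemma rad_colon_generated:
  assumes fl: "fin_length R (regular_module R)"
    and B: "submodule B R M" and C: "submodule C R M" and G: "submodule G R M" and BC: "B \<subseteq> C" and BG: "B \<subseteq> G"
    and simples: "\<And>K. submodule K R M \<Longrightarrow> B \<subseteq> K \<Longrightarrow> K \<subseteq> C \<Longrightarrow> simple_step R M B K \<Longrightarrow> K \<subseteq> G"
    and y: "y \<in> C" "y \<in> rad_colon R M B"
  shows "y \<in> G"
proof -
  interpret A: left_module R "regular_module R" by (rule R.left_module_regular)
  let ?Q = "\<lambda>H. \<exists>F. finite F \<and> (\<forall>m\<in>F. maximal_left_ideal R m) \<and> H = carrier R \<inter> \<Inter>F"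
  have "?Q (carrier (regular_module R))" by (rule exI[of _ "{}"]) simp
  then have "\<exists>H. submodule H R (regular_module R) \<and> ?Q H \<and>
      (\<forall>K. submodule K R (regular_module R) \<and> ?Q K \<and> K \<subseteq> H \<longrightarrow> K = H)"
    by (rule A.fin_length_minimal[OF fl A.submodule_carrier])
  then obtain H where "submodule H R (regular_module R) \<and> ?Q H \<and>
      (\<forall>K. submodule K R (regular_module R) \<and> ?Q K \<and> K \<subseteq> H \<longrightarrow> K = H)" by (rule exE)
  then have H: "submodule H R (regular_module R)" "?Q H"
    and min: "\<And>K. submodule K R (regular_module R) \<Longrightarrow> ?Q K \<Longrightarrow> K \<subseteq> H \<Longrightarrow> K = H" by simp_all
  obtain F where F: "finite F" "\<forall>m\<in>F. maximal_left_ideal R m" "H = carrier R \<inter> \<Inter>F" using H(2) by blast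
  have "H \<subseteq> m" if m: "maximal_left_ideal R m" for m
  proof -
    have "H \<inter> m = H"
    proof (rule min)
      show "submodule (H \<inter> m) R (regular_module R)"
        using m by (intro A.submodule_Int H(1)) (simp add: maximal_left_ideal_def)
      show "?Q (H \<inter> m)" using F m by (intro exI[of _ "insert m F"]) auto
    qed blast
    then show ?thesis by blast
  qed
  then have HJ: "H \<subseteq> jacobson_radical R" using F(3) unfolding jacobson_radical_def by blast
  show ?thesis
  proof (rule semisimple_of_finite_Inter[OF F(1) _ B C G BC BG simples y(1)])
    show "a \<odot>\<^bsub>M\<^esub> y \<in> B" if "a \<in> carrier R" "\<And>m. m \<in> F \<Longrightarrow> a \<in> m" for a
    proof -
      have "a \<in> H" using that F(3) by blast
      then show ?thesis using HJ y(2) by (auto simp: rad_colon_def)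
    qed
  qed (use F(2) in blast)+
qed

lemma simple_submodule_iff:
  "simple_submodule R M S \<longleftrightarrow> submodule S R M \<and> S \<noteq> {\<zero>\<^bsub>M\<^esub>} \<and> simple_step R M {\<zero>\<^bsub>M\<^esub>} S"
proof (intro iffI)
  assume S: "simple_submodule R M S"
  then have sm: "submodule S R M" by (simp add: simple_submodule_def)
  have "simple_step R M {\<zero>\<^bsub>M\<^esub>} S"
    by (rule simple_stepI[OF submodule_zero sm])
      (use S submodule_zero_mem[OF sm] in \<open>auto simp: simple_submodule_def\<close>)
  then show "submodule S R M \<and> S \<noteq> {\<zero>\<^bsub>M\<^esub>} \<and> simple_step R M {\<zero>\<^bsub>M\<^esub>} S"
    using S by (simp add: simple_submodule_def)
next
  assume S: "submodule S R M \<and> S \<noteq> {\<zero>\<^bsub>M\<^esub>} \<and> simple_step R M {\<zero>\<^bsub>M\<^esub>} S"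
  have "H = S" if H: "submodule H R M" "H \<subseteq> S" "H \<noteq> {\<zero>\<^bsub>M\<^esub>}" for H
  proof -
    obtain y where y: "y \<in> H" "y \<noteq> \<zero>\<^bsub>M\<^esub>" using H(3) submodule_zero_mem[OF H(1)] by blast
    have "x \<in> H" if x: "x \<in> S" for x
    proof -
      obtain a where a: "a \<in> carrier R" "x \<ominus>\<^bsub>M\<^esub> a \<odot>\<^bsub>M\<^esub> y = \<zero>\<^bsub>M\<^esub>"
        using simple_stepD[of R M "{\<zero>\<^bsub>M\<^esub>}" S y x] S y H(2) x by blast
      have "a \<odot>\<^bsub>M\<^esub> y \<in> H" by (rule submodule_smult_mem[OF H(1) a(1) y(1)])
      moreover have "x \<in> carrier M" using x S submodule_subset[of S R M] by blast
      ultimately show ?thesis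
        using mem_of_minus_mem[OF H(1), of x "a \<odot>\<^bsub>M\<^esub> y"] a(2) submodule_zero_mem[OF H(1)] by simp
    qed
    then show ?thesis using H(2) by blast
  qed
  then show "simple_submodule R M S" using S unfolding simple_submodule_def by blast
qed

text \<open>One inclusion is that \<open>J\<close> kills simple modules; the other is the
  semisimplicity of modules killed by \<open>J\<close>, in the form of
  \<open>rad_colon_generated\<close>.\<close>

lemma socle_eq_rad_colon:
  assumes fl: "fin_length R (regular_module R)"
  shows "socle R M = rad_colon R M {\<zero>\<^bsub>M\<^esub>}"
proof
  have sub: "\<Union>{S. simple_submodule R M S} \<subseteq> carrier M"
    using submodule_subset by (auto simp: simple_submodule_iff)
  have S: "submodule (socle R M) R M" unfolding socle_def by (rule submodule_gen_submodule[OF sub])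
  show "socle R M \<subseteq> rad_colon R M {\<zero>\<^bsub>M\<^esub>}"
    unfolding socle_def
  proof (rule submodule_gen_least[OF rad_colon_submodule[OF submodule_zero]])
    show "\<Union>{S. simple_submodule R M S} \<subseteq> rad_colon R M {\<zero>\<^bsub>M\<^esub>}"
      using sub rad_kills_simple_step[OF submodule_zero] by (auto simp: simple_submodule_iff rad_colon_def)
  qed
  show "rad_colon R M {\<zero>\<^bsub>M\<^esub>} \<subseteq> socle R M"
  proof
    fix y assume y: "y \<in> rad_colon R M {\<zero>\<^bsub>M\<^esub>}"
    show "y \<in> socle R M"
    proof (rule rad_colon_generated[OF fl submodule_zero submodule_carrier S _ _ _ _ y])
      show "K \<subseteq> socle R M" if "submodule K R M" "simple_step R M {\<zero>\<^bsub>M\<^esub>} K" for K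
      proof (cases "K = {\<zero>\<^bsub>M\<^esub>}")
        case False
        then have "simple_submodule R M K" using that by (simp add: simple_submodule_iff)
        then show ?thesis unfolding socle_def using submodule_gen_upper[of "\<Union>{S. simple_submodule R M S}"] by blast
      qed (use submodule_zero_mem[OF S] in blast)
    qed (use y submodule_zero_mem[OF S] in \<open>auto simp: rad_colon_def\<close>)
  qed
qed

text \<open>\<open>C/B\<close> is killed by \<open>J\<close>, hence generated by its simple
  submodules. One of these outside \<open>G = B + R y\<close> would contain \<open>y\<close> by
  comparability, would then be generated by \<open>y\<close> modulo \<open>B\<close>, and would lie
  in \<open>G\<close> after all; thus \<open>C = G\<close>.\<close>

lemma uniserial_simple_step:
  assumes fl: "fin_length R (regular_module R)"
    and B: "submodule B R M" and C: "submodule C R M" and BC: "B \<subseteq> C"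
    and rad: "\<And>a x. a \<in> jacobson_radical R \<Longrightarrow> x \<in> C \<Longrightarrow> a \<odot>\<^bsub>M\<^esub> x \<in> B"
    and comparable: "\<And>H K. submodule H R M \<Longrightarrow> submodule K R M \<Longrightarrow> B \<subseteq> H \<Longrightarrow> B \<subseteq> K \<Longrightarrow> H \<subseteq> C \<Longrightarrow> K \<subseteq> C
      \<Longrightarrow> H \<subseteq> K \<or> K \<subseteq> H"
  shows "simple_step R M B C"
  unfolding simple_step_def
proof (intro ballI impI)
  fix y x assume y: "y \<in> C" "y \<notin> B" and x: "x \<in> C"
  have yc: "y \<in> carrier M" using y submodule_subset[OF C] by blast
  let ?Y = "(\<lambda>a. a \<odot>\<^bsub>M\<^esub> y) ` carrier R" let ?G = "B <+>\<^bsub>M\<^esub> ?Y"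
  have Y: "submodule ?Y R M" by (rule submodule_cyclic[OF yc])
  note G = submodule_set_add[OF B Y] and BG = set_add_upper1[OF B Y]
  have GC: "?G \<subseteq> C" by (rule set_add_least[OF C BC cyclic_least[OF C y(1)]])
  have yG: "y \<in> ?G" using set_add_upper2[OF B Y] cyclic_self[OF yc] by blast
  have "x \<in> ?G"
  proof (rule rad_colon_generated[OF fl B C G BC BG _ x])
    show "x \<in> rad_colon R M B" using x rad submodule_subset[OF C] by (auto simp: rad_colon_def)
    show "K \<subseteq> ?G" if K: "submodule K R M" "B \<subseteq> K" "K \<subseteq> C" "simple_step R M B K" for K
    proof (cases "K \<subseteq> ?G")
      case False
      then have yK: "y \<in> K" using comparable[OF G K(1) BG K(2) GC K(3)] yG by blast
      show ?thesis
      proof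
        fix z assume z: "z \<in> K"
        obtain a where a: "a \<in> carrier R" "z \<ominus>\<^bsub>M\<^esub> a \<odot>\<^bsub>M\<^esub> y \<in> B" using simple_stepD[OF K(4) yK y(2) z] by blast
        have "a \<odot>\<^bsub>M\<^esub> y \<in> ?G" by (rule submodule_smult_mem[OF G a(1) yG])
        then show "z \<in> ?G" using mem_of_minus_mem[OF G] a(2) BG z submodule_subset[OF K(1)] by blast
      qed
    qed
  qed
  then show "\<exists>a\<in>carrier R. x \<ominus>\<^bsub>M\<^esub> a \<odot>\<^bsub>M\<^esub> y \<in> B" by (rule mem_set_add_cyclic[OF B yc])
qed

text \<open>The two facts depend on each other: the formula for layer \<open>i + 1\<close>
  presupposes that layer \<open>i\<close> is a submodule, and then shows that layer
  \<open>i + 1\<close> is one.\<close>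

lemma soc_pow_facts:
  assumes fl: "fin_length R (regular_module R)"
  shows soc_pow_submodule: "submodule (soc_pow R M i) R M"
    and soc_pow_Suc: "soc_pow R M (Suc i) = rad_colon R M (soc_pow R M i)"
proof -
  have eq: "soc_pow R M (Suc i) = rad_colon R M (soc_pow R M i)" if B: "submodule (soc_pow R M i) R M" for i
  proof -
    let ?B = "soc_pow R M i"
    interpret q: left_module R "quot_mod M ?B" by (rule left_module_quot_mod[OF B])
    have "?B +>\<^bsub>M\<^esub> x \<in> socle R (quot_mod M ?B) \<longleftrightarrow> (\<forall>a\<in>jacobson_radical R. a \<odot>\<^bsub>M\<^esub> x \<in> ?B)"
      if x: "x \<in> carrier M" for x
    proof -
      have "a \<odot>\<^bsub>quot_mod M ?B\<^esub> (?B +>\<^bsub>M\<^esub> x) = ?B \<longleftrightarrow> a \<odot>\<^bsub>M\<^esub> x \<in> ?B" if "a \<in> jacobson_radical R" for a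
        using R.jacobson_closed[OF that] x
        by (simp add: quot_mod_smult[OF B] coset_eq_self_iff[OF B] smult_closed)
      then show ?thesis
        using x unfolding q.socle_eq_rad_colon[OF fl] by (simp add: rad_colon_def quot_carrier quot_zero)
    qed
    then show ?thesis unfolding soc_pow.simps(2) rad_colon_def by blast
  qed
  show sm: "submodule (soc_pow R M i) R M" for i
  proof (induction i)
    case 0
    then show ?case using submodule_zero by simp
  next
    case (Suc i)
    then show ?case using eq[OF Suc] rad_colon_submodule[OF Suc] by simp
  qed
  show "soc_pow R M (Suc i) = rad_colon R M (soc_pow R M i)" by (rule eq[OF sm])
qed

end

text \<open>A factor \<open>J\<close> on the side of \<open>X\<close> is traded for one socle layer
  on the side of \<open>Y\<close>, because \<open>f (a x) = a (f x)\<close> and layer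
  \<open>k + 1\<close> consists of what \<open>J\<close> carries into layer
  \<open>k\<close>.\<close>

lemma (in module_hom) rad_pow_soc_pow_shift:
  assumes fl: "fin_length A (regular_module A)"
  shows "(\<forall>x\<in>rad_pow A X (Suc i). f x \<in> soc_pow A Y k) \<longleftrightarrow> (\<forall>x\<in>rad_pow A X i. f x \<in> soc_pow A Y (Suc k))"
proof
  note S = Y.soc_pow_submodule[OF fl] and Suc = Y.soc_pow_Suc[OF fl]
  note sub = submodule_subset[OF X.rad_pow_submodule, THEN subsetD]
  assume h: "\<forall>x\<in>rad_pow A X (Suc i). f x \<in> soc_pow A Y k"
  show "\<forall>x\<in>rad_pow A X i. f x \<in> soc_pow A Y (Suc k)"
  proof
    fix x assume x: "x \<in> rad_pow A X i"
    have "a \<odot>\<^bsub>Y\<^esub> f x \<in> soc_pow A Y k" if a: "a \<in> jacobson_radical A" for a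
      using h X.rad_pow_Suc_mem[OF a x] X.R.jacobson_closed[OF a] sub[OF x] by (metis smult)
    then show "f x \<in> soc_pow A Y (Suc k)" unfolding Suc rad_colon_def using closed[OF sub[OF x]] by blast
  qed
next
  note S = Y.soc_pow_submodule[OF fl] and Suc = Y.soc_pow_Suc[OF fl]
  note sub = submodule_subset[OF X.rad_pow_submodule, THEN subsetD]
  assume h: "\<forall>x\<in>rad_pow A X i. f x \<in> soc_pow A Y (Suc k)"
  have "rad_pow A X (Suc i) \<subseteq> {x \<in> carrier X. f x \<in> soc_pow A Y k}"
  proof (rule X.rad_pow_Suc_least[OF vimage_submodule[OF S]])
    fix a x assume a: "a \<in> jacobson_radical A" and x: "x \<in> rad_pow A X i"
    have "f x \<in> rad_colon A Y (soc_pow A Y k)" using h x Suc by blast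
    then have "a \<odot>\<^bsub>Y\<^esub> f x \<in> soc_pow A Y k" using a by (simp add: rad_colon_def)
    then show "a \<odot>\<^bsub>X\<^esub> x \<in> {x \<in> carrier X. f x \<in> soc_pow A Y k}"
      using X.R.jacobson_closed[OF a] sub[OF x] by (simp add: smult X.smult_closed)
  qed
  then show "\<forall>x\<in>rad_pow A X (Suc i). f x \<in> soc_pow A Y k" by blast
qed

text \<open>This turns statements about images into statements about radical powers of
  \<open>P\<close>. It is used for \<open>\<phi>\<close> with exponent \<open>s + 1\<close>, for
  maps whose image is not in \<open>L\<close> with exponent \<open>s\<close>, and for the composite
  of \<open>\<phi>\<close> with the projection to \<open>I/N\<close> with exponent
  \<open>s - 1\<close>.\<close>

lemma (in module_hom) rad_pow_kernel_iff:
  assumes fl: "fin_length A (regular_module A)"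
  shows "(\<forall>x\<in>rad_pow A X i. f x = \<zero>\<^bsub>Y\<^esub>) \<longleftrightarrow> (\<forall>x\<in>carrier X. f x \<in> soc_pow A Y i)"
proof -
  \<comment> \<open>The offset \<open>k\<close> carries the induction: each shift lowers the radical
    power and raises the socle layer by one. The claim is the case \<open>k = 0\<close>.\<close>
  have "(\<forall>x\<in>rad_pow A X i. f x \<in> soc_pow A Y k) \<longleftrightarrow> (\<forall>x\<in>carrier X. f x \<in> soc_pow A Y (i + k))" for k
    by (induction i arbitrary: k) (simp_all only: rad_pow_soc_pow_shift[OF fl] rad_pow.simps(1) add_Suc add_Suc_right add_0)
  from this[of 0] show ?thesis by simp
qed

text \<open>The index drops by one because \<open>N\<close> swallows the first layer.\<close>

lemma (in left_module) soc_pow_quot: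
  assumes fl: "fin_length R (regular_module R)" and N: "submodule N R M" and soc: "soc_pow R M (Suc 0) \<subseteq> N"
  shows "x \<in> soc_pow R M (Suc i) \<Longrightarrow> N +>\<^bsub>M\<^esub> x \<in> soc_pow R (quot_mod M N) i"
proof (induction i arbitrary: x)
  case 0
  then have "x \<in> N" using soc by blast
  then show ?case using coset_eq_self_iff[OF N] submodule_subset[OF N] by (auto simp: quot_zero)
next
  case (Suc i)
  interpret q: left_module R "quot_mod M N" by (rule left_module_quot_mod[OF N])
  have x: "x \<in> carrier M" "\<And>a. a \<in> jacobson_radical R \<Longrightarrow> a \<odot>\<^bsub>M\<^esub> x \<in> soc_pow R M (Suc i)"
    using Suc.prems unfolding soc_pow_Suc[OF fl, of "Suc i"] by (auto simp: rad_colon_def)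
  have "a \<odot>\<^bsub>quot_mod M N\<^esub> (N +>\<^bsub>M\<^esub> x) \<in> soc_pow R (quot_mod M N) i" if a: "a \<in> jacobson_radical R" for a
    using Suc.IH[OF x(2)[OF a]] quot_mod_smult[OF N R.jacobson_closed[OF a] x(1)] by simp
  then show ?case unfolding q.soc_pow_Suc[OF fl] using x(1) by (simp add: rad_colon_def quot_carrier)
qed

section \<open>The almost split sequence\<close>

lemma a_minus_restrict_scalars: "x \<ominus>\<^bsub>restrict_scalars A X\<^esub> y = x \<ominus>\<^bsub>X\<^esub> y"
  by (simp add: a_minus_def a_inv_def m_inv_def)

context artin_algebra
begin

text \<open>\<open>r 1\<close> is central in \<open>A\<close>, so multiplication by it is
  \<open>A\<close>-linear.\<close>

lemma mod_hom_scalar: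
  assumes Y: "left_module A Y" and w: "w \<in> mod_hom A X Y" and r: "r \<in> carrier R"
  shows "(\<lambda>x. (r \<odot>\<^bsub>A\<^esub> \<one>\<^bsub>A\<^esub>) \<odot>\<^bsub>Y\<^esub> w x) \<in> mod_hom A X Y"
proof -
  interpret Y: left_module A Y by fact
  show ?thesis
    using mod_homD[OF w] scalar_closed[OF r] scalar_central[OF r]
    by (intro mod_homI) (auto simp: Y.smult_closed Y.smult_r_distr Y.smult_assoc1[symmetric])
qed

text \<open>This is the image of \<open>Hom(X, K)\<close> under evaluation at \<open>b\<close>. Two
  instances occur: \<open>K = L\<close> inside \<open>I\<close>, and \<open>K\<close> all of
  \<open>Z\<close>.\<close>

lemma hom_values_submodule:
  assumes Y: "left_module A Y" and K: "submodule K A Y" and b: "b \<in> carrier X"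
  shows "submodule {w b | w. w \<in> mod_hom A X Y \<and> w ` carrier X \<subseteq> K} R (restrict_scalars A Y)"
proof -
  interpret Y: left_module A Y by fact
  interpret YR: left_module R "restrict_scalars A Y" by (rule left_module_restrict_scalars[OF Y])
  let ?V = "{w b | w. w \<in> mod_hom A X Y \<and> w ` carrier X \<subseteq> K}"
  show ?thesis
  proof (rule YR.submoduleI)
    show "?V \<subseteq> carrier (restrict_scalars A Y)" using mod_hom_closed b by fastforce
    show "\<zero>\<^bsub>restrict_scalars A Y\<^esub> \<in> ?V"
      using mod_hom_zero[OF Y, where X = X] submodule_zero_mem[OF K] by (intro CollectI exI[of _ "\<lambda>_. \<zero>\<^bsub>Y\<^esub>"]) auto
    fix x y assume "x \<in> ?V" "y \<in> ?V"
    then obtain v w where v: "v \<in> mod_hom A X Y" "v ` carrier X \<subseteq> K" "x = v b"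
      and w: "w \<in> mod_hom A X Y" "w ` carrier X \<subseteq> K" "y = w b" by blast
    have "(\<lambda>x. v x \<oplus>\<^bsub>Y\<^esub> w x) \<in> mod_hom A X Y"
      using mod_homD[OF v(1)] mod_homD[OF w(1)]
      by (intro mod_homI) (auto simp: Y.M.a_ac Y.smult_r_distr)
    moreover have "(\<lambda>x. v x \<oplus>\<^bsub>Y\<^esub> w x) ` carrier X \<subseteq> K" using v(2) w(2) submodule_add_mem[OF K] by blast
    ultimately show "x \<oplus>\<^bsub>restrict_scalars A Y\<^esub> y \<in> ?V"
      using v(3) w(3) by (intro CollectI exI[of _ "\<lambda>x. v x \<oplus>\<^bsub>Y\<^esub> w x"]) simp
  next
    fix r x assume r: "r \<in> carrier R" and "x \<in> ?V"
    then obtain v where v: "v \<in> mod_hom A X Y" "v ` carrier X \<subseteq> K" "x = v b" by blast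
    have "(\<lambda>x. (r \<odot>\<^bsub>A\<^esub> \<one>\<^bsub>A\<^esub>) \<odot>\<^bsub>Y\<^esub> v x) ` carrier X \<subseteq> K"
      using v(2) submodule_smult_mem[OF K scalar_closed[OF r]] by blast
    then show "r \<odot>\<^bsub>restrict_scalars A Y\<^esub> x \<in> ?V"
      using v(3) mod_hom_scalar[OF Y v(1) r]
      by (intro CollectI exI[of _ "\<lambda>x. (r \<odot>\<^bsub>A\<^esub> \<one>\<^bsub>A\<^esub>) \<odot>\<^bsub>Y\<^esub> v x"]) simp
  qed
qed

lemma mod_hom_cyclic:
  assumes Z: "left_module A Z" and I: "left_module A I" and v: "v \<in> carrier Z" and t: "t \<in> carrier I"
    and ann: "\<And>a. a \<in> carrier A \<Longrightarrow> a \<odot>\<^bsub>Z\<^esub> v = \<zero>\<^bsub>Z\<^esub> \<Longrightarrow> a \<odot>\<^bsub>I\<^esub> t = \<zero>\<^bsub>I\<^esub>"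
  shows "\<exists>k\<in>mod_hom A (Z\<lparr>carrier := (\<lambda>a. a \<odot>\<^bsub>Z\<^esub> v) ` carrier A\<rparr>) I. k v = t"
proof -
  interpret Z: left_module A Z by fact
  interpret I: left_module A I by fact
  interpret B: left_module A "regular_module A" by (rule A.left_module_regular)
  let ?C = "(\<lambda>a. a \<odot>\<^bsub>Z\<^esub> v) ` carrier A"
  have C: "submodule ?C A Z" by (rule Z.submodule_cyclic[OF v])
  have "(\<lambda>a. a \<odot>\<^bsub>Z\<^esub> v) \<in> mod_hom A (regular_module A) (Z\<lparr>carrier := ?C\<rparr>)"
    using v by (intro mod_homI) (auto simp: Z.smult_l_distr Z.smult_assoc1)
  then interpret g: module_hom A "regular_module A" "Z\<lparr>carrier := ?C\<rparr>" "\<lambda>a. a \<odot>\<^bsub>Z\<^esub> v"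
    by (intro module_homI B.left_module_axioms Z.left_module_sub[OF C])
  have h: "(\<lambda>a. a \<odot>\<^bsub>I\<^esub> t) \<in> mod_hom A (regular_module A) I"
    using t by (intro mod_homI) (auto simp: I.smult_closed I.smult_l_distr I.smult_assoc1)
  have surj: "(\<lambda>a. a \<odot>\<^bsub>Z\<^esub> v) ` carrier (regular_module A) = carrier (Z\<lparr>carrier := ?C\<rparr>)" by simp
  have ker: "a \<odot>\<^bsub>I\<^esub> t = \<zero>\<^bsub>I\<^esub>" if "a \<in> carrier (regular_module A)" "a \<odot>\<^bsub>Z\<^esub> v = \<zero>\<^bsub>Z\<lparr>carrier := ?C\<rparr>\<^esub>" for a
    using that ann by simp
  obtain k where k: "k \<in> mod_hom A (Z\<lparr>carrier := ?C\<rparr>) I"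
    "\<forall>a\<in>carrier (regular_module A). k (a \<odot>\<^bsub>Z\<^esub> v) = a \<odot>\<^bsub>I\<^esub> t"
    using g.factor[OF I surj h ker] by metis
  have "k v = t" using k(2)[rule_format, of "\<one>\<^bsub>A\<^esub>"] Z.smult_one[OF v] I.smult_one[OF t] by simp
  then show ?thesis using k(1) by blast
qed

end

section \<open>The two maps of the sequence in an abstract setting\<close>

text \<open>The radical and socle series no longer occur. \<open>above\<close> with
  \<open>L \<subset> M\<close> says that \<open>M/L\<close> is the simple socle of
  \<open>I/L\<close>; \<open>\<phi>_N\<close> and \<open>not_in_L\<close> are what is left of
  \<open>J^s P = A b\<close>; \<open>A f\<close> is the projective cover of
  \<open>A t\<close>.\<close>

locale uniserial_setup = artin_algebra R A
  for R :: "('r, 'c) ring_scheme" and A :: "('r, 'a) module" +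
  fixes I :: "('a, 'm) module" and N L M :: "'m set" and P :: "('a, 'p) module"
    and \<phi> :: "'p \<Rightarrow> 'm" and b :: 'p and t :: 'm and f :: 'a
  assumes inj: "injective_fg A I" and proj: "projective_fg A P"
    and N: "submodule N A I" and L: "submodule L A I" and M: "submodule M A I"
    and NL: "N \<subseteq> L" and LM: "L \<subset> M"
    and above: "\<And>Y. submodule Y A I \<Longrightarrow> L \<subset> Y \<Longrightarrow> M \<subseteq> Y"
    and t: "t \<in> N" "t \<noteq> \<zero>\<^bsub>I\<^esub>" and t_least: "\<And>H. submodule H A I \<Longrightarrow> H \<noteq> {\<zero>\<^bsub>I\<^esub>} \<Longrightarrow> t \<in> H"
    and \<phi>: "\<phi> \<in> mod_hom A P I" "\<phi> ` carrier P \<subseteq> M" and b: "b \<in> carrier P" "\<phi> b = t"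
    and M_gen: "\<And>m. m \<in> M \<Longrightarrow> \<exists>p\<in>carrier P. m \<ominus>\<^bsub>I\<^esub> \<phi> p \<in> N"
    and \<phi>_N: "\<And>p. p \<in> carrier P \<Longrightarrow> \<phi> p \<in> N \<Longrightarrow> \<exists>a\<in>carrier A. p = a \<odot>\<^bsub>P\<^esub> b"
    and not_in_L: "\<And>\<zeta>. \<zeta> \<in> mod_hom A P I \<Longrightarrow> \<zeta> ` carrier P \<subseteq> L \<Longrightarrow> \<zeta> b \<noteq> t"
    and f: "f \<in> carrier A" "f \<otimes>\<^bsub>A\<^esub> f = f" "f \<odot>\<^bsub>I\<^esub> t = t" "f \<odot>\<^bsub>P\<^esub> b = b"
    and f_local: "\<And>y. y \<in> carrier A \<Longrightarrow> (y \<otimes>\<^bsub>A\<^esub> f) \<odot>\<^bsub>I\<^esub> t \<noteq> \<zero>\<^bsub>I\<^esub> \<Longrightarrow> \<exists>a\<in>carrier A. a \<otimes>\<^bsub>A\<^esub> (y \<otimes>\<^bsub>A\<^esub> f) = f"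
begin

abbreviation "LN \<equiv> (quot_mod I N)\<lparr>carrier := (\<lambda>x. N +>\<^bsub>I\<^esub> x) ` L\<rparr>"
abbreviation "MN \<equiv> (quot_mod I N)\<lparr>carrier := (\<lambda>x. N +>\<^bsub>I\<^esub> x) ` M\<rparr>"

lemma fgI: "fg_module A I" using inj by (simp add: injective_fg_def)
lemma fgP: "fg_module A P" using proj by (simp add: projective_fg_def)

sublocale I: left_module A I by (rule fg_left_module[OF fgI])
sublocale P: left_module A P by (rule fg_left_module[OF fgP])
sublocale IN: module_hom A I "quot_mod I N" "\<lambda>x. N +>\<^bsub>I\<^esub> x" by (rule I.quot_proj_module_hom[OF N])

lemma NM: "N \<subseteq> M" using NL LM by blast
lemma N_carrier: "N \<subseteq> carrier I" and L_carrier: "L \<subseteq> carrier I" and M_carrier: "M \<subseteq> carrier I"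
  using submodule_subset N L M by blast+
lemma t_carrier: "t \<in> carrier I" using t(1) N_carrier by blast
lemma left_module_L: "left_module A (I\<lparr>carrier := L\<rparr>)" and left_module_M: "left_module A (I\<lparr>carrier := M\<rparr>)"
  and left_module_N: "left_module A (I\<lparr>carrier := N\<rparr>)"
  by (intro I.left_module_sub L M N)+
lemma LN_submodule: "submodule ((\<lambda>x. N +>\<^bsub>I\<^esub> x) ` L) A (quot_mod I N)"
  and MN_submodule: "submodule ((\<lambda>x. N +>\<^bsub>I\<^esub> x) ` M) A (quot_mod I N)"
  by (intro IN.image_submodule L M)+
lemma left_module_LN: "left_module A LN" and left_module_MN: "left_module A MN"
  by (intro IN.Y.left_module_sub LN_submodule MN_submodule)+

text \<open>A nonzero kernel would contain \<open>t\<close>.\<close>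

lemma hom_I_inj:
  assumes H: "submodule H A I" and Y: "left_module A Y" and h: "h \<in> mod_hom A (I\<lparr>carrier := H\<rparr>) Y"
    and ht: "t \<in> H \<Longrightarrow> h t \<noteq> \<zero>\<^bsub>Y\<^esub>"
  shows "inj_on h H"
proof -
  interpret h: module_hom A "I\<lparr>carrier := H\<rparr>" Y h by (intro module_homI I.left_module_sub H Y h)
  let ?k = "{x \<in> H. h x = \<zero>\<^bsub>Y\<^esub>}"
  have "submodule ?k A I" using h.kernel_submodule I.submodule_sub_iff[OF H] by simp
  then have "?k = {\<zero>\<^bsub>I\<^esub>}" using t_least[of ?k] ht by blast
  then show ?thesis using h.inj_on_iff by auto
qed

text \<open>The endomorphisms of \<open>L\<close> that are not invertible are thus those that kill
  \<open>t\<close>, so \<open>L\<close> has a local endomorphism ring. This detects splitting by a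
  single element.\<close>

lemma endo_L_bij:
  assumes h: "h \<in> mod_hom A (I\<lparr>carrier := L\<rparr>) (I\<lparr>carrier := L\<rparr>)" and ht: "h t \<noteq> \<zero>\<^bsub>I\<^esub>"
  shows "bij_betw h L L"
proof -
  interpret L: left_module A "I\<lparr>carrier := L\<rparr>" by (rule left_module_L)
  have "inj_on h L" by (rule hom_I_inj[OF L left_module_L h]) (use ht in simp)
  then show ?thesis
    using L.endo_inj_imp_surj[OF I.fin_length_sub[OF fg_fin_length[OF fgI] L] h] by (simp add: bij_betw_def)
qed

text \<open>\<open>v \<mapsto> t\<close> defines a homomorphism on \<open>A v\<close>: if
  \<open>a v = 0\<close> but \<open>a t \<noteq> 0\<close>, locality of \<open>f\<close> gives
  \<open>c a f = f\<close>, so \<open>v = f v = c a v = 0\<close>. Injectivity of \<open>I\<close>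
  extends it to \<open>Z\<close>.\<close>

lemma faithful:
  assumes Z: "fg_module A Z" and v: "v \<in> carrier Z" "f \<odot>\<^bsub>Z\<^esub> v = v" "v \<noteq> \<zero>\<^bsub>Z\<^esub>"
  shows "\<exists>w\<in>mod_hom A Z I. w v = t"
proof -
  interpret Z: left_module A Z by (rule fg_left_module[OF Z])
  have ann: "a \<odot>\<^bsub>I\<^esub> t = \<zero>\<^bsub>I\<^esub>" if a: "a \<in> carrier A" "a \<odot>\<^bsub>Z\<^esub> v = \<zero>\<^bsub>Z\<^esub>" for a
  proof (rule ccontr)
    assume "a \<odot>\<^bsub>I\<^esub> t \<noteq> \<zero>\<^bsub>I\<^esub>"
    then have "(a \<otimes>\<^bsub>A\<^esub> f) \<odot>\<^bsub>I\<^esub> t \<noteq> \<zero>\<^bsub>I\<^esub>" using a(1) f t_carrier by (simp add: I.smult_assoc1)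
    then obtain c where c: "c \<in> carrier A" "c \<otimes>\<^bsub>A\<^esub> (a \<otimes>\<^bsub>A\<^esub> f) = f" using f_local a(1) by blast
    have "v = (c \<otimes>\<^bsub>A\<^esub> (a \<otimes>\<^bsub>A\<^esub> f)) \<odot>\<^bsub>Z\<^esub> v" using c(2) v(2) by simp
    also have "\<dots> = c \<odot>\<^bsub>Z\<^esub> (a \<odot>\<^bsub>Z\<^esub> v)" using c(1) a(1) f(1) v(1,2) by (simp add: Z.smult_assoc1)
    finally show False using a(2) v(3) c(1) by (simp add: Z.smult_zero_right)
  qed
  obtain k where k: "k \<in> mod_hom A (Z\<lparr>carrier := (\<lambda>a. a \<odot>\<^bsub>Z\<^esub> v) ` carrier A\<rparr>) I" "k v = t"
    using mod_hom_cyclic[OF Z.left_module_axioms I.left_module_axioms v(1) t_carrier ann] by blast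
  obtain w where "w \<in> mod_hom A Z I" "\<forall>x\<in>(\<lambda>a. a \<odot>\<^bsub>Z\<^esub> v) ` carrier A. w x = k x"
    using injective_extend[OF inj Z Z.submodule_cyclic[OF v(1)] k(1)] by blast
  then show ?thesis using k(2) Z.cyclic_self[OF v(1)] by blast
qed

text \<open>Suppose \<open>u t\<close> is not of the form \<open>\<zeta> b\<close>. Choose an \<open>R\<close>-submodule \<open>H\<close> of \<open>I\<close> that contains all \<open>\<zeta> b\<close> with \<open>\<zeta> : P \<rightarrow> L\<close>
  and is maximal without \<open>t\<close>. By separation some \<open>w : Z \<rightarrow> I\<close> maps all \<open>\<zeta> b\<close> into \<open>H\<close>, but not \<open>u t\<close>. If the
  image of \<open>w\<close> were not in \<open>L\<close>, then \<open>\<phi>\<close> would lift to \<open>Z \<oplus> L\<close> and \<open>t = \<phi> b\<close> would be in \<open>H\<close>. So \<open>w u\<close> is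
  an endomorphism of \<open>L\<close> not killing \<open>t\<close>, hence invertible, and \<open>u\<close> splits.\<close>

lemma hom_from_P:
  assumes Z: "fg_module A Z" and u: "u \<in> mod_hom A (I\<lparr>carrier := L\<rparr>) Z"
    and not_split: "\<not> split_mono A (I\<lparr>carrier := L\<rparr>) Z u"
  shows "\<exists>\<zeta>\<in>mod_hom A P Z. \<zeta> b = u t"
proof (rule ccontr)
  assume no: "\<not> ?thesis"
  interpret Z: left_module A Z by (rule fg_left_module[OF Z])
  let ?ZR = "restrict_scalars A Z" and ?IR = "restrict_scalars A I"
  interpret ZR: left_module R ?ZR by (rule left_module_restrict_scalars[OF Z.left_module_axioms])
  interpret IR: left_module R ?IR by (rule left_module_restrict_scalars[OF I.left_module_axioms])
  have tL: "t \<in> L" using t(1) NL by blast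
  have ut: "u t \<in> carrier Z" using mod_hom_closed[OF u, of t] tL by simp
  let ?BL = "{\<zeta> b | \<zeta>. \<zeta> \<in> mod_hom A P I \<and> \<zeta> ` carrier P \<subseteq> L}"
  have BL: "submodule ?BL R ?IR" by (rule hom_values_submodule[OF I.left_module_axioms L b(1)])
  have "t \<notin> ?BL" using not_in_L by blast
  from IR.exists_maximal_avoiding[OF BL this]
  obtain H where "submodule H R ?IR \<and> ?BL \<subseteq> H \<and> t \<notin> H \<and> (\<forall>K. submodule K R ?IR \<and> H \<subset> K \<longrightarrow> t \<in> K)"
    by (rule exE)
  then have H: "submodule H R ?IR" "?BL \<subseteq> H" "t \<notin> H"
    and H_max: "\<And>K. submodule K R ?IR \<Longrightarrow> H \<subset> K \<Longrightarrow> t \<in> K" by simp_all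
  \<comment> \<open>\<open>I/H\<close> over \<open>R\<close> is the injective hull of
    \<open>separation\<close> in disguise: by maximality of \<open>H\<close> the class of
    \<open>t\<close> is a multiple of every nonzero element.\<close>
  let ?U = "quot_mod ?IR H"
  interpret q: module_hom R ?IR ?U "\<lambda>x. H +>\<^bsub>?IR\<^esub> x" by (rule IR.quot_proj_module_hom[OF H(1)])
  define G where "G = {\<lambda>z. H +>\<^bsub>?IR\<^esub> w z | w. w \<in> mod_hom A Z I}"
  have GI: "(\<lambda>z. H +>\<^bsub>?IR\<^esub> w z) \<in> G" if "w \<in> mod_hom A Z I" for w
    unfolding G_def using that by (intro CollectI exI[of _ w]) simp
  have q0: "H +>\<^bsub>?IR\<^esub> x = \<zero>\<^bsub>?U\<^esub> \<longleftrightarrow> x \<in> H" if "x \<in> carrier I" for x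
    using IR.coset_eq_self_iff[OF H(1)] that by (simp add: IR.quot_zero)
  \<comment> \<open>Every \<open>\<zeta> b\<close>, and \<open>u t\<close> too, is fixed by
    \<open>f\<close>. On elements fixed by \<open>f\<close> the homomorphisms to \<open>I\<close>
    are faithful; on all of \<open>Z\<close> they need not be.\<close>
  let ?W = "{z \<in> carrier Z. f \<odot>\<^bsub>Z\<^esub> z = z}"
  \<comment> \<open>The trivial condition on the image gives the set the shape of
    \<open>hom_values_submodule\<close>.\<close>
  let ?V = "{\<zeta> b | \<zeta>. \<zeta> \<in> mod_hom A P Z \<and> \<zeta> ` carrier P \<subseteq> carrier Z}"
  have "\<exists>g\<in>G. (\<forall>x\<in>?V. g x = \<zero>\<^bsub>?U\<^esub>) \<and> g (u t) \<noteq> \<zero>\<^bsub>?U\<^esub>"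
  proof (rule separation[OF R.R.is_cring ZR.left_module_axioms fin_length_restrict_scalars[OF Z] q.Y.left_module_axioms])
    show "H +>\<^bsub>?IR\<^esub> t \<in> carrier ?U" "H +>\<^bsub>?IR\<^esub> t \<noteq> \<zero>\<^bsub>?U\<^esub>"
      using q.closed t_carrier q0 H(3) by auto
    show "\<exists>r\<in>carrier R. r \<odot>\<^bsub>?U\<^esub> y = H +>\<^bsub>?IR\<^esub> t" if y: "y \<in> carrier ?U" "y \<noteq> \<zero>\<^bsub>?U\<^esub>" for y
    proof -
      obtain x where x: "x \<in> carrier I" "y = H +>\<^bsub>?IR\<^esub> x" using y(1) by (auto simp: IR.quot_carrier)
      then have xH: "x \<notin> H" using q0 y(2) by blast
      have xc: "x \<in> carrier ?IR" using x(1) by simp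
      let ?C = "(\<lambda>r. r \<odot>\<^bsub>?IR\<^esub> x) ` carrier R"
      have C: "submodule ?C R ?IR" by (rule IR.submodule_cyclic[OF xc])
      have "H \<subset> H <+>\<^bsub>?IR\<^esub> ?C"
        using IR.set_add_upper1[OF H(1) C] IR.set_add_upper2[OF H(1) C] IR.cyclic_self[OF xc] xH by blast
      then have "t \<in> H <+>\<^bsub>?IR\<^esub> ?C" by (rule H_max[OF IR.submodule_set_add[OF H(1) C]])
      from IR.mem_set_add_cyclic[OF H(1) xc this]
      obtain r where r: "r \<in> carrier R" "t \<ominus>\<^bsub>?IR\<^esub> r \<odot>\<^bsub>?IR\<^esub> x \<in> H" by (rule bexE)
      have "H +>\<^bsub>?IR\<^esub> t = H +>\<^bsub>?IR\<^esub> (r \<odot>\<^bsub>?IR\<^esub> x)"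
        using IR.coset_eq_iff[OF H(1), of t "r \<odot>\<^bsub>?IR\<^esub> x"] r t_carrier IR.smult_closed[OF r(1) xc] by simp
      also have "\<dots> = r \<odot>\<^bsub>?U\<^esub> y" using q.smult[OF r(1) xc] x(2) by simp
      finally show ?thesis using r(1) by (intro bexI[of _ r]) simp_all
    qed
    show "G \<subseteq> mod_hom R ?ZR ?U"
      unfolding G_def using mod_hom_comp[OF mod_hom_restrict_scalars IR.quot_proj_hom[OF H(1)]] by blast
    show "\<exists>g'\<in>G. \<forall>z\<in>carrier ?ZR. g' z = r \<odot>\<^bsub>?U\<^esub> g z" if g: "g \<in> G" and r: "r \<in> carrier R" for g r
    proof -
      obtain w where w: "w \<in> mod_hom A Z I" "g = (\<lambda>z. H +>\<^bsub>?IR\<^esub> w z)" using g unfolding G_def by blast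
      have "(\<lambda>z. H +>\<^bsub>?IR\<^esub> ((r \<odot>\<^bsub>A\<^esub> \<one>\<^bsub>A\<^esub>) \<odot>\<^bsub>I\<^esub> w z)) \<in> G"
        by (rule GI[OF mod_hom_scalar[OF I.left_module_axioms w(1) r]])
      moreover have "H +>\<^bsub>?IR\<^esub> ((r \<odot>\<^bsub>A\<^esub> \<one>\<^bsub>A\<^esub>) \<odot>\<^bsub>I\<^esub> w z) = r \<odot>\<^bsub>?U\<^esub> g z" if "z \<in> carrier Z" for z
        using q.smult[OF r, of "w z"] mod_hom_closed[OF w(1) that] w(2) by simp
      ultimately show ?thesis by (intro bexI[of _ "\<lambda>z. H +>\<^bsub>?IR\<^esub> ((r \<odot>\<^bsub>A\<^esub> \<one>\<^bsub>A\<^esub>) \<odot>\<^bsub>I\<^esub> w z)"]) simp_all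
    qed
    show "\<exists>g''\<in>G. \<forall>z\<in>carrier ?ZR. g'' z = g z \<ominus>\<^bsub>?U\<^esub> g' z" if g: "g \<in> G" "g' \<in> G" for g g'
    proof -
      obtain w w' where w: "w \<in> mod_hom A Z I" "g = (\<lambda>z. H +>\<^bsub>?IR\<^esub> w z)"
        and w': "w' \<in> mod_hom A Z I" "g' = (\<lambda>z. H +>\<^bsub>?IR\<^esub> w' z)" using g unfolding G_def by blast
      have "(\<lambda>z. H +>\<^bsub>?IR\<^esub> (w z \<ominus>\<^bsub>I\<^esub> w' z)) \<in> G"
        by (rule GI[OF mod_hom_minus[OF I.left_module_axioms w(1) w'(1)]])
      moreover have "H +>\<^bsub>?IR\<^esub> (w z \<ominus>\<^bsub>I\<^esub> w' z) = g z \<ominus>\<^bsub>?U\<^esub> g' z" if "z \<in> carrier Z" for z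
        using q.minus[of "w z" "w' z"] mod_hom_closed[OF w(1) that] mod_hom_closed[OF w'(1) that] w(2) w'(2)
        by (simp add: a_minus_restrict_scalars)
      ultimately show ?thesis by (intro bexI[of _ "\<lambda>z. H +>\<^bsub>?IR\<^esub> (w z \<ominus>\<^bsub>I\<^esub> w' z)"]) simp_all
    qed
    show "submodule ?W R ?ZR"
    proof (rule ZR.submoduleI)
      show "r \<odot>\<^bsub>?ZR\<^esub> x \<in> ?W" if r: "r \<in> carrier R" and x: "x \<in> ?W" for r x
      proof -
        have xc: "x \<in> carrier Z" and fx: "f \<odot>\<^bsub>Z\<^esub> x = x" using x by auto
        have "f \<odot>\<^bsub>Z\<^esub> ((r \<odot>\<^bsub>A\<^esub> \<one>\<^bsub>A\<^esub>) \<odot>\<^bsub>Z\<^esub> x) = (r \<odot>\<^bsub>A\<^esub> \<one>\<^bsub>A\<^esub>) \<odot>\<^bsub>Z\<^esub> (f \<odot>\<^bsub>Z\<^esub> x)"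
          using Z.smult_assoc1[OF f(1) scalar_closed[OF r] xc] Z.smult_assoc1[OF scalar_closed[OF r] f(1) xc]
            scalar_central[OF r f(1)] by metis
        then show ?thesis using fx xc by (simp add: Z.smult_closed scalar_closed[OF r])
      qed
    qed (use f(1) in \<open>auto simp: Z.smult_zero_right Z.smult_r_distr\<close>)
    show "\<exists>g\<in>G. g v \<noteq> \<zero>\<^bsub>?U\<^esub>" if v: "v \<in> ?W" "v \<noteq> \<zero>\<^bsub>?ZR\<^esub>" for v
    proof -
      obtain w where w: "w \<in> mod_hom A Z I" "w v = t" using faithful[OF Z] v by auto
      then show ?thesis
        using q0[OF t_carrier] H(3) unfolding G_def by (intro bexI[of _ "\<lambda>z. H +>\<^bsub>?IR\<^esub> w z"]) auto
    qed
    show "submodule ?V R ?ZR" by (rule hom_values_submodule[OF Z.left_module_axioms Z.submodule_carrier b(1)])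
    show "?V \<subseteq> ?W"
    proof
      fix x assume "x \<in> ?V"
      then obtain \<zeta> where \<zeta>: "\<zeta> \<in> mod_hom A P Z" "x = \<zeta> b" by blast
      then show "x \<in> ?W" using mod_hom_smult[OF \<zeta>(1) f(1) b(1)] mod_hom_closed[OF \<zeta>(1) b(1)] f(4) by simp
    qed
    show "u t \<in> ?W" using mod_hom_smult[OF u f(1), of t] f(3) tL ut by simp
    show "u t \<notin> ?V" using no by auto
  qed
  then obtain g where "g \<in> G" and g: "\<forall>x\<in>?V. g x = \<zero>\<^bsub>?U\<^esub>" "g (u t) \<noteq> \<zero>\<^bsub>?U\<^esub>" by blast
  then obtain w where w: "w \<in> mod_hom A Z I" "g = (\<lambda>z. H +>\<^bsub>?IR\<^esub> w z)" unfolding G_def by blast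
  interpret w: module_hom A Z I w by (intro module_homI Z.left_module_axioms I.left_module_axioms w(1))
  have wV: "w (\<zeta> b) \<in> H" if \<zeta>: "\<zeta> \<in> mod_hom A P Z" for \<zeta>
  proof -
    have "\<zeta> b \<in> ?V" using \<zeta> mod_hom_closed[OF \<zeta>] by blast
    then have "H +>\<^bsub>?IR\<^esub> w (\<zeta> b) = \<zero>\<^bsub>?U\<^esub>" using g(1) w(2) by simp
    then show ?thesis using q0 w.closed mod_hom_closed[OF \<zeta> b(1)] by blast
  qed
  have wut: "w (u t) \<notin> H" using g(2) w(2) q0[OF w.closed[OF ut]] by simp
  have wL: "w ` carrier Z \<subseteq> L"
  proof (rule ccontr)
    assume not: "\<not> w ` carrier Z \<subseteq> L"
    let ?Y = "w ` carrier Z <+>\<^bsub>I\<^esub> L"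
    have D: "submodule (w ` carrier Z) A I" by (rule w.image_submodule[OF Z.submodule_carrier])
    have Y: "submodule ?Y A I" by (rule I.submodule_set_add[OF D L])
    have "L \<subset> ?Y" using not I.set_add_upper1[OF D L] I.set_add_upper2[OF D L] by blast
    then have MY: "M \<subseteq> ?Y" by (rule above[OF Y])
    let ?D = "dsum Z (I\<lparr>carrier := L\<rparr>)"
    have s: "(\<lambda>(z, l). w z \<oplus>\<^bsub>I\<^esub> l) \<in> mod_hom A ?D I"
      by (rule mod_hom_copair[OF I.left_module_axioms w(1) mod_hom_incl[OF L_carrier]])
    have s_im: "(\<lambda>(z, l). w z \<oplus>\<^bsub>I\<^esub> l) ` carrier ?D = ?Y"
    proof (intro equalityI subsetI)
      fix y assume "y \<in> (\<lambda>(z, l). w z \<oplus>\<^bsub>I\<^esub> l) ` carrier ?D"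
      then obtain z l where "z \<in> carrier Z" "l \<in> L" "y = w z \<oplus>\<^bsub>I\<^esub> l" by auto
      then show "y \<in> ?Y" unfolding set_add_iff by blast
    next
      fix y assume "y \<in> ?Y"
      then obtain z l where "z \<in> carrier Z" "l \<in> L" "y = w z \<oplus>\<^bsub>I\<^esub> l" unfolding set_add_iff by blast
      then show "y \<in> (\<lambda>(z, l). w z \<oplus>\<^bsub>I\<^esub> l) ` carrier ?D" by (intro image_eqI[of _ _ "(z, l)"]) auto
    qed
    have "\<exists>h\<in>mod_hom A P ?D. \<forall>p\<in>carrier P. (\<lambda>(z, l). w z \<oplus>\<^bsub>I\<^esub> l) (h p) = \<phi> p"
    proof (rule projective_lift[OF proj fg_dsum[OF Z fg_sub[OF fgI L]] fg_sub[OF fgI Y]])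
      show "(\<lambda>(z, l). w z \<oplus>\<^bsub>I\<^esub> l) \<in> mod_hom A ?D (I\<lparr>carrier := ?Y\<rparr>)"
        by (rule mod_hom_sub_codomain[OF s]) (simp only: s_im order_refl)
      show "(\<lambda>(z, l). w z \<oplus>\<^bsub>I\<^esub> l) ` carrier ?D = carrier (I\<lparr>carrier := ?Y\<rparr>)" using s_im by simp
      show "\<phi> \<in> mod_hom A P (I\<lparr>carrier := ?Y\<rparr>)"
        by (rule mod_hom_sub_codomain[OF \<phi>(1)]) (use \<phi>(2) MY in blast)
    qed
    then obtain h where h: "h \<in> mod_hom A P ?D" "\<forall>p\<in>carrier P. (\<lambda>(z, l). w z \<oplus>\<^bsub>I\<^esub> l) (h p) = \<phi> p"
      by (rule bexE)
    have h1: "(\<lambda>p. fst (h p)) \<in> mod_hom A P Z" by (rule mod_hom_comp[OF h(1) dsum_fst_hom])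
    have h2: "(\<lambda>p. snd (h p)) \<in> mod_hom A P (I\<lparr>carrier := L\<rparr>)" by (rule mod_hom_comp[OF h(1) dsum_snd_hom])
    have "(\<lambda>p. snd (h p)) \<in> mod_hom A P I" by (rule mod_hom_of_sub_codomain[OF h2 L_carrier])
    moreover have "(\<lambda>p. snd (h p)) ` carrier P \<subseteq> L" using mod_hom_closed[OF h2] by auto
    \<comment> \<open>The component in \<open>L\<close> contributes an element of \<open>H\<close>
      by the choice of \<open>H\<close>, the component in \<open>Z\<close> does so by the choice of
      \<open>w\<close>.\<close>
    ultimately have "snd (h b) \<in> H" using H(2) by blast
    moreover have "w (fst (h b)) \<in> H" by (rule wV[OF h1])
    ultimately have "w (fst (h b)) \<oplus>\<^bsub>?IR\<^esub> snd (h b) \<in> H" using submodule_add_mem[OF H(1)] by blast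
    moreover have "w (fst (h b)) \<oplus>\<^bsub>I\<^esub> snd (h b) = t"
      using h(2) b by (simp add: case_prod_beta)
    ultimately show False using H(3) by simp
  qed
  have w': "w \<in> mod_hom A Z (I\<lparr>carrier := L\<rparr>)" by (rule mod_hom_sub_codomain[OF w(1) wL])
  have wu: "(\<lambda>x. w (u x)) \<in> mod_hom A (I\<lparr>carrier := L\<rparr>) (I\<lparr>carrier := L\<rparr>)" by (rule mod_hom_comp[OF u w'])
  have "w (u t) \<noteq> \<zero>\<^bsub>I\<^esub>" using wut submodule_zero_mem[OF H(1)] by auto
  then have "bij_betw (\<lambda>x. w (u x)) (carrier (I\<lparr>carrier := L\<rparr>)) (carrier (I\<lparr>carrier := L\<rparr>))"
    using endo_L_bij[OF wu] by simp
  then have "\<exists>k\<in>mod_hom A (I\<lparr>carrier := L\<rparr>) (I\<lparr>carrier := L\<rparr>). \<forall>x\<in>L. k (w (u x)) = x"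
    by (rule inv_mod_hom[OF left_module_L left_module_L wu]) auto
  then obtain k where k: "k \<in> mod_hom A (I\<lparr>carrier := L\<rparr>) (I\<lparr>carrier := L\<rparr>)" "\<forall>x\<in>L. k (w (u x)) = x"
    by (rule bexE)
  have "split_mono A (I\<lparr>carrier := L\<rparr>) Z u"
    unfolding split_mono_def using mod_hom_comp[OF w' k(1)] k(2) by (intro bexI[of _ "\<lambda>z. k (w z)"]) auto
  then show False using not_split by simp
qed

lemma extension:
  assumes Z: "left_module A Z" and u: "u \<in> mod_hom A (I\<lparr>carrier := L\<rparr>) Z"
    and \<zeta>: "\<zeta> \<in> mod_hom A P Z" "\<zeta> b = u t"
  shows "\<exists>v\<in>mod_hom A (dsum (I\<lparr>carrier := M\<rparr>) LN) Z. \<forall>x\<in>L. v (x, N +>\<^bsub>I\<^esub> x) = u x"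
proof -
  interpret Z: left_module A Z by fact
  interpret u: module_hom A "I\<lparr>carrier := L\<rparr>" Z u by (intro module_homI left_module_L Z u)
  interpret \<zeta>: module_hom A P Z \<zeta> by (intro module_homI P.left_module_axioms Z \<zeta>)
  interpret \<phi>: module_hom A P I \<phi> by (intro module_homI P.left_module_axioms I.left_module_axioms \<phi>)
  have tL: "t \<in> L" using t(1) NL by blast
  let ?D = "dsum P (I\<lparr>carrier := N\<rparr>)"
  have "(\<lambda>(p, n). \<phi> p \<oplus>\<^bsub>I\<^esub> n) \<in> mod_hom A ?D I"
    by (rule mod_hom_copair[OF I.left_module_axioms \<phi>(1) mod_hom_incl[OF N_carrier]])
  moreover have im: "(\<lambda>(p, n). \<phi> p \<oplus>\<^bsub>I\<^esub> n) ` carrier ?D = M"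
  proof (intro equalityI subsetI)
    fix m assume "m \<in> (\<lambda>(p, n). \<phi> p \<oplus>\<^bsub>I\<^esub> n) ` carrier ?D"
    then obtain p n where "p \<in> carrier P" "n \<in> N" "m = \<phi> p \<oplus>\<^bsub>I\<^esub> n" by auto
    then show "m \<in> M" using \<phi>(2) NM submodule_add_mem[OF M] by blast
  next
    fix m assume m: "m \<in> M"
    then obtain p where p: "p \<in> carrier P" "m \<ominus>\<^bsub>I\<^esub> \<phi> p \<in> N" using M_gen by blast
    have c: "m \<in> carrier I" "\<phi> p \<in> carrier I" using m M_carrier \<phi>.closed[OF p(1)] by auto
    have "m = \<phi> p \<oplus>\<^bsub>I\<^esub> (m \<ominus>\<^bsub>I\<^esub> \<phi> p)"
      using I.minus_add_cancel[OF c] I.M.a_comm[OF _ c(2), of "m \<ominus>\<^bsub>I\<^esub> \<phi> p"] c by simp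
    then show "m \<in> (\<lambda>(p, n). \<phi> p \<oplus>\<^bsub>I\<^esub> n) ` carrier ?D"
      using p by (intro image_eqI[of _ _ "(p, m \<ominus>\<^bsub>I\<^esub> \<phi> p)"]) auto
  qed
  ultimately have "(\<lambda>(p, n). \<phi> p \<oplus>\<^bsub>I\<^esub> n) \<in> mod_hom A ?D (I\<lparr>carrier := M\<rparr>)"
    by (intro mod_hom_sub_codomain) simp_all
  then interpret s: module_hom A ?D "I\<lparr>carrier := M\<rparr>" "\<lambda>(p, n). \<phi> p \<oplus>\<^bsub>I\<^esub> n"
    by (intro module_homI left_module_dsum P.left_module_axioms left_module_N left_module_M)
  have uN: "u \<in> mod_hom A (I\<lparr>carrier := N\<rparr>) Z"
    using mod_hom_sub_domain[OF u, of N] NL by simp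
  have h: "(\<lambda>(p, n). \<zeta> p \<oplus>\<^bsub>Z\<^esub> u n) \<in> mod_hom A ?D Z" by (rule mod_hom_copair[OF Z \<zeta>(1) uN])
  have s_surj: "(\<lambda>(p, n). \<phi> p \<oplus>\<^bsub>I\<^esub> n) ` carrier ?D = carrier (I\<lparr>carrier := M\<rparr>)" using im by simp
  \<comment> \<open>By \<open>\<phi>_N\<close> the kernel of
    \<open>P \<oplus> N \<rightarrow> M\<close> consists of pairs \<open>(a b, - a t)\<close>, and
    \<open>\<zeta> b = u t\<close> makes the combined map vanish on them.\<close>
  have ker: "(\<lambda>(p, n). \<zeta> p \<oplus>\<^bsub>Z\<^esub> u n) d = \<zero>\<^bsub>Z\<^esub>"
    if d: "d \<in> carrier ?D" "(\<lambda>(p, n). \<phi> p \<oplus>\<^bsub>I\<^esub> n) d = \<zero>\<^bsub>I\<lparr>carrier := M\<rparr>\<^esub>" for d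
  proof -
    obtain p n where pn: "d = (p, n)" "p \<in> carrier P" "n \<in> N" using d(1) by auto
    have c: "n \<in> carrier I" "\<phi> p \<in> carrier I" "n \<in> L" using pn N_carrier \<phi>.closed NL by auto
    have "\<phi> p \<oplus>\<^bsub>I\<^esub> n = \<zero>\<^bsub>I\<^esub>" using d(2) pn(1) by simp
    then have \<phi>p: "\<phi> p = \<ominus>\<^bsub>I\<^esub> n" using I.M.minus_equality[of "\<phi> p" n] c by simp
    then have "\<phi> p \<in> N" using submodule_uminus_mem[OF N pn(3)] by simp
    then obtain a where a: "a \<in> carrier A" "p = a \<odot>\<^bsub>P\<^esub> b" using \<phi>_N[OF pn(2)] by blast
    have "a \<odot>\<^bsub>I\<^esub> t = \<ominus>\<^bsub>I\<^esub> n" using \<phi>.smult[OF a(1) b(1)] a(2) b(2) \<phi>p by simp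
    then have "u (a \<odot>\<^bsub>I\<^esub> t) = u (\<ominus>\<^bsub>I\<lparr>carrier := L\<rparr>\<^esub> n)" using I.a_inv_sub[OF L c(3)] by simp
    then have "a \<odot>\<^bsub>Z\<^esub> u t = \<ominus>\<^bsub>Z\<^esub> u n" using u.smult[OF a(1), of t] u.uminus[of n] tL c(3) by simp
    then have "\<zeta> p = \<ominus>\<^bsub>Z\<^esub> u n" using \<zeta>.smult[OF a(1) b(1)] a(2) \<zeta>(2) by simp
    then show ?thesis using pn(1) u.closed[of n] c(3) by (simp add: Z.M.l_neg)
  qed
  obtain v1 where v1: "v1 \<in> mod_hom A (I\<lparr>carrier := M\<rparr>) Z"
    "\<forall>d\<in>carrier ?D. v1 ((\<lambda>(p, n). \<phi> p \<oplus>\<^bsub>I\<^esub> n) d) = (\<lambda>(p, n). \<zeta> p \<oplus>\<^bsub>Z\<^esub> u n) d"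
    using s.factor[OF Z s_surj h ker] by metis
  have v1_N: "v1 n = u n" if n: "n \<in> N" for n
  proof -
    have "v1 (\<phi> \<zero>\<^bsub>P\<^esub> \<oplus>\<^bsub>I\<^esub> n) = \<zeta> \<zero>\<^bsub>P\<^esub> \<oplus>\<^bsub>Z\<^esub> u n" using v1(2)[rule_format, of "(\<zero>\<^bsub>P\<^esub>, n)"] n by simp
    then show ?thesis using \<phi>.zero \<zeta>.zero n N_carrier NL u.closed[of n] by (simp add: subset_iff)
  qed
  have v1_L: "v1 \<in> mod_hom A (I\<lparr>carrier := L\<rparr>) Z" using mod_hom_sub_domain[OF v1(1), of L] LM by auto
  interpret v1: module_hom A "I\<lparr>carrier := L\<rparr>" Z v1 by (intro module_homI left_module_L Z v1_L)
  have "(\<lambda>x. N +>\<^bsub>I\<^esub> x) \<in> mod_hom A (I\<lparr>carrier := L\<rparr>) LN"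
    by (rule mod_hom_sub_codomain[OF mod_hom_sub_domain[OF IN.hom L_carrier]]) simp
  then interpret r: module_hom A "I\<lparr>carrier := L\<rparr>" LN "\<lambda>x. N +>\<^bsub>I\<^esub> x"
    by (intro module_homI left_module_L left_module_LN)
  have k: "(\<lambda>x. u x \<ominus>\<^bsub>Z\<^esub> v1 x) \<in> mod_hom A (I\<lparr>carrier := L\<rparr>) Z" by (rule mod_hom_minus[OF Z u v1_L])
  have ker2: "u x \<ominus>\<^bsub>Z\<^esub> v1 x = \<zero>\<^bsub>Z\<^esub>"
    if x: "x \<in> carrier (I\<lparr>carrier := L\<rparr>)" "N +>\<^bsub>I\<^esub> x = \<zero>\<^bsub>LN\<^esub>" for x
  proof -
    have "x \<in> N" using x I.coset_eq_self_iff[OF N, of x] L_carrier by (auto simp: I.quot_zero)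
    then show ?thesis using v1_N u.closed[of x] x(1) by (simp add: Z.minus_eq_zero_iff)
  qed
  have r_surj: "(\<lambda>x. N +>\<^bsub>I\<^esub> x) ` carrier (I\<lparr>carrier := L\<rparr>) = carrier LN" by simp
  obtain v2 where v2: "v2 \<in> mod_hom A LN Z" "\<forall>x\<in>carrier (I\<lparr>carrier := L\<rparr>). v2 (N +>\<^bsub>I\<^esub> x) = u x \<ominus>\<^bsub>Z\<^esub> v1 x"
    using r.factor[OF Z r_surj k ker2] by metis
  have "v1 x \<oplus>\<^bsub>Z\<^esub> v2 (N +>\<^bsub>I\<^esub> x) = u x" if x: "x \<in> L" for x
  proof -
    have c: "u x \<in> carrier Z" "v1 x \<in> carrier Z" using u.closed[of x] v1.closed[of x] x by auto
    then show ?thesis using v2(2) x Z.minus_add_cancel[OF c] Z.M.a_comm[OF c(2), of "u x \<ominus>\<^bsub>Z\<^esub> v1 x"] by simp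
  qed
  then show ?thesis
    using mod_hom_copair[OF Z v1(1) v2(1)] by (intro bexI[of _ "\<lambda>(x, y). v1 x \<oplus>\<^bsub>Z\<^esub> v2 y"]) auto
qed

lemma incl_proj_hom:
  "(\<lambda>x. (x, N +>\<^bsub>I\<^esub> x)) \<in> mod_hom A (I\<lparr>carrier := L\<rparr>) (dsum (I\<lparr>carrier := M\<rparr>) LN)"
proof (rule mod_hom_pair)
  show "(\<lambda>x. x) \<in> mod_hom A (I\<lparr>carrier := L\<rparr>) (I\<lparr>carrier := M\<rparr>)" using LM by (auto simp: mod_hom_def)
  show "(\<lambda>x. N +>\<^bsub>I\<^esub> x) \<in> mod_hom A (I\<lparr>carrier := L\<rparr>) LN"
    by (rule mod_hom_sub_codomain[OF mod_hom_sub_domain[OF IN.hom L_carrier]]) simp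
qed

text \<open>A retraction restricted to \<open>M\<close> fixes \<open>t\<close>, whose coset is zero;
  so it is injective on \<open>M\<close> and maps \<open>L\<close> bijectively to \<open>L\<close>.
  An element of \<open>M\<close> outside \<open>L\<close> would then share its image with one of
  \<open>L\<close>.\<close>

lemma not_split_mono:
  "\<not> split_mono A (I\<lparr>carrier := L\<rparr>) (dsum (I\<lparr>carrier := M\<rparr>) LN) (\<lambda>x. (x, N +>\<^bsub>I\<^esub> x))"
proof
  assume "split_mono A (I\<lparr>carrier := L\<rparr>) (dsum (I\<lparr>carrier := M\<rparr>) LN) (\<lambda>x. (x, N +>\<^bsub>I\<^esub> x))"
  then obtain h where h: "h \<in> mod_hom A (dsum (I\<lparr>carrier := M\<rparr>) LN) (I\<lparr>carrier := L\<rparr>)"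
    "\<forall>x\<in>carrier (I\<lparr>carrier := L\<rparr>). h (x, N +>\<^bsub>I\<^esub> x) = x" unfolding split_mono_def by (rule bexE)
  have "(\<lambda>x. (x, \<zero>\<^bsub>LN\<^esub>)) \<in> mod_hom A (I\<lparr>carrier := M\<rparr>) (dsum (I\<lparr>carrier := M\<rparr>) LN)"
    by (rule mod_hom_pair[OF _ mod_hom_zero[OF left_module_LN]]) (simp add: mod_hom_def)
  from mod_hom_comp[OF this h(1)]
  have h1: "(\<lambda>x. h (x, \<zero>\<^bsub>LN\<^esub>)) \<in> mod_hom A (I\<lparr>carrier := M\<rparr>) (I\<lparr>carrier := L\<rparr>)" .
  have tL: "t \<in> L" using t(1) NL by blast
  have "N +>\<^bsub>I\<^esub> t = \<zero>\<^bsub>LN\<^esub>" using I.coset_eq_self_iff[OF N t_carrier] t(1) by (simp add: I.quot_zero)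
  then have ht: "h (t, \<zero>\<^bsub>LN\<^esub>) = t" using h(2) tL by force
  have inj_M: "inj_on (\<lambda>x. h (x, \<zero>\<^bsub>LN\<^esub>)) M"
    by (rule hom_I_inj[OF M left_module_L h1]) (use ht t(2) in simp)
  have "L \<subseteq> carrier (I\<lparr>carrier := M\<rparr>)" using LM by auto
  from mod_hom_sub_domain[OF h1 this]
  have "(\<lambda>x. h (x, \<zero>\<^bsub>LN\<^esub>)) \<in> mod_hom A (I\<lparr>carrier := L\<rparr>) (I\<lparr>carrier := L\<rparr>)" by simp
  then have bij: "bij_betw (\<lambda>x. h (x, \<zero>\<^bsub>LN\<^esub>)) L L" by (rule endo_L_bij) (use ht t(2) in simp)
  obtain m where m: "m \<in> M" "m \<notin> L" using LM by blast
  have "h (m, \<zero>\<^bsub>LN\<^esub>) \<in> L" using mod_hom_closed[OF h1, of m] m(1) by simp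
  then obtain l where "l \<in> L" "h (m, \<zero>\<^bsub>LN\<^esub>) = h (l, \<zero>\<^bsub>LN\<^esub>)"
    using bij unfolding bij_betw_def by (metis (no_types, lifting) imageE)
  then show False using inj_M m LM by (auto dest: inj_onD)
qed

lemma left_almost_split:
  "left_almost_split A (I\<lparr>carrier := L\<rparr>) (dsum (I\<lparr>carrier := M\<rparr>) LN) (\<lambda>x. (x, N +>\<^bsub>I\<^esub> x))"
proof -
  have "\<exists>v\<in>mod_hom A (dsum (I\<lparr>carrier := M\<rparr>) LN) Z. \<forall>x\<in>carrier (I\<lparr>carrier := L\<rparr>). v (x, N +>\<^bsub>I\<^esub> x) = u x"
    if u: "u \<in> mod_hom A (I\<lparr>carrier := L\<rparr>) Z" and Z: "fg_module A Z" and ns: "\<not> split_mono A (I\<lparr>carrier := L\<rparr>) Z u"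
    for Z :: "'a fgmod" and u
  proof -
    obtain \<zeta> where \<zeta>: "\<zeta> \<in> mod_hom A P Z" "\<zeta> b = u t" using hom_from_P[OF Z u ns] by blast
    show ?thesis using extension[OF fg_left_module[OF Z] u \<zeta>] by simp
  qed
  then show ?thesis using incl_proj_hom not_split_mono unfolding left_almost_split_def by simp
qed

text \<open>\<open>L\<close>, \<open>M\<close>, \<open>L/N\<close> and \<open>M/N\<close> form a
  pullback square, since \<open>N \<subseteq> L\<close> puts into \<open>L\<close> each element of
  \<open>M\<close> whose coset comes from \<open>L\<close>. The component \<open>M\<close> alone
  already covers \<open>M/N\<close>.\<close>

lemma short_exact:
  "short_exact A (I\<lparr>carrier := L\<rparr>) (\<lambda>x. (x, N +>\<^bsub>I\<^esub> x)) (dsum (I\<lparr>carrier := M\<rparr>) LN)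
    (\<lambda>(y, z). (N +>\<^bsub>I\<^esub> y) \<ominus>\<^bsub>MN\<^esub> z) MN"
proof -
  interpret MN: left_module A MN by (rule left_module_MN)
  have fgN: "fg_module A (quot_mod I N)" by (rule fg_quot[OF fgI N])
  let ?Y = "dsum (I\<lparr>carrier := M\<rparr>) LN" and ?f = "\<lambda>x. (x, N +>\<^bsub>I\<^esub> x)" and ?g = "\<lambda>(y, z). (N +>\<^bsub>I\<^esub> y) \<ominus>\<^bsub>MN\<^esub> z"
  have LNMN: "carrier LN \<subseteq> carrier MN" using LM by auto
  have p: "(\<lambda>x. N +>\<^bsub>I\<^esub> x) \<in> mod_hom A (I\<lparr>carrier := M\<rparr>) MN"
    by (rule mod_hom_sub_codomain[OF mod_hom_sub_domain[OF IN.hom M_carrier]]) simp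
  have i: "(\<lambda>z. z) \<in> mod_hom A LN MN" using LNMN by (auto simp: mod_hom_def)
  have "(\<lambda>d. (N +>\<^bsub>I\<^esub> fst d) \<ominus>\<^bsub>MN\<^esub> snd d) \<in> mod_hom A ?Y MN"
    by (rule mod_hom_minus[OF left_module_MN mod_hom_comp[OF dsum_fst_hom p] mod_hom_comp[OF dsum_snd_hom i]])
  then have g: "?g \<in> mod_hom A ?Y MN" by (simp add: split_def)
  have gz: "?g (y, z) = \<zero>\<^bsub>MN\<^esub> \<longleftrightarrow> N +>\<^bsub>I\<^esub> y = z" if "y \<in> M" "z \<in> carrier LN" for y z
    using MN.minus_eq_zero_iff[of "N +>\<^bsub>I\<^esub> y" z] that LNMN by auto
  have "?f ` carrier (I\<lparr>carrier := L\<rparr>) = a_kernel ?Y MN ?g"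
  proof (intro equalityI subsetI)
    fix d assume "d \<in> ?f ` carrier (I\<lparr>carrier := L\<rparr>)"
    then obtain x where x: "x \<in> L" "d = (x, N +>\<^bsub>I\<^esub> x)" by auto
    then have "x \<in> M" "N +>\<^bsub>I\<^esub> x \<in> carrier LN" using LM by auto
    then show "d \<in> a_kernel ?Y MN ?g" using gz[of x "N +>\<^bsub>I\<^esub> x"] x(2) by (simp add: a_kernel_eq)
  next
    fix d assume d: "d \<in> a_kernel ?Y MN ?g"
    then obtain y z where yz: "d = (y, z)" "y \<in> M" "z \<in> carrier LN" "?g (y, z) = \<zero>\<^bsub>MN\<^esub>"
      by (auto simp: a_kernel_eq)
    then have eq: "N +>\<^bsub>I\<^esub> y = z" using gz by blast
    obtain l where l: "l \<in> L" "z = N +>\<^bsub>I\<^esub> l" using yz(3) by auto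
    have c: "y \<in> carrier I" "l \<in> carrier I" using yz(2) l(1) M_carrier L_carrier by auto
    have "y \<ominus>\<^bsub>I\<^esub> l \<in> N" using I.coset_eq_iff[OF N c] eq l(2) by simp
    then have "y \<in> L" using I.mem_of_minus_mem[OF L c(1) l(1)] NL by blast
    then show "d \<in> ?f ` carrier (I\<lparr>carrier := L\<rparr>)" using yz(1) eq by auto
  qed
  moreover have "?g ` carrier ?Y = carrier MN"
  proof (intro equalityI subsetI)
    show "y \<in> carrier MN" if "y \<in> ?g ` carrier ?Y" for y using that mod_hom_closed[OF g] by blast
    fix y assume "y \<in> carrier MN"
    then obtain m where m: "m \<in> M" "y = N +>\<^bsub>I\<^esub> m" by auto
    have zero: "\<zero>\<^bsub>MN\<^esub> \<in> carrier LN" using submodule_zero_mem[OF LN_submodule] by simp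
    have "?g (m, \<zero>\<^bsub>MN\<^esub>) = y" using MN.minus_zero[of y] m by simp
    then show "y \<in> ?g ` carrier ?Y" using m(1) zero by (intro image_eqI[of _ _ "(m, \<zero>\<^bsub>MN\<^esub>)"]) simp_all
  qed
  moreover have "fg_module A (I\<lparr>carrier := L\<rparr>)" "fg_module A ?Y" "fg_module A MN"
    by (intro fg_sub fg_dsum fgI fgN L M LN_submodule MN_submodule)+
  ultimately show ?thesis
    unfolding short_exact_def using g incl_proj_hom by (auto simp: inj_on_def)
qed

lemma almost_split_sequence:
  assumes "uniserial A MN"
  shows "almost_split_sequence A (I\<lparr>carrier := L\<rparr>) (\<lambda>x. (x, N +>\<^bsub>I\<^esub> x)) (dsum (I\<lparr>carrier := M\<rparr>) LN)
    (\<lambda>(y, z). (N +>\<^bsub>I\<^esub> y) \<ominus>\<^bsub>MN\<^esub> z) MN"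
proof -
  have "fg_module A MN" by (intro fg_sub fg_quot fgI N MN_submodule)
  then have "fin_length A MN" by (rule fg_fin_length)
  then have "right_almost_split A (dsum (I\<lparr>carrier := M\<rparr>) LN) MN (\<lambda>(y, z). (N +>\<^bsub>I\<^esub> y) \<ominus>\<^bsub>MN\<^esub> z)"
    using left_module.uniserial_endo[OF left_module_MN _ assms]
    by (intro right_almost_split_of_left[OF short_exact left_almost_split]) blast
  then show ?thesis unfolding almost_split_sequence_def using short_exact left_almost_split by blast
qed

end

section \<open>Radical layers under a uniserial quotient\<close>

lemma uniserial_quot_comparable:
  assumes X: "left_module A X" and D: "submodule D A X" and us: "uniserial A (quot_mod X D)"
    and H: "submodule H A X" "D \<subseteq> H" and K: "submodule K A X" "D \<subseteq> K"
  shows "H \<subseteq> K \<or> K \<subseteq> H"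
proof -
  interpret X: left_module A X by fact
  interpret q: module_hom A X "quot_mod X D" "\<lambda>x. D +>\<^bsub>X\<^esub> x" by (rule X.quot_proj_module_hom[OF D])
  have lift: "G \<subseteq> G'" if G: "submodule G A X" "submodule G' A X" "D \<subseteq> G'"
    and le: "(\<lambda>x. D +>\<^bsub>X\<^esub> x) ` G \<subseteq> (\<lambda>x. D +>\<^bsub>X\<^esub> x) ` G'" for G G'
  proof
    fix x assume x: "x \<in> G"
    then obtain y where y: "y \<in> G'" "D +>\<^bsub>X\<^esub> x = D +>\<^bsub>X\<^esub> y" using le by blast
    have c: "x \<in> carrier X" "y \<in> carrier X" using x y(1) submodule_subset[OF G(1)] submodule_subset[OF G(2)] by auto
    have "x \<ominus>\<^bsub>X\<^esub> y \<in> G'" using X.coset_eq_iff[OF D c] y(2) G(3) by blast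
    then show "x \<in> G'" by (rule X.mem_of_minus_mem[OF G(2) c(1) y(1)])
  qed
  show ?thesis
    using us q.image_submodule[OF H(1)] q.image_submodule[OF K(1)] lift[OF H(1) K] lift[OF K(1) H]
    unfolding uniserial_def by blast
qed

context artin_algebra
begin

lemma rad_pow_antimono: "left_module A X \<Longrightarrow> rad_pow A X (i + k) \<subseteq> rad_pow A X i"
  by (induction k) (auto dest: subsetD[OF left_module.rad_pow_Suc_subset] simp del: rad_pow.simps(2))

text \<open>The bound on \<open>i\<close> keeps \<open>J^n X\<close> below the interval, so its
  submodules are compared inside \<open>top^n X\<close>.\<close>

lemma uniserial_rad_pow_step:
  assumes X: "left_module A X" and us: "uniserial A (top_pow A n X)" and i: "Suc i \<le> n"
  shows "simple_step A X (rad_pow A X (Suc i)) (rad_pow A X i)"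
proof -
  interpret X: left_module A X by fact
  note rs = X.rad_pow_submodule
  have le: "rad_pow A X n \<subseteq> rad_pow A X (Suc i)" using rad_pow_antimono[OF X, of "Suc i" "n - Suc i"] i by simp
  show ?thesis
  proof (rule X.uniserial_simple_step[OF fg_fin_length[OF fg_regular] rs rs X.rad_pow_Suc_subset])
    show "a \<odot>\<^bsub>X\<^esub> x \<in> rad_pow A X (Suc i)" if "a \<in> jacobson_radical A" "x \<in> rad_pow A X i" for a x
      by (rule X.rad_pow_Suc_mem[OF that])
    show "H \<subseteq> K \<or> K \<subseteq> H"
      if "submodule H A X" "submodule K A X" "rad_pow A X (Suc i) \<subseteq> H" "rad_pow A X (Suc i) \<subseteq> K" for H K
      by (rule uniserial_quot_comparable[OF X rs us[unfolded top_pow_def] that(1) order_trans[OF le that(3)]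
            that(2) order_trans[OF le that(4)]])
  qed
qed

text \<open>If \<open>A b\<close> were proper in \<open>J^i X\<close>, the submodule
  \<open>K\<close> from \<open>exists_maximal_below\<close> would contain both \<open>b\<close> and
  \<open>J^(i+1) X\<close>. But \<open>b\<close> generates \<open>J^i X\<close> modulo
  \<open>J^(i+1) X\<close>, as this layer is simple.\<close>

lemma rad_pow_cyclic:
  assumes X: "fg_module A X" and us: "uniserial A (top_pow A n X)" and i: "Suc i \<le> n"
    and b: "b \<in> rad_pow A X i" "b \<notin> rad_pow A X (Suc i)"
  shows "rad_pow A X i = (\<lambda>a. a \<odot>\<^bsub>X\<^esub> b) ` carrier A"
proof -
  interpret X: left_module A X by (rule fg_left_module[OF X])
  let ?C = "rad_pow A X i" and ?B = "(\<lambda>a. a \<odot>\<^bsub>X\<^esub> b) ` carrier A"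
  have C: "submodule ?C A X" by (rule X.rad_pow_submodule)
  have bc: "b \<in> carrier X" using b(1) submodule_subset[OF C] by blast
  have B: "submodule ?B A X" by (rule X.submodule_cyclic[OF bc])
  have BC: "?B \<subseteq> ?C" by (rule X.cyclic_least[OF C b(1)])
  have "?B = ?C"
  proof (rule ccontr)
    assume "?B \<noteq> ?C"
    then have "?B \<subset> ?C" using BC by blast
    from X.exists_maximal_below[OF fg_fin_length[OF X] B C this]
    obtain K where K: "submodule K A X" "?B \<subseteq> K" "K \<subset> ?C" "\<forall>a\<in>jacobson_radical A. \<forall>x\<in>?C. a \<odot>\<^bsub>X\<^esub> x \<in> K" by blast
    have rK: "rad_pow A X (Suc i) \<subseteq> K" by (rule X.rad_pow_Suc_least[OF K(1)]) (use K(4) in blast)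
    have "x \<in> K" if x: "x \<in> ?C" for x
    proof -
      obtain a where a: "a \<in> carrier A" "x \<ominus>\<^bsub>X\<^esub> a \<odot>\<^bsub>X\<^esub> b \<in> rad_pow A X (Suc i)"
        using simple_stepD[OF uniserial_rad_pow_step[OF X.left_module_axioms us i] b x] by blast
      have "a \<odot>\<^bsub>X\<^esub> b \<in> K" using a(1) K(2) by blast
      then show ?thesis
        using X.mem_of_minus_mem[OF K(1)] a(2) rK x submodule_subset[OF C] by blast
    qed
    then show False using K(3) by blast
  qed
  then show ?thesis by simp
qed

text \<open>Each simple submodule contains \<open>t\<close>, hence equals \<open>A t\<close>, which
  lies in \<open>N\<close>.\<close>

lemma soc_pow_one_least:
  assumes X: "left_module A X" and t: "t \<in> carrier X" "t \<noteq> \<zero>\<^bsub>X\<^esub>"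
    and t_least: "\<And>H. submodule H A X \<Longrightarrow> H \<noteq> {\<zero>\<^bsub>X\<^esub>} \<Longrightarrow> t \<in> H"
    and N: "submodule N A X" "N \<noteq> {\<zero>\<^bsub>X\<^esub>}"
  shows "soc_pow A X (Suc 0) \<subseteq> N"
proof -
  interpret X: left_module A X by fact
  have fl: "fin_length A (regular_module A)" by (rule fg_fin_length[OF fg_regular])
  have tN: "t \<in> N" by (rule t_least[OF N])
  have "S \<subseteq> N" if "simple_submodule A X S" for S
  proof
    fix x assume x: "x \<in> S"
    have S: "submodule S A X" "S \<noteq> {\<zero>\<^bsub>X\<^esub>}" "simple_step A X {\<zero>\<^bsub>X\<^esub>} S"
      using that by (auto simp: X.simple_submodule_iff)
    obtain a where a: "a \<in> carrier A" "x \<ominus>\<^bsub>X\<^esub> a \<odot>\<^bsub>X\<^esub> t = \<zero>\<^bsub>X\<^esub>"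
      using simple_stepD[OF S(3) t_least[OF S(1,2)] _ x] t(2) by blast
    have "a \<odot>\<^bsub>X\<^esub> t \<in> N" by (rule submodule_smult_mem[OF N(1) a(1) tN])
    then show "x \<in> N"
      using X.mem_of_minus_mem[OF N(1)] a(2) submodule_zero_mem[OF N(1)] x submodule_subset[OF S(1)] by force
  qed
  then have "socle A X \<subseteq> N" unfolding socle_def by (intro X.submodule_gen_least[OF N(1)]) blast
  then show ?thesis using X.soc_pow_Suc[OF fl, of 0] X.socle_eq_rad_colon[OF fl] by simp
qed

end

section \<open>Verification of the abstract setting from the radical and socle series\<close>

theorem theorem2p2p4:
  fixes R :: "('r, 'c) ring_scheme"
    and A :: "('r, 'a) module"
    and I :: "('a, 'm) module"
    and P :: "('a, 'p) module"
    and N L M :: "'m set"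
    and s :: nat
  assumes "artin_algebra R A"
    and "injective_fg A I"
    and "indecomposable A I"
    and "submodule N A I"
    and "N \<noteq> {\<zero>\<^bsub>I\<^esub>}"
    and "s \<ge> 1"
    and "uniserial A (soc_pow_mod A s (quot_mod I N))"
    and "\<not> (\<lambda>x. N +>\<^bsub>I\<^esub> x) ` (soc_pow A I (s + 1) <+>\<^bsub>I\<^esub> N) \<subseteq> soc_pow A (quot_mod I N) (s - 1)"
    and "submodule L A I"
    and "submodule M A I"
    and "N \<subseteq> L"
    and "L \<subseteq> M"
    and "soc_pow A (quot_mod I N) (s - 1) = (\<lambda>x. N +>\<^bsub>I\<^esub> x) ` L"
    and "soc_pow A (quot_mod I N) s = (\<lambda>x. N +>\<^bsub>I\<^esub> x) ` M"
    and "projective_cover A P \<pi> (mod_top A (soc_pow_mod A s (quot_mod I N)))"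
    and "uniserial A (top_pow A (s + 1) P)"
  shows "almost_split_sequence A
      (I\<lparr>carrier := L\<rparr>)
      (\<lambda>x. (x, N +>\<^bsub>I\<^esub> x))
      (dsum (I\<lparr>carrier := M\<rparr>) (soc_pow_mod A (s - 1) (quot_mod I N)))
      (\<lambda>(y, z). (N +>\<^bsub>I\<^esub> y) \<ominus>\<^bsub>soc_pow_mod A s (quot_mod I N)\<^esub> z)
      (soc_pow_mod A s (quot_mod I N))"
proof -
  interpret artin_algebra R A by fact
  note inj = assms(2) and N = assms(4) and L = assms(9) and M = assms(10) and NL = assms(11) and LM = assms(12)
  \<comment> \<open>\<open>r\<close> is the index \<open>s - 1\<close>; with
    \<open>s = Suc r\<close> the recursion of the socle series applies.\<close>
  obtain r where s: "s = Suc r" using assms(6) by (cases s) auto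
  have fl: "fin_length A (regular_module A)" by (rule fg_fin_length[OF fg_regular])
  have fgI: "fg_module A I" using inj by (simp add: injective_fg_def)
  interpret I: left_module A I by (rule fg_left_module[OF fgI])
  let ?Q = "quot_mod I N" and ?q = "\<lambda>x. N +>\<^bsub>I\<^esub> x"
  let ?U = "?Q\<lparr>carrier := ?q ` M\<rparr>"
  interpret q: module_hom A I ?Q ?q by (rule I.quot_proj_module_hom[OF N])
  have Lc: "L \<subseteq> carrier I" and Mc: "M \<subseteq> carrier I" and Nc: "N \<subseteq> carrier I"
    using submodule_subset L M N by blast+
  have NM: "N \<subseteq> M" using NL LM by blast
  have socL: "soc_pow A ?Q r = ?q ` L" and socM: "soc_pow A ?Q (Suc r) = ?q ` M" using assms(13,14) s by simp_all
  have U_def: "soc_pow_mod A s ?Q = ?U" and V_def: "soc_pow_mod A (s - 1) ?Q = ?Q\<lparr>carrier := ?q ` L\<rparr>"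
    unfolding soc_pow_mod_def using assms(13,14) by simp_all
  have us: "uniserial A ?U" using assms(7) U_def by simp
  have qmem: "?q x \<in> ?q ` K \<longleftrightarrow> x \<in> K" if K: "submodule K A I" "N \<subseteq> K" and x: "x \<in> carrier I" for K x
  proof
    assume "?q x \<in> ?q ` K"
    then obtain y where y: "y \<in> K" "?q x = ?q y" by blast
    have yc: "y \<in> carrier I" using y(1) submodule_subset[OF K(1)] by blast
    have "x \<ominus>\<^bsub>I\<^esub> y \<in> K" using I.coset_eq_iff[OF N x yc] y(2) K(2) by blast
    then show "x \<in> K" by (rule I.mem_of_minus_mem[OF K(1) x y(1)])
  qed blast
  have M_iff: "x \<in> M \<longleftrightarrow> (\<forall>a\<in>jacobson_radical A. a \<odot>\<^bsub>I\<^esub> x \<in> L)" if x: "x \<in> carrier I" for x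
  proof -
    have "x \<in> M \<longleftrightarrow> ?q x \<in> rad_colon A ?Q (?q ` L)"
      using qmem[OF M NM x] socM socL q.Y.soc_pow_Suc[OF fl, of r] by simp
    also have "\<dots> \<longleftrightarrow> (\<forall>a\<in>jacobson_radical A. ?q (a \<odot>\<^bsub>I\<^esub> x) \<in> ?q ` L)"
      using q.closed[OF x] q.smult[OF A.jacobson_closed x] by (simp add: rad_colon_def)
    also have "\<dots> \<longleftrightarrow> (\<forall>a\<in>jacobson_radical A. a \<odot>\<^bsub>I\<^esub> x \<in> L)"
      using qmem[OF L NL I.smult_closed[OF A.jacobson_closed x]] by blast
    finally show ?thesis .
  qed
  have qM: "submodule (?q ` M) A ?Q" by (rule q.image_submodule[OF M])
  have comparable: "H \<subseteq> K \<or> K \<subseteq> H"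
    if H: "submodule H A I" "N \<subseteq> H" "H \<subseteq> M" and K: "submodule K A I" "N \<subseteq> K" "K \<subseteq> M" for H K
  proof -
    have "submodule (?q ` H) A ?U" "submodule (?q ` K) A ?U"
      unfolding q.Y.submodule_sub_iff[OF qM]
      by (intro conjI q.image_submodule[OF H(1)] q.image_submodule[OF K(1)] image_mono H(3) K(3))+
    then have le: "?q ` H \<subseteq> ?q ` K \<or> ?q ` K \<subseteq> ?q ` H" using us by (simp only: uniserial_def)
    have "H \<subseteq> K" if "?q ` H \<subseteq> ?q ` K"
    proof
      fix x assume "x \<in> H"
      then show "x \<in> K" using that qmem[OF K(1,2), of x] H(3) Mc by blast
    qed
    moreover have "K \<subseteq> H" if "?q ` K \<subseteq> ?q ` H"
    proof
      fix x assume "x \<in> K"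
      then show "x \<in> H" using that qmem[OF H(1,2), of x] K(3) Mc by blast
    qed
    ultimately show ?thesis using le by blast
  qed
  have step: "simple_step A I L M"
  proof (rule I.uniserial_simple_step[OF fl L M LM])
    show "a \<odot>\<^bsub>I\<^esub> x \<in> L" if "a \<in> jacobson_radical A" "x \<in> M" for a x using M_iff that Mc by blast
    show "H \<subseteq> K \<or> K \<subseteq> H" if "submodule H A I" "submodule K A I" "L \<subseteq> H" "L \<subseteq> K" "H \<subseteq> M" "K \<subseteq> M" for H K
      by (rule comparable[OF that(1) order_trans[OF NL that(3)] that(5) that(2) order_trans[OF NL that(4)] that(6)])
  qed
  \<comment> \<open>A minimal step \<open>K\<close> above \<open>L\<close> inside \<open>Y\<close>
    satisfies \<open>J K \<subseteq> L\<close>, so \<open>K \<subseteq> M\<close>; as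
    \<open>M/L\<close> is simple, \<open>K = M\<close>.\<close>
  have above: "M \<subseteq> Y" if Y: "submodule Y A I" "L \<subset> Y" for Y
  proof -
    from I.exists_minimal_above[OF fg_fin_length[OF fgI] L Y]
    obtain K where K: "submodule K A I" "L \<subset> K" "K \<subseteq> Y" "\<forall>a\<in>jacobson_radical A. \<forall>x\<in>K. a \<odot>\<^bsub>I\<^esub> x \<in> L" by blast
    have KM: "K \<subseteq> M" using M_iff K(4) submodule_subset[OF K(1)] by blast
    obtain y where y: "y \<in> K" "y \<notin> L" using K(2) by blast
    have "x \<in> K" if x: "x \<in> M" for x
    proof -
      have yM: "y \<in> M" using y(1) KM by blast
      obtain a where a: "a \<in> carrier A" "x \<ominus>\<^bsub>I\<^esub> a \<odot>\<^bsub>I\<^esub> y \<in> L" using simple_stepD[OF step yM y(2) x] by blast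
      have "a \<odot>\<^bsub>I\<^esub> y \<in> K" by (rule submodule_smult_mem[OF K(1) a(1) y(1)])
      then show ?thesis using I.mem_of_minus_mem[OF K(1)] a(2) K(2) x Mc by blast
    qed
    then show ?thesis using K(3) by blast
  qed
  obtain t where t: "t \<in> carrier I" "t \<noteq> \<zero>\<^bsub>I\<^esub>" "\<forall>H. submodule H A I \<and> H \<noteq> {\<zero>\<^bsub>I\<^esub>} \<longrightarrow> t \<in> H"
    using injective_indecomposable_socle[OF inj assms(3)] by blast
  then have t_least: "\<And>H. submodule H A I \<Longrightarrow> H \<noteq> {\<zero>\<^bsub>I\<^esub>} \<Longrightarrow> t \<in> H" by blast
  have tN: "t \<in> N" by (rule t_least[OF N assms(5)])
  have soc1: "soc_pow A I (Suc 0) \<subseteq> N"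
    by (rule soc_pow_one_least[OF I.left_module_axioms t(1,2) t_least N assms(5)])
  note S = I.soc_pow_submodule[OF fl]
  \<comment> \<open>The socle of \<open>I\<close> lies in \<open>N\<close>, so each layer of
    \<open>I\<close> maps into the layer of \<open>I/N\<close> with index one less.\<close>
  have soc_sub: "soc_pow A I (Suc s) \<subseteq> M" "soc_pow A I s \<subseteq> L"
  proof -
    show "soc_pow A I (Suc s) \<subseteq> M"
    proof
      fix x assume x: "x \<in> soc_pow A I (Suc s)"
      have "?q x \<in> ?q ` M" using I.soc_pow_quot[OF fl N soc1 x] unfolding s socM .
      then show "x \<in> M" using qmem[OF M NM] x submodule_subset[OF S] by blast
    qed
    show "soc_pow A I s \<subseteq> L"
    proof
      fix x assume x: "x \<in> soc_pow A I s"
      have "?q x \<in> ?q ` L" using I.soc_pow_quot[OF fl N soc1 x[unfolded s]] unfolding socL .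
      then show "x \<in> L" using qmem[OF L NL] x submodule_subset[OF S] by blast
    qed
  qed
  let ?X = "soc_pow A I (Suc s)"
  have "\<not> ?X \<subseteq> L"
  proof
    assume XL: "?X \<subseteq> L"
    have "?q ` (?X <+>\<^bsub>I\<^esub> N) \<subseteq> ?q ` L" by (rule image_mono[OF I.set_add_least[OF L XL NL]])
    then show False using assms(8) unfolding assms(13) by simp
  qed
  then obtain x0 where x0: "x0 \<in> ?X" "x0 \<notin> L" by blast
  have L_psub: "L \<subset> M" using LM x0 soc_sub(1) by blast
  \<comment> \<open>Submodules between \<open>N\<close> and \<open>M\<close> form a chain.
    \<open>D + N\<close> is not below \<open>L\<close>, so it is strictly above \<open>L\<close> and
    reaches \<open>M\<close>.\<close>
  have gen: "M \<subseteq> D <+>\<^bsub>I\<^esub> N" if D: "submodule D A I" "D \<subseteq> M" "\<not> D \<subseteq> L" for D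
  proof -
    note DN = I.submodule_set_add[OF D(1) N] and up = I.set_add_upper1[OF D(1) N] I.set_add_upper2[OF D(1) N]
    have "D <+>\<^bsub>I\<^esub> N \<subseteq> L \<or> L \<subseteq> D <+>\<^bsub>I\<^esub> N"
      by (rule comparable[OF DN up(2) I.set_add_least[OF M D(2) NM] L NL LM])
    then have "L \<subset> D <+>\<^bsub>I\<^esub> N" using up(1) D(3) by blast
    then show ?thesis by (rule above[OF DN])
  qed
  have XM: "M \<subseteq> ?X <+>\<^bsub>I\<^esub> N" using gen[OF S soc_sub(1)] x0 by blast

  have lmU: "left_module A ?U" by (rule q.Y.left_module_sub[OF qM])
  interpret U: left_module A ?U by (rule lmU)
  let ?JU = "rad_pow A ?U 1"
  have JU: "submodule ?JU A ?U" by (rule U.rad_pow_submodule)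
  have qL: "submodule (?q ` L) A ?U"
    unfolding q.Y.submodule_sub_iff[OF qM] by (intro conjI q.image_submodule[OF L] image_mono LM)
  \<comment> \<open>Two elements of \<open>M/N\<close> with the same class in the top differ by an
    element of \<open>L/N\<close>. So the lift \<open>\<phi>\<close> is known modulo
    \<open>L\<close>, which suffices to keep its image out of \<open>L\<close>.\<close>
  have JU_L: "?JU \<subseteq> ?q ` L"
    unfolding One_nat_def
  proof (rule U.rad_pow_Suc_least[OF qL])
    fix a y assume a: "a \<in> jacobson_radical A" and "y \<in> rad_pow A ?U 0"
    then obtain m where m: "m \<in> M" "y = ?q m" by auto
    have mc: "m \<in> carrier I" using m(1) Mc by blast
    have "a \<odot>\<^bsub>I\<^esub> m \<in> L" using M_iff[OF mc] m(1) a by blast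
    then show "a \<odot>\<^bsub>?U\<^esub> y \<in> ?q ` L"
      using m(2) q.smult[OF A.jacobson_closed[OF a] mc] by (intro image_eqI[of _ _ "a \<odot>\<^bsub>I\<^esub> m"]) simp_all
  qed
  interpret top: module_hom A ?U "quot_mod ?U ?JU" "\<lambda>y. ?JU +>\<^bsub>?U\<^esub> y" by (rule U.quot_proj_module_hom[OF JU])
  have cover: "projective_cover A P \<pi> (quot_mod ?U ?JU)"
    using assms(15) U_def by (simp add: mod_top_def top_pow_def)
  then have proj: "projective_fg A P" and \<pi>: "\<pi> \<in> mod_hom A P (quot_mod ?U ?JU)" "\<pi> ` carrier P = carrier (quot_mod ?U ?JU)"
    by (auto simp: projective_cover_def)
  have fgP: "fg_module A P" using proj by (simp add: projective_fg_def)
  interpret P: left_module A P by (rule fg_left_module[OF fgP])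
  have fgT: "fg_module A (quot_mod ?U ?JU)" by (intro fg_quot fg_sub fgI N qM JU)
  let ?p = "\<lambda>x. ?JU +>\<^bsub>?U\<^esub> (?q x)"
  have Xc: "?X \<subseteq> carrier I" by (rule submodule_subset[OF S])
  have qX: "?q \<in> mod_hom A (I\<lparr>carrier := ?X\<rparr>) ?U"
    by (rule mod_hom_sub_codomain[OF mod_hom_sub_domain[OF q.hom Xc]]) (use soc_sub(1) in auto)
  have p_hom: "?p \<in> mod_hom A (I\<lparr>carrier := ?X\<rparr>) (quot_mod ?U ?JU)" by (rule mod_hom_comp[OF qX top.hom])
  have p_surj: "?p ` carrier (I\<lparr>carrier := ?X\<rparr>) = carrier (quot_mod ?U ?JU)"
  proof (intro equalityI subsetI)
    show "y \<in> carrier (quot_mod ?U ?JU)" if "y \<in> ?p ` carrier (I\<lparr>carrier := ?X\<rparr>)" for y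
      using that mod_hom_closed[OF p_hom] by blast
    fix y assume "y \<in> carrier (quot_mod ?U ?JU)"
    then obtain m where m: "m \<in> M" "y = ?JU +>\<^bsub>?U\<^esub> (?q m)" unfolding U.quot_carrier by auto
    then have "m \<in> ?X <+>\<^bsub>I\<^esub> N" using XM by blast
    then obtain x n where xn: "x \<in> ?X" "n \<in> N" "m = x \<oplus>\<^bsub>I\<^esub> n" unfolding set_add_iff by blast
    have c: "x \<in> carrier I" "n \<in> carrier I" "m \<in> carrier I" using xn m(1) Xc Nc Mc by auto
    have "m \<ominus>\<^bsub>I\<^esub> x \<in> N" using I.add_minus_cancel(1)[OF c(1,2)] xn by simp
    then have "?q m = ?q x" using I.coset_eq_iff[OF N c(3,1)] by simp
    then show "y \<in> ?p ` carrier (I\<lparr>carrier := ?X\<rparr>)" using m(2) xn(1) by auto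
  qed
  from projective_lift[OF proj fg_sub[OF fgI S] fgT p_hom p_surj \<pi>(1)]
  obtain \<phi> where \<phi>: "\<phi> \<in> mod_hom A P (I\<lparr>carrier := ?X\<rparr>)" "\<forall>x\<in>carrier P. ?p (\<phi> x) = \<pi> x" by (rule bexE)
  have \<phi>I: "\<phi> \<in> mod_hom A P I" by (rule mod_hom_of_sub_codomain[OF \<phi>(1) Xc])
  have \<phi>X: "\<phi> p \<in> ?X" if "p \<in> carrier P" for p using mod_hom_closed[OF \<phi>(1) that] by simp
  interpret \<phi>: module_hom A P I \<phi> by (intro module_homI P.left_module_axioms I.left_module_axioms \<phi>I)
  have \<phi>M: "\<phi> ` carrier P \<subseteq> M" using \<phi>X soc_sub(1) by blast
  have D: "submodule (\<phi> ` carrier P) A I" by (rule \<phi>.image_submodule[OF P.submodule_carrier])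
  have DL: "\<not> \<phi> ` carrier P \<subseteq> L"
  proof
    assume sub: "\<phi> ` carrier P \<subseteq> L"
    have x0M: "x0 \<in> M" using x0(1) soc_sub(1) by blast
    then have "?JU +>\<^bsub>?U\<^esub> (?q x0) \<in> \<pi> ` carrier P" using \<pi>(2) top.closed[of "?q x0"] by simp
    then obtain p where p: "p \<in> carrier P" "?JU +>\<^bsub>?U\<^esub> (?q x0) = ?p (\<phi> p)" using \<phi>(2) by fastforce
    have \<phi>p: "\<phi> p \<in> L" "\<phi> p \<in> M" using p(1) sub LM by auto
    then have c: "?q x0 \<in> carrier ?U" "?q (\<phi> p) \<in> carrier ?U" "?q (\<phi> p) \<in> ?q ` L" using x0M by auto
    have "?q x0 \<ominus>\<^bsub>?U\<^esub> ?q (\<phi> p) \<in> ?q ` L" using U.coset_eq_iff[OF JU c(1,2)] p(2) JU_L by blast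
    then have "?q x0 \<in> ?q ` L" by (rule U.mem_of_minus_mem[OF qL c(1,3)])
    then show False using qmem[OF L NL] x0(2) x0M Mc by blast
  qed
  have M_gen: "\<exists>p\<in>carrier P. m \<ominus>\<^bsub>I\<^esub> \<phi> p \<in> N" if m: "m \<in> M" for m
  proof -
    have "m \<in> \<phi> ` carrier P <+>\<^bsub>I\<^esub> N" using gen[OF D \<phi>M DL] m by blast
    then obtain p n where pn: "p \<in> carrier P" "n \<in> N" "m = \<phi> p \<oplus>\<^bsub>I\<^esub> n" unfolding set_add_iff by blast
    have c: "\<phi> p \<in> carrier I" "n \<in> carrier I" using \<phi>.closed[OF pn(1)] pn(2) Nc by auto
    then show ?thesis using pn I.add_minus_cancel(1)[OF c] by (intro bexI[of _ p]) simp_all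
  qed

  \<comment> \<open>Here \<open>s + 1\<close> enters: a map into
    \<open>soc\<^sup>s\<^sup>+\<^sup>1 I\<close> kills \<open>J\<^sup>s\<^sup>+\<^sup>1 P\<close>,
    whereas a map whose image is not in \<open>L\<close>, and so not in
    \<open>soc\<^sup>s I\<close>, is nonzero on \<open>J\<^sup>s P\<close>.\<close>
  have rad_kill: "\<forall>x\<in>rad_pow A P (Suc s). \<phi> x = \<zero>\<^bsub>I\<^esub>" using \<phi>.rad_pow_kernel_iff[OF fl, of "Suc s"] \<phi>X by blast
  have not_kill: "\<exists>x\<in>rad_pow A P s. w x \<noteq> \<zero>\<^bsub>I\<^esub>"
    if w: "w \<in> mod_hom A P I" and wL: "\<not> w ` carrier P \<subseteq> L" for w
  proof -
    interpret w: module_hom A P I w by (intro module_homI P.left_module_axioms I.left_module_axioms w)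
    show ?thesis using w.rad_pow_kernel_iff[OF fl, of s] wL soc_sub(2) by blast
  qed
  have rs: "submodule (rad_pow A P i) A P" for i by (rule P.rad_pow_submodule)
  have "t \<in> \<phi> ` rad_pow A P s"
  proof (rule t_least[OF \<phi>.image_submodule[OF rs]])
    show "\<phi> ` rad_pow A P s \<noteq> {\<zero>\<^bsub>I\<^esub>}" using not_kill[OF \<phi>I DL] by blast
  qed
  then obtain b0 where b0: "b0 \<in> rad_pow A P s" "\<phi> b0 = t" by blast
  have b0c: "b0 \<in> carrier P" using b0(1) submodule_subset[OF rs] by blast
  have "\<exists>c\<in>carrier A. c \<odot>\<^bsub>I\<^esub> (a \<odot>\<^bsub>I\<^esub> t) = t" if a: "a \<in> carrier A" "a \<odot>\<^bsub>I\<^esub> t \<noteq> \<zero>\<^bsub>I\<^esub>" for a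
  proof -
    have atc: "a \<odot>\<^bsub>I\<^esub> t \<in> carrier I" by (rule I.smult_closed[OF a(1) t(1)])
    have "t \<in> (\<lambda>c. c \<odot>\<^bsub>I\<^esub> (a \<odot>\<^bsub>I\<^esub> t)) ` carrier A"
      using t_least[OF I.submodule_cyclic[OF atc]] I.cyclic_self[OF atc] a(2) by blast
    then show ?thesis by force
  qed
  from exists_local_idempotent[OF I.left_module_axioms t(1,2) this]
  obtain f where f: "f \<in> carrier A" "f \<odot>\<^bsub>I\<^esub> t = t" "f \<otimes>\<^bsub>A\<^esub> f = f"
    "\<forall>y\<in>carrier A. (y \<otimes>\<^bsub>A\<^esub> f) \<odot>\<^bsub>I\<^esub> t \<noteq> \<zero>\<^bsub>I\<^esub> \<longrightarrow> (\<exists>a\<in>carrier A. a \<otimes>\<^bsub>A\<^esub> (y \<otimes>\<^bsub>A\<^esub> f) = f)" by blast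
  \<comment> \<open>Multiplication by \<open>f\<close> makes \<open>b\<close> fixed by
    \<open>f\<close> and keeps \<open>\<phi> b = t\<close>, because \<open>f t = t\<close>.\<close>
  define b where "b = f \<odot>\<^bsub>P\<^esub> b0"
  have bc: "b \<in> carrier P" unfolding b_def by (rule P.smult_closed[OF f(1) b0c])
  have bs: "b \<in> rad_pow A P s" unfolding b_def by (rule submodule_smult_mem[OF rs f(1) b0(1)])
  have \<phi>b: "\<phi> b = t" using \<phi>.smult[OF f(1) b0c] b0(2) f(2) by (simp add: b_def)
  have fb: "f \<odot>\<^bsub>P\<^esub> b = b" using P.smult_assoc1[OF f(1) f(1) b0c] f(3) by (simp add: b_def)
  have b_not: "b \<notin> rad_pow A P (Suc s)" using rad_kill \<phi>b t(2) by auto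
  have usP: "uniserial A (top_pow A (Suc s) P)" using assms(16) by simp
  have rad_s: "rad_pow A P s = (\<lambda>a. a \<odot>\<^bsub>P\<^esub> b) ` carrier A"
    by (rule rad_pow_cyclic[OF fgP usP _ bs b_not]) simp

  \<comment> \<open>The preimage of \<open>N\<close> contains \<open>J^s P = A b\<close>, so it can
    be compared with \<open>J^(s-1) P\<close> in the uniserial quotient of \<open>P\<close>. If it
    were larger than \<open>J^s P\<close>, it would contain \<open>J^(s-1) P\<close>; then the
    composite \<open>P \<rightarrow> I/N\<close> would kill \<open>J^(s-1) P\<close> and have its
    image in \<open>soc^(s-1)(I/N) = L/N\<close>, contrary to \<open>DL\<close>.\<close>
  have \<phi>_N: "\<exists>a\<in>carrier A. p = a \<odot>\<^bsub>P\<^esub> b" if p: "p \<in> carrier P" "\<phi> p \<in> N" for p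
  proof -
    let ?B = "{p \<in> carrier P. \<phi> p \<in> N}"
    have B: "submodule ?B A P" by (rule \<phi>.vimage_submodule[OF N])
    have sB: "rad_pow A P s \<subseteq> ?B"
    proof
      fix x assume "x \<in> rad_pow A P s"
      then obtain a where a: "a \<in> carrier A" "x = a \<odot>\<^bsub>P\<^esub> b" unfolding rad_s by blast
      then show "x \<in> ?B"
        using \<phi>.smult[OF a(1) bc] \<phi>b submodule_smult_mem[OF N a(1) tN] P.smult_closed[OF a(1) bc] by simp
    qed
    have "?B \<subseteq> rad_pow A P s"
    proof (rule ccontr)
      assume "\<not> ?B \<subseteq> rad_pow A P s"
      then obtain y where y: "y \<in> ?B" "y \<notin> rad_pow A P s" by blast
      have le: "rad_pow A P (Suc s) \<subseteq> rad_pow A P s" "rad_pow A P s \<subseteq> rad_pow A P r"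
        unfolding s by (rule P.rad_pow_Suc_subset)+
      have "?B \<subseteq> rad_pow A P r \<or> rad_pow A P r \<subseteq> ?B"
        using uniserial_quot_comparable[OF P.left_module_axioms rs usP[unfolded top_pow_def] B _ rs] le sB by blast
      then have "rad_pow A P r \<subseteq> ?B"
      proof
        assume "?B \<subseteq> rad_pow A P r"
        then have yr: "y \<in> rad_pow A P r" using y(1) by blast
        have st: "simple_step A P (rad_pow A P s) (rad_pow A P r)"
          unfolding s by (rule uniserial_rad_pow_step[OF P.left_module_axioms usP]) (simp add: s)
        show ?thesis
        proof
          fix x assume x: "x \<in> rad_pow A P r"
          obtain a where a: "a \<in> carrier A" "x \<ominus>\<^bsub>P\<^esub> a \<odot>\<^bsub>P\<^esub> y \<in> rad_pow A P s" using simple_stepD[OF st yr y(2) x] by blast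
          have xc: "x \<in> carrier P" using x submodule_subset[OF rs] by blast
          show "x \<in> ?B"
            by (rule P.mem_of_minus_mem[OF B xc submodule_smult_mem[OF B a(1) y(1)]]) (use a(2) sB in blast)
        qed
      qed
      then have qr: "\<forall>x\<in>rad_pow A P r. ?q (\<phi> x) = \<zero>\<^bsub>?Q\<^esub>"
        using I.coset_eq_self_iff[OF N] Nc by (auto simp: I.quot_zero)
      interpret q\<phi>: module_hom A P ?Q "\<lambda>p. ?q (\<phi> p)"
        by (intro module_homI P.left_module_axioms q.Y.left_module_axioms mod_hom_comp[OF \<phi>I q.hom])
      have "\<forall>x\<in>carrier P. ?q (\<phi> x) \<in> ?q ` L" using qr q\<phi>.rad_pow_kernel_iff[OF fl, of r] socL by blast
      then have "\<phi> ` carrier P \<subseteq> L" using qmem[OF L NL] \<phi>.closed by blast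
      then show False using DL by blast
    qed
    then show ?thesis using p unfolding rad_s by blast
  qed

  \<comment> \<open>\<open>\<phi> - \<zeta>\<close> would kill \<open>b\<close>, hence
    \<open>J^s P = A b\<close>, and so map into \<open>soc^s I \<subseteq> L\<close>; with
    \<open>\<zeta>\<close> also \<open>\<phi>\<close> would map into \<open>L\<close>.\<close>
  have not_in_L: "\<zeta> b \<noteq> t" if \<zeta>: "\<zeta> \<in> mod_hom A P I" "\<zeta> ` carrier P \<subseteq> L" for \<zeta>
  proof
    assume \<zeta>b: "\<zeta> b = t"
    have \<delta>: "(\<lambda>p. \<phi> p \<ominus>\<^bsub>I\<^esub> \<zeta> p) \<in> mod_hom A P I" by (rule mod_hom_minus[OF I.left_module_axioms \<phi>I \<zeta>(1)])
    have "\<not> (\<lambda>p. \<phi> p \<ominus>\<^bsub>I\<^esub> \<zeta> p) ` carrier P \<subseteq> L"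
    proof
      assume sub: "(\<lambda>p. \<phi> p \<ominus>\<^bsub>I\<^esub> \<zeta> p) ` carrier P \<subseteq> L"
      have "\<phi> p \<in> L" if p: "p \<in> carrier P" for p
      proof (rule I.mem_of_minus_mem[OF L \<phi>.closed[OF p]])
        show "\<zeta> p \<in> L" using \<zeta>(2) p by blast
        show "\<phi> p \<ominus>\<^bsub>I\<^esub> \<zeta> p \<in> L" using sub p by blast
      qed
      then show False using DL by blast
    qed
    from not_kill[OF \<delta> this] obtain x where x: "x \<in> rad_pow A P s" "\<phi> x \<ominus>\<^bsub>I\<^esub> \<zeta> x \<noteq> \<zero>\<^bsub>I\<^esub>" by blast
    then obtain a where a: "a \<in> carrier A" "x = a \<odot>\<^bsub>P\<^esub> b" unfolding rad_s by blast
    have "\<phi> x = \<zeta> x" using \<phi>.smult[OF a(1) bc] mod_hom_smult[OF \<zeta>(1) a(1) bc] a(2) \<phi>b \<zeta>b by simp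
    then show False
      using x I.minus_eq_zero_iff[of "\<phi> x" "\<zeta> x"] \<phi>.closed[of x] submodule_subset[OF rs] by (metis subsetD)
  qed

  have f_local: "\<exists>a\<in>carrier A. a \<otimes>\<^bsub>A\<^esub> (y \<otimes>\<^bsub>A\<^esub> f) = f"
    if "y \<in> carrier A" "(y \<otimes>\<^bsub>A\<^esub> f) \<odot>\<^bsub>I\<^esub> t \<noteq> \<zero>\<^bsub>I\<^esub>" for y
    using f(4) that by blast
  have "uniserial_setup_axioms A I N L M P \<phi> b t f"
    by (rule uniserial_setup_axioms.intro)
      (fact inj, fact proj, fact N, fact L, fact M, fact NL, fact L_psub, fact above, fact tN, fact t(2),
        fact t_least, fact \<phi>I, fact \<phi>M, fact bc, fact \<phi>b, fact M_gen, fact \<phi>_N, fact not_in_L,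
        fact f(1), fact f(3), fact f(2), fact fb, fact f_local)
  then interpret uniserial_setup R A I N L M P \<phi> b t f
    by (intro uniserial_setup.intro assms(1))
  show ?thesis unfolding U_def V_def by (rule almost_split_sequence[OF us])
qed

end
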